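(* Let $\alpha>2$ and for $R>0$ let $$D_R^\alpha=\{(z,t)\in\mathbb{R}^2\times\mathbb{R}: |z|^\alpha+|t|^\alpha\le R^\alpha\},$$ with $|D_R^\alpha|$ its Lebesgue measure. Then, as $R\to\infty$, $$\Big|\#(\mathbb{Z}^3\cap D_R^\alpha)-|D_R^\alpha|\Big|=O\Big(\big(R^{3/2}+R^{2-\frac2\alpha}\big)\log R\Big).$$
   Context: $|z|$ denotes the Euclidean norm on $\mathbb{R}^2$; $D_R^\alpha$ is the Euclidean dilate $\{(Rz,Rt):(z,t)\in D_1^\alpha\}$. *)

theory Defs
  imports "HOL-Analysis.Analysis" "HOL-Library.Landau_Symbols"
begin

text \<open>On the exponents used (positive), \<open>powr\<close> agrees with the usual power of a nonnegative
  real, including at base \<open>0\<close>, where it is \<open>0\<close>.\<close>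

definition super_ball :: "real \<Rightarrow> real \<Rightarrow> ((real^2) \<times> real) set" where
  "super_ball \<alpha> R = {(z, t). norm z powr \<alpha> + \<bar>t\<bar> powr \<alpha> \<le> R powr \<alpha>}"

definition int_lattice3 :: "((real^2) \<times> real) set" where
  "int_lattice3 = {(z, t). (\<forall>i. z $ i \<in> \<int>) \<and> t \<in> \<int>}"

text \<open>Since \<open>card\<close> is \<open>0\<close> on infinite sets and \<open>measure\<close> is \<open>0\<close> on sets of infinite measure, the
  next two facts are needed for both to take their intended values on \<open>super_ball\<close>.\<close>

lemma super_ball_subset:
  assumes "\<alpha> > 0" "R > 0"
  shows "super_ball \<alpha> R \<subseteq> cball 0 R \<times> cball 0 R"
proof
  fix p assume "p \<in> super_ball \<alpha> R"
  then obtain z t where p: "p = (z, t)"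
    and h: "norm z powr \<alpha> + \<bar>t\<bar> powr \<alpha> \<le> R powr \<alpha>"
    by (auto simp: super_ball_def)
  have "norm z powr \<alpha> \<le> R powr \<alpha>" "\<bar>t\<bar> powr \<alpha> \<le> R powr \<alpha>"
    using h powr_ge_zero[of "norm z" \<alpha>] powr_ge_zero[of "\<bar>t\<bar>" \<alpha>] by linarith+
  then have "norm z \<le> R" "\<bar>t\<bar> \<le> R"
    using assms powr_less_mono2[of \<alpha> R "norm z"] powr_less_mono2[of \<alpha> R "\<bar>t\<bar>"]
    by fastforce+
  then show "p \<in> cball 0 R \<times> cball 0 R" by (simp add: p)
qed

lemma finite_int_lattice3_super_ball:
  assumes "\<alpha> > 0" "R > 0"
  shows "finite (int_lattice3 \<inter> super_ball \<alpha> R)"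
proof -
  let ?I = "{x::real. x \<in> \<int> \<and> \<bar>x\<bar> \<le> R}"
  have fin: "finite ?I" by (rule finite_abs_int_segment)
  have "int_lattice3 \<inter> super_ball \<alpha> R \<subseteq> {z::real^2. \<forall>i. z $ i \<in> ?I} \<times> ?I"
  proof
    fix p assume p: "p \<in> int_lattice3 \<inter> super_ball \<alpha> R"
    then obtain z t where zt: "p = (z, t)" "\<forall>i. z $ i \<in> \<int>" "t \<in> \<int>"
      by (auto simp: int_lattice3_def)
    have "norm z \<le> R" "\<bar>t\<bar> \<le> R"
      using p zt super_ball_subset[OF assms] by auto
    moreover have "\<bar>z $ i\<bar> \<le> R" for i
      using component_le_norm_cart[of z i] \<open>norm z \<le> R\<close> by linarith
    ultimately show "p \<in> {z::real^2. \<forall>i. z $ i \<in> ?I} \<times> ?I"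
      using zt by auto
  qed
  moreover have "finite {z::real^2. \<forall>i. z $ i \<in> ?I}"
  proof (rule finite_subset)
    show "{z::real^2. \<forall>i. z $ i \<in> ?I} \<subseteq> vec_lambda ` (PiE UNIV (\<lambda>_. ?I))"
    proof
      fix z :: "real^2" assume "z \<in> {z. \<forall>i. z $ i \<in> ?I}"
      then have "vec_nth z \<in> PiE UNIV (\<lambda>_. ?I)" by auto
      then have "vec_lambda (vec_nth z) \<in> vec_lambda ` (PiE UNIV (\<lambda>_. ?I))"
        by (rule imageI)
      then show "z \<in> vec_lambda ` (PiE UNIV (\<lambda>_. ?I))" by (simp only: vec_nth_inverse)
    qed
    show "finite (vec_lambda ` (PiE (UNIV :: 2 set) (\<lambda>_. ?I)))"
      by (intro finite_imageI finite_PiE fin) simp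
  qed
  ultimately show ?thesis
    using fin by (blast intro: finite_subset finite_cartesian_product)
qed

lemma super_ball_eq_dilate:
  assumes "R > 0"
  shows "super_ball \<alpha> R = (\<lambda>p. R *\<^sub>R p) ` super_ball \<alpha> 1"
proof -
  have scale: "(R *\<^sub>R z, R * t) \<in> super_ball \<alpha> R \<longleftrightarrow> (z, t) \<in> super_ball \<alpha> 1" for z t
    using assms
    by (simp add: super_ball_def powr_mult abs_mult flip: distrib_left)
  show ?thesis
  proof (intro set_eqI iffI)
    fix p assume p: "p \<in> super_ball \<alpha> R"
    define q where "q = inverse R *\<^sub>R p"
    have "p = R *\<^sub>R q" using assms by (simp add: q_def)
    moreover have "q \<in> super_ball \<alpha> 1"
      using scale[of "fst q" "snd q"] p \<open>p = R *\<^sub>R q\<close> by (cases q) simp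
    ultimately show "p \<in> (\<lambda>p. R *\<^sub>R p) ` super_ball \<alpha> 1" by blast
  next
    fix p assume "p \<in> (\<lambda>p. R *\<^sub>R p) ` super_ball \<alpha> 1"
    then show "p \<in> super_ball \<alpha> R" using scale by auto
  qed
qed

end

theory Submission
  imports Defs "HOL-Real_Asymp.Real_Asymp"
begin

text \<open>Slice the body by the planes \<open>t = const\<close>: the slice at an integer \<open>t\<close> is a disc of radius
  \<open>\<rho>(t) = (R\<^sup>\<alpha> - |t|\<^sup>\<alpha>)\<^sup>1\<^sup>/\<^sup>\<alpha>\<close>, and the areas \<open>\<pi> \<rho>(t)\<^sup>2\<close>, being concave in \<open>t\<close>, sum to the volume up to
  \<open>O(R\<^sup>2\<^sup>-\<^sup>2\<^sup>/\<^sup>\<alpha>)\<close> by the trapezoidal rule. The discrepancy of each disc is sandwiched between two smoothed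
  counts, where the smoothing is by the positive kernel proportional to \<open>cos\<^sup>2\<^sup>P (\<pi> x) cos\<^sup>2\<^sup>P (\<pi> y)\<close> with
  \<open>P\<close> about \<open>R\<close>; its width \<open>R\<^sup>-\<^sup>1\<^sup>/\<^sup>2\<close> (up to a logarithm) costs \<open>R\<^sup>1\<^sup>/\<^sup>2\<close> per slice. The smoothed
  count is a finite trigonometric sum over frequencies \<open>m\<close>, essentially \<open>|m| \<le> R\<^sup>1\<^sup>/\<^sup>2\<close>, whose terms are
  asymptotic to \<open>\<rho>\<^sup>1\<^sup>/\<^sup>2 |m|\<^sup>-\<^sup>3\<^sup>/\<^sup>2\<close> times a wave \<open>e(|m| \<rho>(t))\<close>. Summing over \<open>t\<close> first, van der Corput's second
  difference test on dyadic ranges of the curvature of \<open>\<rho>\<close> gives the saving; the slices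
  \<open>|t| \<le> R\<^sup>1\<^sup>-\<^sup>1\<^sup>/\<^sup>\<alpha>\<close>, where the curvature degenerates, are estimated trivially.\<close>

section \<open>Exponential sums\<close>

text \<open>The kernel is a trigonometric polynomial, so its Fourier expansion is the binomial
  theorem and the smoothed count is a finite sum: neither Poisson summation nor any convergence
  question enters. A positive kernel of width \<open>d\<close> compares the count with smoothed
  counts at radii \<open>\<rho>(t) + 2d\<close> and \<open>\<rho>(t) - 2d\<close>. All exponential
  sums are therefore bounded uniformly in a constant shift \<open>\<sigma>\<close> of the radius,
  which leaves second differences unchanged. The obstacle is the equator: for \<alpha> > 2 the
  curvature \<open>-\<rho>''(t)\<close> vanishes at \<open>t = 0\<close>, to order
  \<open>t^(\<alpha>-2) R^(1-\<alpha>)\<close>. At \<open>t0 = R^(1-1/\<alpha>)\<close> it is about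
  \<open>t0^(-2)\<close>, so that the term \<open>1 / sqrt \<mu>\<close> of the second difference
  test, at frequency 1, has the size of the number of slices below \<open>t0\<close>; this fixes the
  cut. Up to logarithms, a frequency of length \<open>q\<close> then contributes
  \<open>R/q + R^(3/2-1/\<alpha>) q^(-3/2)\<close>. At the poles the radius drops to 0 and the
  expansion of the disc transform fails, so the two outermost slices at either end are counted
  trivially; their areas are \<open>O(R^(2-2/\<alpha>))\<close>.\<close>

text \<open>Jordan's inequality: on \<open>[0, 1/2]\<close> the concave sine lies above its chord,
  and the other half follows by reflection. It turns a distance from the integers into a lower bound
  for the sine, both in the Kusmin-Landau inequality and in the tail bound for the kernel.\<close>

lemma sin_pi_ge:
  fixes d t :: real
  assumes "0 < t" "t \<le> d" "d \<le> 1 - t"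
  shows "2 * t \<le> sin (pi * d)"
proof -
  have conc: "2 * y \<le> sin (pi * y)" if "0 \<le> y" "y \<le> 1/2" for y :: real
  proof -
    have cv: "convex_on {0..pi} (\<lambda>x. - sin x)"
    proof (rule f''_ge0_imp_convex)
      show "((\<lambda>x. - sin x) has_real_derivative - cos x) (at x)" if "x \<in> {0..pi}" for x
        by (auto intro!: derivative_eq_intros)
      show "((\<lambda>x. - cos x) has_real_derivative sin x) (at x)" if "x \<in> {0..pi}" for x
        by (auto intro!: derivative_eq_intros)
      show "0 \<le> sin x" if "x \<in> {0..pi}" for x using that by (auto intro: sin_ge_zero)
    qed auto
    have "- sin ((1 - 2*y) *\<^sub>R 0 + (2*y) *\<^sub>R (pi/2)) \<le> (1 - 2*y) * (- sin 0) + (2*y) * (- sin (pi/2))"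
      using that by (intro convex_onD[OF cv]) auto
    then show ?thesis by (simp add: mult.commute)
  qed
  show ?thesis
  proof (cases "d \<le> 1/2")
    case True
    then show ?thesis using conc[of d] assms by linarith
  next
    case False
    have "sin (pi * (1 - d)) = sin (pi * d)"
      by (simp add: right_diff_distrib sin_diff)
    then have "2 * (1 - d) \<le> sin (pi * d)" using conc[of "1 - d"] assms False by simp
    moreover have "2 * t \<le> 2 * (1 - d)" using assms by simp
    ultimately show ?thesis by (rule order.trans[rotated])
  qed
qed

lemma cot_pi_mono:
  fixes a b :: real
  assumes "0 < a" "a \<le> b" "b < 1"
  shows "cot (pi * b) \<le> cot (pi * a)"
proof -
  have s: "sin (pi * a) > 0" "sin (pi * b) > 0"
    using assms by (auto intro!: sin_gt_zero)
  have "sin (pi * b - pi * a) \<ge> 0"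
    using assms mult_left_mono[of b 1 pi] mult_left_mono[of a b pi] pi_gt_zero
    by (intro sin_ge_zero) (auto intro: order.trans[of _ "pi * b"])
  moreover have "cot (pi * a) - cot (pi * b) = sin (pi * b - pi * a) / (sin (pi * a) * sin (pi * b))"
    using s unfolding cot_def sin_diff by (simp add: field_simps)
  ultimately have "0 \<le> cot (pi * a) - cot (pi * b)" using s by simp
  then show ?thesis by simp
qed

text \<open>The Kusmin--Landau inequality. If \<open>d\<^sub>n = x\<^sub>n\<^sub>+\<^sub>1 - x\<^sub>n\<close> then \<open>e(x\<^sub>n) = c\<^sub>n (e(x\<^sub>n) - e(x\<^sub>n\<^sub>+\<^sub>1))\<close> with
  \<open>c\<^sub>n = (1 + i cot (\<pi> d\<^sub>n)) / 2\<close>, and monotonicity of the cotangent bounds the variation of \<open>c\<close>.\<close>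

lemma kusmin_landau:
  fixes x :: "nat \<Rightarrow> real" and k :: int
  assumes \<theta>: "0 < \<theta>"
    and d: "\<And>n. a \<le> n \<Longrightarrow> n < b \<Longrightarrow> of_int k + \<theta> \<le> x (n+1) - x n \<and> x (n+1) - x n \<le> of_int k + 1 - \<theta>"
    and mono: "\<And>n. a \<le> n \<Longrightarrow> n + 1 < b \<Longrightarrow> x (n+1) - x n \<le> x (n+2) - x (n+1)"
  shows "norm (\<Sum>n\<in>{a..<b}. cis (2 * pi * x n)) \<le> 1 / \<theta>"
proof (cases "a < b")
  case False
  then show ?thesis using \<theta> by simp
next
  case True
  define dd where "dd n = x (n+1) - x n - of_int k" for n
  define u where "u n = cis (2 * pi * x n)" for n
  define c where "c n = Complex (1/2) (cot (pi * dd n) / 2)" for n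
  have rng: "\<theta> \<le> dd n" "dd n \<le> 1 - \<theta>" if "a \<le> n" "n < b" for n
    using d[OF that] by (auto simp: dd_def)
  have sn: "2 * \<theta> \<le> sin (pi * dd n)" if "a \<le> n" "n < b" for n
    by (rule sin_pi_ge) (use rng[OF that] \<theta> in auto)
  have key: "u n + u (Suc n) * c n = u n * c n" if n: "a \<le> n" "n < b" for n
  proof -
    have s0: "sin (pi * dd n) \<noteq> 0" using sn[OF n] \<theta> by linarith
    have "cis (2 * pi * x (Suc n)) = cis (2 * pi * x n + 2 * (pi * dd n) + 2 * pi * of_int k)"
      by (simp add: dd_def algebra_simps)
    also have "\<dots> = cis (2 * pi * x n) * cis (2 * (pi * dd n)) * cis (2 * pi * of_int k)"
      by (simp only: cis_mult)
    also have "cis (2 * pi * of_int k) = 1" by (rule cis_multiple_2pi) auto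
    finally have e: "u (Suc n) = u n * cis (2 * (pi * dd n))" by (simp add: u_def)
    have sc: "sin (pi * dd n) ^ 2 + cos (pi * dd n) ^ 2 = 1" by simp
    define S C where "S = sin (pi * dd n)" and "C = cos (pi * dd n)"
    have sc: "C * C = 1 - S * S" using sc by (simp add: S_def C_def power2_eq_square)
    have e1: "cis (2 * (pi * dd n)) = Complex (1 - 2 * (S * S)) (2 * (S * C))"
      using sc unfolding complex_eq_iff cis.sel complex.sel sin_double cos_double S_def[symmetric] C_def[symmetric]
      by (simp add: power2_eq_square)
    have e2: "c n = Complex (1/2) (C / S / 2)" by (simp add: c_def cot_def S_def C_def)
    have "S \<noteq> 0" using s0 by (simp add: S_def)
    then have "1 + cis (2 * (pi * dd n)) * c n = c n"
      using sc unfolding e1 e2 by (simp add: complex_eq_iff field_simps)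
    then have "u n * (1 + cis (2 * (pi * dd n)) * c n) = u n * c n" by simp
    then show ?thesis by (simp add: e algebra_simps)
  qed
  have nu: "norm (u n) = 1" for n by (simp add: u_def)
  \<comment> \<open>Summation by parts: with the boundary term \<open>u (Suc m) * c m\<close>
    included, each step adds only \<open>u (Suc m) * (c (Suc m) - c m)\<close>. The real part of
    \<open>c\<close> is constant and its imaginary part decreases, so the norms of these increments
    telescope.\<close>
  have ind: "norm ((\<Sum>n\<in>{a..<Suc m}. u n) + u (Suc m) * c m)
          \<le> norm (c a) + (cot (pi * dd a) - cot (pi * dd m)) / 2" if "a \<le> m" "m < b" for m
    using that
  proof (induction m rule: dec_induct)
    case base
    then show ?case using key[of a] by (simp add: norm_mult nu)
  next
    case (step m)
    have "(\<Sum>n\<in>{a..<Suc (Suc m)}. u n) + u (Suc (Suc m)) * c (Suc m)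
        = (\<Sum>n\<in>{a..<Suc m}. u n) + (u (Suc m) + u (Suc (Suc m)) * c (Suc m))"
      using step by simp
    also have "\<dots> = ((\<Sum>n\<in>{a..<Suc m}. u n) + u (Suc m) * c m) + u (Suc m) * (c (Suc m) - c m)"
      using key[of "Suc m"] step by (simp add: algebra_simps)
    finally have "norm ((\<Sum>n\<in>{a..<Suc (Suc m)}. u n) + u (Suc (Suc m)) * c (Suc m))
       \<le> norm ((\<Sum>n\<in>{a..<Suc m}. u n) + u (Suc m) * c m) + norm (u (Suc m) * (c (Suc m) - c m))"
      by (simp only: norm_triangle_ineq)
    moreover have "c (Suc m) - c m = Complex 0 ((cot (pi * dd (Suc m)) - cot (pi * dd m)) / 2)"
      by (simp add: c_def complex_eq_iff field_simps)
    moreover have "cot (pi * dd (Suc m)) \<le> cot (pi * dd m)"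
      using rng[of m] rng[of "Suc m"] step mono[of m] \<theta>
      by (intro cot_pi_mono) (auto simp: dd_def)
    ultimately have "norm ((\<Sum>n\<in>{a..<Suc (Suc m)}. u n) + u (Suc (Suc m)) * c (Suc m))
       \<le> norm ((\<Sum>n\<in>{a..<Suc m}. u n) + u (Suc m) * c m)
         + (cot (pi * dd m) - cot (pi * dd (Suc m))) / 2"
      using nu[of "Suc m"] by (simp add: norm_mult complex_norm)
    moreover have "norm ((\<Sum>n\<in>{a..<Suc m}. u n) + u (Suc m) * c m)
          \<le> norm (c a) + (cot (pi * dd a) - cot (pi * dd m)) / 2"
      using step by simp
    ultimately show ?case by argo
  qed
  have cb: "norm (c n) \<le> 1 / (4 * \<theta>)" "\<bar>cot (pi * dd n)\<bar> \<le> 1 / (2 * \<theta>)" if "a \<le> n" "n < b" for n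
  proof -
    have s: "2 * \<theta> \<le> sin (pi * dd n)" by (rule sn[OF that])
    then have s0: "sin (pi * dd n) > 0" using \<theta> by linarith
    have inv: "1 / sin (pi * dd n) \<le> 1 / (2 * \<theta>)" using s \<theta> by (intro divide_left_mono) (auto intro: mult_pos_pos s0)
    have "(norm (c n))\<^sup>2 = (1 / (2 * sin (pi * dd n)))\<^sup>2"
      using s0 sin_cos_squared_add[of "pi * dd n"] unfolding c_def cot_def cmod_power2
      by (simp add: power_divide field_simps)
    then have "norm (c n) = 1 / (2 * sin (pi * dd n))"
      using s0 by (simp add: power2_eq_iff_nonneg)
    then show "norm (c n) \<le> 1 / (4 * \<theta>)" using inv by simp
    have "\<bar>cot (pi * dd n)\<bar> \<le> 1 / sin (pi * dd n)"
      using s0 by (simp add: cot_def abs_divide divide_le_cancel)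
    then show "\<bar>cot (pi * dd n)\<bar> \<le> 1 / (2 * \<theta>)" using inv by linarith
  qed
  obtain m where m: "b = Suc m" using True by (cases b) auto
  have "norm (\<Sum>n\<in>{a..<b}. u n) \<le> norm ((\<Sum>n\<in>{a..<Suc m}. u n) + u (Suc m) * c m) + norm (u (Suc m) * c m)"
    unfolding m u_def[symmetric] using norm_triangle_ineq4[of "(\<Sum>n\<in>{a..<Suc m}. u n) + u (Suc m) * c m" "u (Suc m) * c m"] by simp
  also have "\<dots> \<le> norm (c a) + (cot (pi * dd a) - cot (pi * dd m)) / 2 + norm (c m)"
    using ind[of m] m True by (simp add: norm_mult nu)
  also have "\<dots> \<le> 1 / (4 * \<theta>) + (1 / (2 * \<theta>) + 1 / (2 * \<theta>)) / 2 + 1 / (4 * \<theta>)"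
    using cb[of a] cb[of m] m True by (intro add_mono divide_right_mono) auto
  also have "\<dots> = 1 / \<theta>" by (simp add: field_simps)
  finally show ?thesis by (simp add: u_def)
qed

lemma finite_convex_nat_set_eq_interval:
  fixes S :: "nat set"
  assumes "finite S" "S \<noteq> {}" and conv: "\<And>m k n. m \<in> S \<Longrightarrow> n \<in> S \<Longrightarrow> m \<le> k \<Longrightarrow> k \<le> n \<Longrightarrow> k \<in> S"
  obtains s t where "s < t" "S = {s..<t}"
proof (rule that)
  have "Min S \<in> S" "Max S \<in> S" using assms by auto
  then have "k \<in> S" if "Min S \<le> k" "k \<le> Max S" for k using conv that by blast
  then show "S = {Min S..<Suc (Max S)}"
    using Min_le[OF assms(1)] Max_ge[OF assms(1)] by (auto simp only: less_Suc_eq_le atLeastLessThan_iff)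
  show "Min S < Suc (Max S)"
    using Max_ge[OF assms(1) \<open>Min S \<in> S\<close>] by (simp only: less_Suc_eq_le)
qed

text \<open>Group the indices by the integer part of the first difference \<open>d\<close>. Within a
  group, Kusmin-Landau gives \<open>1/\<theta>\<close> where \<open>d\<close> stays at distance
  \<theta> from the integers; the remaining indices number at most \<open>\<theta>/\<mu> + 1\<close>
  on either side, because \<open>d\<close> grows by at least \<mu> per step. The choice
  \<open>\<theta> = sqrt \<mu>\<close> balances the two, and \<open>d\<close> grows by at most
  \<open>2 \<mu>\<close> per step, which bounds the number of groups. For
  \<open>\<mu> \<ge> 1/4\<close> the trivial bound suffices.\<close>

lemma van_der_corput_second_difference:
  fixes x :: "nat \<Rightarrow> real"
  assumes ab: "a \<le> b" and \<mu>: "0 < \<mu>"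
    and D: "\<And>n. a \<le> n \<Longrightarrow> n + 1 < b \<Longrightarrow>
              \<mu> \<le> x (n+2) - 2 * x (n+1) + x n \<and> x (n+2) - 2 * x (n+1) + x n \<le> 2 * \<mu>"
  shows "norm (\<Sum>n\<in>{a..<b}. cis (2 * pi * x n)) \<le> 8 * (real (b - a) * sqrt \<mu> + 1 / sqrt \<mu>)"
proof (cases "a < b \<and> \<mu> < 1/4")
  case False
  then consider "a = b" | "\<mu> \<ge> 1/4" using ab by linarith
  then show ?thesis
  proof cases
    case 2
    have "norm (\<Sum>n\<in>{a..<b}. cis (2 * pi * x n)) \<le> (\<Sum>n\<in>{a..<b}. 1)"
      by (intro sum_norm_le) simp
    also have "\<dots> = real (b - a) * 1" by simp
    also have "\<dots> \<le> real (b - a) * (2 * sqrt \<mu>)"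
      using real_sqrt_le_mono[OF 2] by (intro mult_left_mono) (auto simp: real_sqrt_divide)
    also have "\<dots> \<le> 8 * (real (b - a) * sqrt \<mu> + 1 / sqrt \<mu>)" using \<mu> by (simp add: algebra_simps)
    finally show ?thesis .
  qed (use \<mu> in auto)
next
  case True
  then have ab': "a < b" and small: "\<mu> < 1/4" by auto
  define d where "d n = x (n+1) - x n" for n
  define u where "u n = cis (2 * pi * x n)" for n
  define \<theta> where "\<theta> = sqrt \<mu>"
  have \<theta>: "0 < \<theta>" "\<theta> < 1/2" "\<theta> * \<theta> = \<mu>"
    using real_sqrt_less_mono[OF small] \<mu> by (auto simp: \<theta>_def real_sqrt_divide)
  have grow: "d m + \<mu> * (real n - real m) \<le> d n \<and> d n \<le> d m + 2 * \<mu> * (real n - real m)"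
    if "a \<le> m" "m \<le> n" "n < b" for m n
    using that(2,3)
  proof (induction n rule: dec_induct)
    case (step n)
    have "\<mu> \<le> d (Suc n) - d n \<and> d (Suc n) - d n \<le> 2 * \<mu>"
      using D[of n] that(1) step by (simp add: d_def)
    moreover have "d m + \<mu> * (real n - real m) \<le> d n" "d n \<le> d m + 2 * \<mu> * (real n - real m)"
      using step by auto
    moreover have "\<mu> * (real (Suc n) - real m) = \<mu> * (real n - real m) + \<mu>"
      by (simp add: algebra_simps)
    ultimately show ?case by linarith
  qed auto
  have dmono: "d m \<le> d n" if "a \<le> m" "m \<le> n" "n < b" for m n
  proof -
    have "0 \<le> \<mu> * (real n - real m)" using \<mu> that by simp
    then show ?thesis using grow[OF that] by linarith
  qed
  have small_card: "real (card S) \<le> \<theta> / \<mu> + 1"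
    if S: "S \<subseteq> {a..<b}" "\<And>n. n \<in> S \<Longrightarrow> v \<le> d n \<and> d n \<le> v + \<theta>" for S v
  proof (cases "S = {}")
    case False
    have fin: "finite S" using S(1) finite_subset by blast
    have "S \<subseteq> {Min S..Max S}" using fin by auto
    then have "card S \<le> card {Min S..Max S}" by (intro card_mono) auto
    moreover have "Min S \<in> S" "Max S \<in> S" "Min S \<le> Max S" using fin False by auto
    ultimately have c: "real (card S) \<le> real (Max S) - real (Min S) + 1" and
      m: "Min S \<in> S" "Max S \<in> S" "Min S \<le> Max S" by auto
    then have "d (Min S) + \<mu> * (real (Max S) - real (Min S)) \<le> d (Max S)"
      using grow[of "Min S" "Max S"] S(1) by (auto simp: subset_iff)
    then have "\<mu> * (real (Max S) - real (Min S)) \<le> \<theta>" using S(2)[OF m(1)] S(2)[OF m(2)] by linarith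
    then have "real (Max S) - real (Min S) \<le> \<theta> / \<mu>" using \<mu> by (simp add: field_simps)
    then show ?thesis using c by linarith
  qed (use \<theta> \<mu> in auto)
  have sum_card: "norm (sum u S) \<le> real (card S)" for S
    using sum_norm_le[of S u "\<lambda>_. 1"] by (simp add: u_def)
  have block: "norm (\<Sum>n | n \<in> {a..<b} \<and> \<lfloor>d n\<rfloor> = k. u n) \<le> 4 / \<theta>" for k
  proof -
    define A where "A = {n \<in> {a..<b}. of_int k \<le> d n \<and> d n < of_int k + \<theta>}"
    define G where "G = {n \<in> {a..<b}. of_int k + \<theta> \<le> d n \<and> d n \<le> of_int k + 1 - \<theta>}"
    define B where "B = {n \<in> {a..<b}. of_int k + 1 - \<theta> < d n \<and> d n < of_int k + 1}"
    have split: "{n. n \<in> {a..<b} \<and> \<lfloor>d n\<rfloor> = k} = A \<union> G \<union> B"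
      using \<theta> by (auto simp: A_def G_def B_def floor_eq_iff)
    have "sum u (A \<union> G \<union> B) = sum u A + sum u G + sum u B"
      using \<theta> by (subst sum.union_disjoint; (subst sum.union_disjoint)?) (auto simp: A_def G_def B_def)
    then have "norm (sum u (A \<union> G \<union> B)) \<le> norm (sum u A) + norm (sum u G) + norm (sum u B)"
      by (metis norm_triangle_ineq norm_triangle_mono order_refl)
    moreover have "norm (sum u A) \<le> \<theta> / \<mu> + 1"
      by (rule order.trans[OF sum_card small_card[of A "of_int k"]]) (auto simp: A_def)
    moreover have "norm (sum u B) \<le> \<theta> / \<mu> + 1"
      by (rule order.trans[OF sum_card small_card[of B "of_int k + 1 - \<theta>"]]) (auto simp: B_def)
    moreover have "norm (sum u G) \<le> 1 / \<theta>"
    proof (cases "G = {}")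
      case False
      have "finite G" by (simp add: G_def)
      moreover have "i \<in> G" if "m \<in> G" "n \<in> G" "m \<le> i" "i \<le> n" for m i n
        using that dmono[of m i] dmono[of i n] by (auto simp: G_def)
      ultimately obtain s t where st: "s < t" "G = {s..<t}"
        using finite_convex_nat_set_eq_interval[of G] False by metis
      have mem: "n \<in> G" if "s \<le> n" "n < t" for n using that st by simp
      have "norm (\<Sum>n\<in>{s..<t}. u n) \<le> 1 / \<theta>"
        unfolding u_def
      proof (rule kusmin_landau[where k = k])
        show "real_of_int k + \<theta> \<le> x (n + 1) - x n \<and> x (n + 1) - x n \<le> real_of_int k + 1 - \<theta>"
          if "s \<le> n" "n < t" for n
          using mem[OF that] by (auto simp: G_def d_def)
        show "x (n + 1) - x n \<le> x (n + 2) - x (n + 1)"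
          if "s \<le> n" "n + 1 < t" for n
          using that mem[of n] mem[of "n+1"] dmono[of n "Suc n"] by (auto simp: G_def d_def)
      qed (use \<theta> in auto)
      then show ?thesis by (simp add: st(2))
    qed (use \<theta> in auto)
    \<comment> \<open>The three pieces add up to \<open>3/\<theta> + 2\<close>, and the 2 is
      absorbed because \<open>\<theta> < 1/2\<close>.\<close>
    moreover have "\<theta> / \<mu> = 1 / \<theta>" using \<theta>(1) unfolding \<theta>(3)[symmetric] by simp
    moreover have "2 \<le> 1 / \<theta>" using \<theta> by (simp add: field_simps)
    moreover have "4 / \<theta> = 4 * (1 / \<theta>)" by simp
    ultimately show ?thesis unfolding split by linarith
  qed
  define K where "K = (\<lambda>n. \<lfloor>d n\<rfloor>) ` {a..<b}"
  have Ksub: "K \<subseteq> {\<lfloor>d a\<rfloor>..\<lfloor>d (b-1)\<rfloor>}"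
    using ab' by (auto simp: K_def intro!: floor_mono dmono)
  have "real (card K) \<le> 2 * \<mu> * real (b - a) + 2"
  proof -
    have "card K \<le> card {\<lfloor>d a\<rfloor>..\<lfloor>d (b-1)\<rfloor>}" by (intro card_mono Ksub) auto
    moreover have "\<lfloor>d a\<rfloor> \<le> \<lfloor>d (b-1)\<rfloor>" using ab' by (intro floor_mono dmono) auto
    ultimately have "real (card K) \<le> of_int (\<lfloor>d (b-1)\<rfloor> - \<lfloor>d a\<rfloor> + 1)" by simp
    also have "\<dots> \<le> d (b-1) - d a + 2" by linarith
    also have "d (b-1) - d a \<le> 2 * \<mu> * (real (b - 1) - real a)"
    proof -
      have "a \<le> b - 1" "b - 1 < b" using ab' by auto
      from grow[OF order.refl this] show ?thesis by linarith
    qed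
    also have "\<dots> \<le> 2 * \<mu> * real (b - a)" using ab' \<mu> by (intro mult_left_mono) auto
    finally show ?thesis by simp
  qed
  moreover have "sum u {a..<b} = (\<Sum>k\<in>K. \<Sum>n | n \<in> {a..<b} \<and> \<lfloor>d n\<rfloor> = k. u n)"
    unfolding K_def by (rule sum.image_gen) simp
  then have "norm (sum u {a..<b}) \<le> real (card K) * (4 / \<theta>)"
    using sum_norm_le[of K "\<lambda>k. \<Sum>n | n \<in> {a..<b} \<and> \<lfloor>d n\<rfloor> = k. u n" "\<lambda>_. 4 / \<theta>"] block by simp
  ultimately have "norm (sum u {a..<b}) \<le> (2 * \<mu> * real (b - a) + 2) * (4 / \<theta>)"
    using \<theta>(1) mult_right_mono[of "real (card K)" "2 * \<mu> * real (b - a) + 2" "4 / \<theta>"] by force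
  also have "\<dots> = 8 * (real (b - a) * \<theta> + 1 / \<theta>)"
  proof -
    have "\<mu> * (1 / \<theta>) = \<theta>" using \<theta>(1) unfolding \<theta>(3)[symmetric] by simp
    then have "8 * real (b - a) * (\<mu> * (1 / \<theta>)) = 8 * real (b - a) * \<theta>" by simp
    then show ?thesis by (simp add: algebra_simps)
  qed
  finally show ?thesis by (simp add: u_def \<theta>_def)
qed

text \<open>Abel summation, used to remove the decreasing weight \<open>sqrt \<rho>\<close> from the
  exponential sums. The induction tracks the weighted sum minus \<open>w m\<close> times the
  unweighted partial sum, a quantity that changes by \<open>(w m - w (m+1))\<close> times a partial
  sum at each step.\<close>

lemma norm_abel_sum_le:
  fixes u :: "nat \<Rightarrow> complex" and w :: "nat \<Rightarrow> real"
  assumes partial: "\<And>m. m \<le> b \<Longrightarrow> norm (sum u {a..<m}) \<le> B"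
    and dec: "\<And>n. a \<le> n \<Longrightarrow> n + 1 < b \<Longrightarrow> w (n+1) \<le> w n"
    and nonneg: "\<And>n. a \<le> n \<Longrightarrow> n < b \<Longrightarrow> 0 \<le> w n"
    and W: "a < b \<Longrightarrow> w a \<le> W" and WB: "0 \<le> W" "0 \<le> B"
  shows "norm (\<Sum>n\<in>{a..<b}. w n *\<^sub>R u n) \<le> W * B"
proof (cases "a < b")
  case True
  have ind: "norm ((\<Sum>n\<in>{a..<Suc m}. w n *\<^sub>R u n) - w m *\<^sub>R sum u {a..<Suc m}) \<le> (w a - w m) * B"
    if "a \<le> m" "m < b" for m
    using that
  proof (induction m rule: dec_induct)
    case (step m)
    have "(\<Sum>n\<in>{a..<Suc (Suc m)}. w n *\<^sub>R u n) - w (Suc m) *\<^sub>R sum u {a..<Suc (Suc m)}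
      = ((\<Sum>n\<in>{a..<Suc m}. w n *\<^sub>R u n) - w m *\<^sub>R sum u {a..<Suc m}) + (w m - w (Suc m)) *\<^sub>R sum u {a..<Suc m}"
      using step(1) by (simp add: algebra_simps)
    also have "norm \<dots> \<le> (w a - w m) * B + norm ((w m - w (Suc m)) *\<^sub>R sum u {a..<Suc m})"
      using step by (intro norm_triangle_mono) auto
    also have "norm ((w m - w (Suc m)) *\<^sub>R sum u {a..<Suc m}) \<le> (w m - w (Suc m)) * B"
      using step dec[of m] partial[of "Suc m"] by (simp add: mult_left_mono)
    finally show ?case by (simp only: left_diff_distrib) simp
  qed simp
  obtain m where m: "b = Suc m" "a \<le> m" using True by (cases b) auto
  have "norm (\<Sum>n\<in>{a..<b}. w n *\<^sub>R u n)
     \<le> norm ((\<Sum>n\<in>{a..<Suc m}. w n *\<^sub>R u n) - w m *\<^sub>R sum u {a..<Suc m}) + norm (w m *\<^sub>R sum u {a..<Suc m})"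
    unfolding m
    using norm_triangle_ineq[of "(\<Sum>n\<in>{a..<Suc m}. w n *\<^sub>R u n) - w m *\<^sub>R sum u {a..<Suc m}" "w m *\<^sub>R sum u {a..<Suc m}"]
    by simp
  also have "\<dots> \<le> (w a - w m) * B + w m * B"
    using ind[of m] partial[of b] nonneg[of m] m by (intro add_mono) (auto intro!: mult_left_mono)
  also have "\<dots> \<le> W * B" using W True WB by (simp add: left_diff_distrib mult_right_mono)
  finally show ?thesis .
qed (use WB in auto)

text \<open>Dyadic decomposition by the size of the second difference \<open>D\<close>: on a block with \<open>D \<ge> g\<close> of
  length \<open>L\<close> the sequence drops by at least \<open>g L (L - 1) / 2\<close>, so \<open>L\<^sup>2 g\<close> is bounded by the range
  of \<open>p\<close> and every block contributes the same amount.\<close>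

lemma concave_exponential_sum:
  fixes p :: "nat \<Rightarrow> real" and J :: nat
  assumes q: "0 < q" and g0: "0 < g0" and R: "0 \<le> R" and J: "R < 2 ^ J * g0"
    and D0: "\<And>n. a \<le> n \<Longrightarrow> n + 1 < b \<Longrightarrow> g0 \<le> 2 * p (n+1) - p n - p (n+2)"
    and Dmono: "\<And>n. a \<le> n \<Longrightarrow> n + 2 < b \<Longrightarrow>
       2 * p (n+1) - p n - p (n+2) \<le> 2 * p (n+2) - p (n+1) - p (n+3)"
    and dec: "\<And>n. a \<le> n \<Longrightarrow> n < b \<Longrightarrow> p (n+1) \<le> p n"
    and rng: "\<And>n. a \<le> n \<Longrightarrow> n \<le> b \<Longrightarrow> 0 \<le> p n \<and> p n \<le> R"
  shows "norm (\<Sum>n\<in>{a..<b}. cis (2 * pi * (q * p n)))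
     \<le> real J * (24 * sqrt (q * R) + 8 / sqrt (q * g0) + 1) + 1"
proof (cases "a < b")
  case False
  then show ?thesis using R q g0 by (auto intro!: add_nonneg_nonneg mult_nonneg_nonneg)
next
  case True
  \<comment> \<open>Second differences are controlled only for \<open>n + 1 < b\<close>, so the last
    index \<open>b'\<close> is split off; it accounts for the final \<open>+ 1\<close> of the
    bound.\<close>
  then obtain b' where b': "b = Suc b'" "a \<le> b'" by (cases b) auto
  define D where "D n = 2 * p (n+1) - p n - p (n+2)" for n
  define u where "u n = cis (2 * pi * (q * p n))" for n
  define B where "B j = {n \<in> {a..<b'}. 2 ^ j * g0 \<le> D n \<and> D n < 2 ^ (Suc j) * g0}" for j :: nat
  have Dm: "D m \<le> D n" if "a \<le> m" "m \<le> n" "n < b'" for m n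
    using that(2,3)
  proof (induction n rule: dec_induct)
    case (step n)
    then show ?case using Dmono[of n] that(1) b' by (auto simp: D_def numeral_3_eq_3)
  qed auto
  have DR: "D n \<le> R" if "a \<le> n" "n < b'" for n
    using dec[of n] dec[of "n+1"] rng[of "n+1"] rng[of "n+2"] that b' by (simp add: D_def)
  have Blk: "norm (sum u (B j)) \<le> 24 * sqrt (q * R) + 8 / sqrt (q * g0) + 1" for j
  proof (cases "B j = {}")
    case True
    then show ?thesis using q g0 R by auto
  next
    case False
    define g where "g = 2 ^ j * g0"
    have gg: "0 < g" "g0 \<le> g" using g0 by (auto simp: g_def)
    have "finite (B j)" by (simp add: B_def)
    moreover have "i \<in> B j" if "m \<in> B j" "n \<in> B j" "m \<le> i" "i \<le> n" for m i n
      using that Dm[of m i] Dm[of i n] by (auto simp: B_def)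
    ultimately obtain s t where st: "s < t" and Beq: "B j = {s..<t}"
      using finite_convex_nat_set_eq_interval[of "B j"] False by metis
    have mem: "a \<le> n" "n < b'" "g \<le> D n" "D n < 2 * g" if "s \<le> n" "n < t" for n
    proof -
      have "n \<in> B j" using that by (simp add: Beq)
      then show "a \<le> n" "n < b'" "g \<le> D n" "D n < 2 * g" by (auto simp: B_def g_def)
    qed
    have gR: "g \<le> R" using mem[of s] DR[of s] st by force
    have drop: "p n - p (n+1) \<ge> g * (real n - real s)" if "s \<le> n" "n < t" for n
      using that
    proof (induction n rule: dec_induct)
      case base
      then show ?case using dec[of s] mem[of s] st b' by auto
    next
      case (step n)
      then show ?case using mem[of n] by (simp add: D_def algebra_simps)
    qed
    have tot: "p s - p n \<ge> g * ((real n - real s) * (real n - real s - 1) / 2)" if "s \<le> n" "n \<le> t" for n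
      using that
    proof (induction n rule: dec_induct)
      case (step n)
      have "g * ((real (Suc n) - real s) * (real (Suc n) - real s - 1) / 2)
          = g * ((real n - real s) * (real n - real s - 1) / 2) + g * (real n - real s)"
        by (simp add: field_simps)
      moreover have "g * (real n - real s) \<le> p n - p (Suc n)" using drop[of n] step by simp
      moreover have "g * ((real n - real s) * (real n - real s - 1) / 2) \<le> p s - p n" using step by simp
      ultimately show ?case by linarith
    qed simp
    define L where "L = real (t - s)"
    have L: "L \<ge> 1" "L = real t - real s" using st by (auto simp: L_def)
    have "s \<le> t - 1" "t - 1 < t" using st by auto
    then have "t \<le> b" "a \<le> t" "s \<le> b" "a \<le> s" using mem[of s] mem[of "t - 1"] st b' by auto
    then have "p s - p t \<le> R" using rng[of s] rng[of t] by linarith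
    then have "g * (L * (L - 1) / 2) \<le> R" using tot[of t] st by (simp add: L)
    moreover have "g * ((L - 1) * (L - 1)) \<le> g * (L * (L - 1))"
      using L gg by (intro mult_left_mono mult_right_mono) auto
    ultimately have "g * (L - 1)\<^sup>2 \<le> 4 * R" using R by (simp add: power2_eq_square)
    then have "sqrt (g * (L - 1)\<^sup>2) \<le> sqrt (4 * R)" by simp
    then have "(L - 1) * sqrt g \<le> 2 * sqrt R" using L by (simp add: real_sqrt_mult mult.commute)
    moreover have "sqrt g \<le> sqrt R" using gR by simp
    ultimately have "L * sqrt g \<le> 3 * sqrt R" unfolding left_diff_distrib by linarith
    then have "sqrt q * (L * sqrt g) \<le> sqrt q * (3 * sqrt R)"
      using q by (intro mult_left_mono) auto
    then have Lg: "L * sqrt (q * g) \<le> 3 * sqrt (q * R)" by (simp add: real_sqrt_mult mult.left_commute)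
    \<comment> \<open>The second difference test is stated for convex phases, whereas
      \<open>p\<close> is concave: it is applied to \<open>- q p\<close>, whose sum is the complex
      conjugate.\<close>
    have "norm (\<Sum>n\<in>{s..<t}. cis (2 * pi * (- (q * p n)))) \<le> 8 * (real (t - s) * sqrt (q * g) + 1 / sqrt (q * g))"
    proof (rule van_der_corput_second_difference)
      fix n assume n: "s \<le> n" "n + 1 < t"
      have "- (q * p (n + 2)) - 2 * - (q * p (n + 1)) + - (q * p n) = q * D n"
        by (simp add: D_def algebra_simps)
      then show "q * g \<le> - (q * p (n + 2)) - 2 * - (q * p (n + 1)) + - (q * p n) \<and>
         - (q * p (n + 2)) - 2 * - (q * p (n + 1)) + - (q * p n) \<le> 2 * (q * g)"
        using mem[of n] n q by (simp add: mult.left_commute[of 2])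
    qed (use st q gg in auto)
    moreover have "(\<Sum>n\<in>{s..<t}. cis (2 * pi * (- (q * p n)))) = cnj (\<Sum>n\<in>{s..<t}. u n)"
      by (simp add: u_def cis_cnj)
    then have "norm (\<Sum>n\<in>{s..<t}. cis (2 * pi * (- (q * p n)))) = norm (sum u (B j))"
      unfolding Beq by (simp only: complex_mod_cnj)
    moreover have "1 / sqrt (q * g) \<le> 1 / sqrt (q * g0)"
      using q g0 gg by (intro divide_left_mono) auto
    ultimately show ?thesis using Lg by (simp add: L_def)
  qed
  have un: "{a..<b'} = (\<Union>j\<in>{..<J}. B j)"
  proof
    show "{a..<b'} \<subseteq> (\<Union>j\<in>{..<J}. B j)"
    proof
      fix n assume n: "n \<in> {a..<b'}"
      have lo: "g0 \<le> D n" using D0[of n] n b' by (auto simp: D_def)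
      have hi: "D n < 2 ^ J * g0" using DR[of n] n J by auto
      define k where "k = (LEAST k. D n < 2 ^ k * g0)"
      have k: "D n < 2 ^ k * g0" unfolding k_def by (rule LeastI[of _ J]) (rule hi)
      have kJ: "k \<le> J" unfolding k_def by (rule Least_le) (rule hi)
      have "k \<noteq> 0" using k lo by (cases k) auto
      then obtain j where j: "k = Suc j" by (cases k) auto
      have "\<not> D n < 2 ^ j * g0" using not_less_Least[of j "\<lambda>k. D n < 2 ^ k * g0"] j by (simp add: k_def)
      then have "n \<in> B j" using k j n by (auto simp: B_def)
      then show "n \<in> (\<Union>j\<in>{..<J}. B j)" using j kJ by auto
    qed
  qed (auto simp: B_def)
  have disj: "B i \<inter> B j = {}" if "i < j" for i j
  proof -
    have "(2::real) ^ Suc i * g0 \<le> 2 ^ j * g0" using that g0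
      by (intro mult_right_mono power_increasing) auto
    then show ?thesis by (auto simp: B_def)
  qed
  have "sum u {a..<b} = u b' + sum u {a..<b'}" using b' by simp
  also have "sum u {a..<b'} = (\<Sum>j<J. sum u (B j))"
    unfolding un
  proof (rule sum.UNION_disjoint)
    show "\<forall>i\<in>{..<J}. \<forall>j\<in>{..<J}. i \<noteq> j \<longrightarrow> B i \<inter> B j = {}"
      using disj by (metis Int_commute linorder_neqE_nat)
  qed (auto simp: B_def)
  finally have "norm (sum u {a..<b}) \<le> norm (u b') + norm (\<Sum>j<J. sum u (B j))"
    by (simp only: norm_triangle_ineq)
  also have "norm (\<Sum>j<J. sum u (B j)) \<le> (\<Sum>j<J. 24 * sqrt (q * R) + 8 / sqrt (q * g0) + 1)"
    by (intro sum_norm_le Blk)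
  finally show ?thesis by (simp add: u_def)
qed

section \<open>The Fourier transform of the unit disc\<close>

text \<open>In classical terms this is \<open>pi * J_1(x) / x\<close> with the Bessel function
  \<open>J_1\<close>. The integral form needs no separate value at 0 and can be differentiated under
  the integral sign.\<close>

definition disc_transform :: "real \<Rightarrow> real" where
  "disc_transform x = integral {-1..1} (\<lambda>v. sqrt (1 - v\<^sup>2) * cos (x * v))"

lemma has_field_derivative_integral_cos:
  fixes g :: "real \<Rightarrow> real"
  assumes "continuous_on {-1..1} g"
  shows "((\<lambda>x. integral {-1..1} (\<lambda>v. g v * cos (x * v))) has_field_derivative
           - integral {-1..1} (\<lambda>v. v * g v * sin (x * v))) (at x)"
proof -
  have "((\<lambda>x. integral (cbox (-1) 1) (\<lambda>v. g v * cos (x * v))) has_field_derivative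
           integral (cbox (-1) 1) (\<lambda>v. - (v * g v * sin (x * v)))) (at x within UNIV)"
  proof (rule leibniz_rule_field_derivative)
    show "((\<lambda>x. g v * cos (x * v)) has_field_derivative - (v * g v * sin (x * v))) (at x within UNIV)" for x v
      by (auto intro!: derivative_eq_intros)
    show "(\<lambda>v. g v * cos (x * v)) integrable_on cbox (-1) 1" for x
      by (intro integrable_continuous) (auto intro!: continuous_intros assms)
    show "continuous_on (UNIV \<times> cbox (-1) 1) (\<lambda>(x, v). - (v * g v * sin (x * v)))"
      unfolding split_beta by (intro continuous_intros continuous_on_compose2[OF assms]) auto
  qed auto
  then show ?thesis by simp
qed

lemma has_field_derivative_integral_sin:
  fixes g :: "real \<Rightarrow> real"
  assumes "continuous_on {-1..1} g"
  shows "((\<lambda>x. integral {-1..1} (\<lambda>v. g v * sin (x * v))) has_field_derivative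
           integral {-1..1} (\<lambda>v. v * g v * cos (x * v))) (at x)"
proof -
  have "((\<lambda>x. integral (cbox (-1) 1) (\<lambda>v. g v * sin (x * v))) has_field_derivative
           integral (cbox (-1) 1) (\<lambda>v. v * g v * cos (x * v))) (at x within UNIV)"
  proof (rule leibniz_rule_field_derivative)
    show "((\<lambda>x. g v * sin (x * v)) has_field_derivative v * g v * cos (x * v)) (at x within UNIV)" for x v
      by (auto intro!: derivative_eq_intros)
    show "(\<lambda>v. g v * sin (x * v)) integrable_on cbox (-1) 1" for x
      by (intro integrable_continuous) (auto intro!: continuous_intros assms)
    show "continuous_on (UNIV \<times> cbox (-1) 1) (\<lambda>(x, v). v * g v * cos (x * v))"
      unfolding split_beta by (intro continuous_intros continuous_on_compose2[OF assms]) auto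
  qed auto
  then show ?thesis by simp
qed

text \<open>The differential equation \<open>x I'' + 3 I' + x I = 0\<close>, obtained by integrating the derivative of
  \<open>(1 - v\<^sup>2)\<^sup>3\<^sup>/\<^sup>2 sin (x v)\<close>.\<close>

lemma disc_transform_ode:
  obtains I1 I2 where
    "\<And>x. (disc_transform has_field_derivative I1 x) (at x)"
    "\<And>x. (I1 has_field_derivative I2 x) (at x)"
    "\<And>x. x * I2 x + 3 * I1 x + x * disc_transform x = 0"
proof
  let ?s = "\<lambda>v::real. sqrt (1 - v\<^sup>2)"
  have cs: "continuous_on {-1..1} ?s" by (intro continuous_intros)
  have cvs: "continuous_on {-1..1} (\<lambda>v. v * ?s v)" by (intro continuous_intros)
  define I1 where "I1 x = - integral {-1..1} (\<lambda>v. v * ?s v * sin (x * v))" for x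
  define I2 where "I2 x = - integral {-1..1} (\<lambda>v. v * (v * ?s v) * cos (x * v))" for x
  show "(disc_transform has_field_derivative I1 x) (at x)" for x
    unfolding disc_transform_def I1_def by (rule has_field_derivative_integral_cos[OF cs])
  show "(I1 has_field_derivative I2 x) (at x)" for x
    unfolding I1_def I2_def
    by (rule DERIV_minus[OF has_field_derivative_integral_sin[OF cvs]])
  show "x * I2 x + 3 * I1 x + x * disc_transform x = 0" for x
  proof -
    let ?F = "\<lambda>v. (1 - v\<^sup>2) * ?s v * sin (x * v)"
    let ?F' = "\<lambda>v. x * (?s v * cos (x * v)) - x * (v * (v * ?s v) * cos (x * v)) - 3 * (v * ?s v * sin (x * v))"
    have "(?F' has_integral ?F 1 - ?F (-1)) {-1..1}"
    proof (rule fundamental_theorem_of_calculus_interior)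
      show "(?F has_vector_derivative ?F' v) (at v)" if "v \<in> {-1<..<1}" for v
      proof -
        have v: "0 < 1 - v\<^sup>2" using that by (simp add: abs_square_less_1 abs_less_iff)
        have v1: "(1 - v\<^sup>2) / ?s v = ?s v" using v by (simp add: real_div_sqrt)
        have F: "(?F has_field_derivative
            (- 2 * v * ?s v + (1 - v\<^sup>2) * (- (2 * v) / (2 * ?s v))) * sin (x * v) + (1 - v\<^sup>2) * ?s v * (cos (x * v) * x)) (at v)"
          using v by (auto intro!: derivative_eq_intros simp: field_simps)
        have "(1 - v\<^sup>2) * (- (2 * v) / (2 * ?s v)) = - v * ((1 - v\<^sup>2) / ?s v)"
          by simp
        then have e: "(1 - v\<^sup>2) * (- (2 * v) / (2 * ?s v)) = - v * ?s v" unfolding v1 .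
        have "(?F has_field_derivative ?F' v) (at v)"
          by (rule DERIV_cong[OF F], unfold e) (simp add: algebra_simps power2_eq_square)
        then show ?thesis by (simp add: has_real_derivative_iff_has_vector_derivative)
      qed
    qed (auto intro!: continuous_intros)
    then have 1: "integral {-1..1} ?F' = 0" by (auto dest: integral_unique)
    have int: "(\<lambda>v. ?s v * cos (x * v)) integrable_on {-1..1}"
      "(\<lambda>v. v * (v * ?s v) * cos (x * v)) integrable_on {-1..1}"
      "(\<lambda>v. v * ?s v * sin (x * v)) integrable_on {-1..1}"
      by (intro integrable_continuous_interval continuous_intros)+
    have "(?F' has_integral x * disc_transform x - x * (- I2 x) - 3 * (- I1 x)) {-1..1}"
      unfolding disc_transform_def I1_def I2_def minus_minus
      by (intro has_integral_diff has_integral_mult_right integrable_integral int)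
    then have "integral {-1..1} ?F' = x * disc_transform x + x * I2 x + 3 * I1 x"
      by (simp add: integral_unique)
    then show ?thesis using 1 by linarith
  qed
qed

section \<open>Large-argument asymptotics of the disc transform\<close>

text \<open>The function \<open>f + c/x\<close> is nonincreasing and \<open>f - c/x\<close> is
  nondecreasing, so the intervals \<open>[f x - c/x, f x + c/x]\<close> are nested; \<open>l\<close>
  is the infimum of their right ends.\<close>

lemma almost_limit_of_derivative_bound:
  fixes f :: "real \<Rightarrow> real"
  assumes c: "0 \<le> c"
    and d: "\<And>x. 1 \<le> x \<Longrightarrow> (f has_field_derivative f' x) (at x)"
    and b: "\<And>x. 1 \<le> x \<Longrightarrow> \<bar>f' x\<bar> \<le> c / x\<^sup>2"
  obtains l where "\<And>x. 1 \<le> x \<Longrightarrow> \<bar>f x - l\<bar> \<le> c / x"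
proof
  have up: "f y + c / y \<le> f x + c / x" if "1 \<le> x" "x \<le> y" for x y
  proof (rule DERIV_nonpos_imp_nonincreasing[OF that(2), where f = "\<lambda>x. f x + c / x"])
    fix z assume "x \<le> z" "z \<le> y"
    then have z: "1 \<le> z" using that by simp
    have "((\<lambda>x. f x + c / x) has_field_derivative f' z - c / z\<^sup>2) (at z)"
      using z d[OF z] by (auto intro!: derivative_eq_intros simp: power2_eq_square)
    then show "\<exists>D. ((\<lambda>x. f x + c / x) has_field_derivative D) (at z) \<and> D \<le> 0"
      using b[OF z] by (intro exI[of _ "f' z - c / z\<^sup>2"]) auto
  qed
  have lo: "f x - c / x \<le> f y - c / y" if "1 \<le> x" "x \<le> y" for x y
  proof (rule DERIV_nonneg_imp_nondecreasing[OF that(2), where f = "\<lambda>x. f x - c / x"])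
    fix z assume "x \<le> z" "z \<le> y"
    then have z: "1 \<le> z" using that by simp
    have "((\<lambda>x. f x - c / x) has_field_derivative f' z + c / z\<^sup>2) (at z)"
      using z d[OF z] by (auto intro!: derivative_eq_intros simp: power2_eq_square)
    then show "\<exists>D. ((\<lambda>x. f x - c / x) has_field_derivative D) (at z) \<and> D \<ge> 0"
      using b[OF z] by (intro exI[of _ "f' z + c / z\<^sup>2"]) auto
  qed
  define S where "S = (\<lambda>x. f x + c / x) ` {1..}"
  have cross: "f x - c / x \<le> f y + c / y" if "1 \<le> x" "1 \<le> y" for x y
  proof (cases "x \<le> y")
    case True
    have "0 \<le> c / y" using c that by simp
    then show ?thesis using lo[OF that(1) True] by linarith
  next
    case False
    have "0 \<le> c / x" using c that by simp
    then show ?thesis using up[of y x] that False by linarith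
  qed
  fix x :: real assume x: "1 \<le> x"
  have "f x - c / x \<le> Inf S" unfolding S_def
    by (intro cInf_greatest) (use cross[OF x] in auto)
  moreover have "Inf S \<le> f x + c / x" unfolding S_def
    by (intro cInf_lower) (use x cross[OF x] cross[of 1] in \<open>auto simp: bdd_below_def\<close>)
  ultimately show "\<bar>f x - Inf S\<bar> \<le> c / x" by linarith
qed

text \<open>The Liouville substitution \<open>w = x\<^sup>3\<^sup>/\<^sup>2 I\<close> gives \<open>w'' = - w + 3 w / (4 x\<^sup>2)\<close>; the energy
  \<open>w\<^sup>2 + w'\<^sup>2\<close> stays bounded, and in rotating coordinates the solution converges.\<close>

lemma disc_transform_asymptotics:
  obtains A B C where "0 \<le> C"
    "\<And>x. 1 \<le> x \<Longrightarrow>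
       \<bar>disc_transform x - x powr (-3/2) * (A * cos x + B * sin x)\<bar> \<le> C * x powr (-5/2)"
proof -
  obtain I1 I2 where I1: "\<And>x. (disc_transform has_field_derivative I1 x) (at x)"
    and I2: "\<And>x. (I1 has_field_derivative I2 x) (at x)"
    and ode: "\<And>x. x * I2 x + 3 * I1 x + x * disc_transform x = 0"
    by (rule disc_transform_ode) blast
  define w where "w x = x powr (3/2) * disc_transform x" for x
  define w1 where "w1 x = x powr (3/2) * I1 x + 3/2 * x powr (1/2) * disc_transform x" for x
  define w2 where "w2 x = - w x + 3/4 * w x / x\<^sup>2" for x
  have dw: "(w has_field_derivative w1 x) (at x)" if "1 \<le> x" for x
    unfolding w_def w1_def using that
    by (auto intro!: derivative_eq_intros I1 simp: algebra_simps)
  have dw1: "(w1 has_field_derivative w2 x) (at x)" if "1 \<le> x" for x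
  proof -
    have d: "(w1 has_field_derivative (3/2 * x powr (1/2) * I1 x + x powr (3/2) * I2 x)
       + (3/2 * (1/2 * x powr (-1/2)) * disc_transform x + 3/2 * x powr (1/2) * I1 x)) (at x)"
      unfolding w1_def using that
      by (auto intro!: derivative_eq_intros I1 I2 simp: algebra_simps) (simp add: field_simps)
    have p1: "x powr (3/2) = x powr (1/2) * x" and p2: "x powr (-1/2) = x powr (1/2) / x"
      using that powr_mult_base[of x "1/2"] powr_diff[of x "1/2" 1] by (simp_all add: mult.commute)
    have "x * I2 x = - 3 * I1 x - x * disc_transform x" using ode[of x] by linarith
    then have i2: "I2 x = - 3 * I1 x / x - disc_transform x" using that by (simp add: field_simps)
    show ?thesis
      by (rule DERIV_cong[OF d], unfold w2_def w_def p1 p2 i2)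
        (use that in \<open>simp add: field_simps power2_eq_square\<close>)
  qed
  define E where "E x = (w x)\<^sup>2 + (w1 x)\<^sup>2" for x
  define M where "M = sqrt (E 1 * exp (3/4))"
  have EM: "\<bar>w x\<bar> \<le> M" if x: "1 \<le> x" for x
  proof -
    \<comment> \<open>Since \<open>E' = 3 w w1 / (2 x^2)\<close> is at most
      \<open>3 E / (4 x^2)\<close>, the integrating factor \<open>exp (3 / (4 x))\<close> makes the
      energy nonincreasing.\<close>
    have "E x * exp (3 / (4 * x)) \<le> E 1 * exp (3 / (4 * 1))"
    proof (rule DERIV_nonpos_imp_nonincreasing[OF x, where f = "\<lambda>x. E x * exp (3 / (4 * x))"])
      fix z :: real assume z: "1 \<le> z"
      have "((\<lambda>x. E x * exp (3 / (4 * x))) has_field_derivative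
         (2 * w z * w1 z + 2 * w1 z * w2 z) * exp (3 / (4 * z)) + E z * (exp (3 / (4 * z)) * (- 3 / (4 * z\<^sup>2)))) (at z)"
        unfolding E_def using z dw[OF z] dw1[OF z]
        by (auto intro!: derivative_eq_intros simp: power2_eq_square) (simp add: algebra_simps)
      moreover have "(2 * w z * w1 z + 2 * w1 z * w2 z) * exp (3 / (4 * z)) + E z * (exp (3 / (4 * z)) * (- 3 / (4 * z\<^sup>2)))
        = - (3 / (4 * z\<^sup>2)) * (w z - w1 z)\<^sup>2 * exp (3 / (4 * z))"
        using z unfolding w2_def E_def by (simp add: field_simps power2_eq_square)
      ultimately show "\<exists>D. ((\<lambda>x. E x * exp (3 / (4 * x))) has_field_derivative D) (at z) \<and> D \<le> 0"
        by (auto simp: mult_nonneg_nonneg)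
    qed
    moreover have "E x * 1 \<le> E x * exp (3 / (4 * x))" using x by (intro mult_left_mono) (auto simp: E_def)
    moreover have "(w x)\<^sup>2 \<le> E x" by (simp add: E_def)
    ultimately have "(w x)\<^sup>2 \<le> E 1 * exp (3/4)" by simp
    then show ?thesis unfolding M_def by (metis real_sqrt_abs real_sqrt_le_iff)
  qed
  have M0: "0 \<le> M" using EM[of 1] by simp
  \<comment> \<open>For the unperturbed equation \<open>w'' = - w\<close> both combinations would be
    constant. Their derivatives contain only the perturbation \<open>3 w / (4 x^2)\<close>, which is
    \<open>O(1/x^2)\<close> because \<open>w\<close> is bounded.\<close>
  define f where "f x = w1 x * cos x + w x * sin x" for x
  define g where "g x = w x * cos x - w1 x * sin x" for x
  have df: "(f has_field_derivative 3/4 * w x / x\<^sup>2 * cos x) (at x)" if "1 \<le> x" for x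
    unfolding f_def using dw[OF that] dw1[OF that]
    by (auto intro!: derivative_eq_intros simp: w2_def algebra_simps)
  have dg: "(g has_field_derivative - (3/4 * w x / x\<^sup>2 * sin x)) (at x)" if "1 \<le> x" for x
    unfolding g_def using dw[OF that] dw1[OF that]
    by (auto intro!: derivative_eq_intros simp: w2_def algebra_simps)
  have bnd: "\<bar>3/4 * w x / x\<^sup>2 * t\<bar> \<le> M / x\<^sup>2" if "1 \<le> x" "\<bar>t\<bar> \<le> 1" for x t
  proof -
    have "\<bar>w x * t\<bar> \<le> M * 1" unfolding abs_mult using EM that M0 by (intro mult_mono) auto
    then have "\<bar>w x * t\<bar> / x\<^sup>2 \<le> M / x\<^sup>2" by (intro divide_right_mono) auto
    moreover have "\<bar>3/4 * w x / x\<^sup>2 * t\<bar> = 3/4 * (\<bar>w x * t\<bar> / x\<^sup>2)" by (simp add: abs_mult)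
    moreover have "0 \<le> \<bar>w x * t\<bar> / x\<^sup>2" by simp
    ultimately show ?thesis by linarith
  qed
  obtain lf where lf: "\<And>x. 1 \<le> x \<Longrightarrow> \<bar>f x - lf\<bar> \<le> M / x"
  proof (rule almost_limit_of_derivative_bound[OF M0 df])
    show "\<bar>3/4 * w x / x\<^sup>2 * cos x\<bar> \<le> M / x\<^sup>2" if "1 \<le> x" for x
      by (rule bnd[OF that]) simp
  qed blast+
  obtain lg where lg: "\<And>x. 1 \<le> x \<Longrightarrow> \<bar>g x - lg\<bar> \<le> M / x"
  proof (rule almost_limit_of_derivative_bound[OF M0 dg])
    show "\<bar>- (3/4 * w x / x\<^sup>2 * sin x)\<bar> \<le> M / x\<^sup>2" if "1 \<le> x" for x
      unfolding abs_minus_cancel by (rule bnd[OF that]) simp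
  qed blast+
  show thesis
  proof (rule that[of "2 * M" lg lf])
    fix x :: real assume x: "1 \<le> x"
    have "w x = f x * sin x + g x * cos x"
    proof -
      have "f x * sin x + g x * cos x = w x * ((sin x)\<^sup>2 + (cos x)\<^sup>2)"
        unfolding f_def g_def by algebra
      then show ?thesis by simp
    qed
    then have "w x - (lg * cos x + lf * sin x) = (f x - lf) * sin x + (g x - lg) * cos x"
      by (simp add: algebra_simps)
    moreover have "\<bar>(f x - lf) * sin x\<bar> \<le> M / x * 1" unfolding abs_mult
      using lf[OF x] M0 x by (intro mult_mono) auto
    moreover have "\<bar>(g x - lg) * cos x\<bar> \<le> M / x * 1" unfolding abs_mult
      using lg[OF x] M0 x by (intro mult_mono) auto
    ultimately have 1: "\<bar>w x - (lg * cos x + lf * sin x)\<bar> \<le> 2 * M / x" by simp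
    have "x powr (-3/2) * w x = disc_transform x"
      using x by (simp add: w_def powr_minus field_simps)
    then have "\<bar>disc_transform x - x powr (-3/2) * (lg * cos x + lf * sin x)\<bar>
        = x powr (-3/2) * \<bar>w x - (lg * cos x + lf * sin x)\<bar>"
      by (metis abs_mult abs_of_nonneg powr_ge_zero right_diff_distrib)
    also have "\<dots> \<le> x powr (-3/2) * (2 * M / x)" by (intro mult_left_mono 1) auto
    also have "\<dots> = 2 * M * x powr (-5/2)"
      using x powr_diff[of x "-3/2" 1] by simp
    finally show "\<bar>disc_transform x - x powr (-3/2) * (lg * cos x + lf * sin x)\<bar> \<le> 2 * M * x powr (-5/2)" .
  qed (use M0 in simp)
qed

section \<open>Shears and rotations preserve planar Lebesgue measure\<close>

text \<open>By Fubini it suffices to look at horizontal lines, on each of which the shear is a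
  translation.\<close>

lemma distr_lborel_shear_fst:
  "distr lborel borel (\<lambda>z. (fst z + a * snd z, snd z)) = (lborel :: (real \<times> real) measure)"
proof (rule measure_eqI)
  fix A :: "(real \<times> real) set" assume "A \<in> sets (distr lborel borel (\<lambda>z. (fst z + a * snd z, snd z)))"
  then have A[measurable]: "A \<in> sets borel" by simp
  have T[measurable]: "(\<lambda>z::real\<times>real. (fst z + a * snd z, snd z)) \<in> borel_measurable borel"
    by (intro borel_measurable_continuous_onI continuous_intros)
  have A'[measurable]: "A \<in> sets (lborel \<Otimes>\<^sub>M lborel)" unfolding lborel_prod by simp
  let ?T = "\<lambda>z::real\<times>real. (fst z + a * snd z, snd z)"
  have TA: "?T -` A \<in> sets (lborel \<Otimes>\<^sub>M lborel)"
    unfolding lborel_prod using measurable_sets[OF T A] by simp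
  have "emeasure (distr lborel borel ?T) A = emeasure (lborel \<Otimes>\<^sub>M lborel) (?T -` A)"
    by (subst emeasure_distr) (simp_all add: lborel_prod)
  also have "\<dots> = (\<integral>\<^sup>+y. emeasure lborel ((\<lambda>x. (x, y)) -` (?T -` A)) \<partial>lborel)"
    by (rule lborel_pair.emeasure_pair_measure_alt2[OF TA])
  also have "\<dots> = (\<integral>\<^sup>+y. emeasure lborel ((\<lambda>x. (x, y)) -` A) \<partial>lborel)"
  proof (rule nn_integral_cong)
    fix y :: real
    have B: "(\<lambda>x. (x, y)) -` A \<in> sets borel"
    proof -
      have "(\<lambda>x::real. (x, y)) \<in> borel_measurable borel"
        by (intro borel_measurable_continuous_onI continuous_intros)
      from measurable_sets[OF this A] show ?thesis by simp
    qed
    have "emeasure lborel ((\<lambda>x. (x, y)) -` (?T -` A)) = emeasure lborel ((+) (a * y) -` ((\<lambda>x. (x, y)) -` A))"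
      by (rule arg_cong[where f = "emeasure lborel"]) (auto simp: add.commute)
    also have "\<dots> = emeasure (distr lborel borel ((+) (a * y))) ((\<lambda>x. (x, y)) -` A)"
      using B by (subst emeasure_distr) auto
    finally show "emeasure lborel ((\<lambda>x. (x, y)) -` (?T -` A)) = emeasure lborel ((\<lambda>x. (x, y)) -` A)"
      by (simp only: lborel_distr_plus)
  qed
  also have "\<dots> = emeasure (lborel \<Otimes>\<^sub>M lborel) A"
    by (rule lborel_pair.emeasure_pair_measure_alt2[OF A', symmetric])
  finally show "emeasure (distr lborel borel ?T) A = emeasure lborel A" by (simp only: lborel_prod)
qed simp

lemma distr_lborel_shear_snd:
  "distr lborel borel (\<lambda>z. (fst z, snd z + a * fst z)) = (lborel :: (real \<times> real) measure)"
proof (rule measure_eqI)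
  fix A :: "(real \<times> real) set" assume "A \<in> sets (distr lborel borel (\<lambda>z. (fst z, snd z + a * fst z)))"
  then have A[measurable]: "A \<in> sets borel" by simp
  have T[measurable]: "(\<lambda>z::real\<times>real. (fst z, snd z + a * fst z)) \<in> borel_measurable borel"
    by (intro borel_measurable_continuous_onI continuous_intros)
  have A'[measurable]: "A \<in> sets (lborel \<Otimes>\<^sub>M lborel)" unfolding lborel_prod by simp
  let ?T = "\<lambda>z::real\<times>real. (fst z, snd z + a * fst z)"
  have TA: "?T -` A \<in> sets (lborel \<Otimes>\<^sub>M lborel)"
    unfolding lborel_prod using measurable_sets[OF T A] by simp
  have "emeasure (distr lborel borel ?T) A = emeasure (lborel \<Otimes>\<^sub>M lborel) (?T -` A)"
    by (subst emeasure_distr) (simp_all add: lborel_prod)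
  also have "\<dots> = (\<integral>\<^sup>+x. emeasure lborel (Pair x -` (?T -` A)) \<partial>lborel)"
    by (rule lborel.emeasure_pair_measure_alt[OF TA])
  also have "\<dots> = (\<integral>\<^sup>+x. emeasure lborel (Pair x -` A) \<partial>lborel)"
  proof (rule nn_integral_cong)
    fix x :: real
    have B: "Pair x -` A \<in> sets borel"
    proof -
      have "Pair x \<in> borel_measurable (borel :: real measure)"
        by (intro borel_measurable_continuous_onI continuous_intros)
      from measurable_sets[OF this A] show ?thesis by simp
    qed
    have "emeasure lborel (Pair x -` (?T -` A)) = emeasure lborel ((+) (a * x) -` (Pair x -` A))"
      by (rule arg_cong[where f = "emeasure lborel"]) (auto simp: add.commute)
    also have "\<dots> = emeasure (distr lborel borel ((+) (a * x))) (Pair x -` A)"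
      using B by (subst emeasure_distr) auto
    finally show "emeasure lborel (Pair x -` (?T -` A)) = emeasure lborel (Pair x -` A)"
      by (simp only: lborel_distr_plus)
  qed
  also have "\<dots> = emeasure (lborel \<Otimes>\<^sub>M lborel) A"
    by (rule lborel.emeasure_pair_measure_alt[OF A', symmetric])
  finally show "emeasure (distr lborel borel ?T) A = emeasure lborel A" by (simp only: lborel_prod)
qed simp

text \<open>A rotation by an angle that is not a multiple of \<open>\<pi>\<close> is a product of three shears.\<close>

lemma lborel_integral_rotation:
  fixes h :: "real \<times> real \<Rightarrow> real"
  assumes [measurable]: "h \<in> borel_measurable borel" and cs: "c\<^sup>2 + s\<^sup>2 = 1" "s \<noteq> 0"
  shows "(\<integral>z. h (c * fst z + s * snd z, c * snd z - s * fst z) \<partial>lborel) = integral\<^sup>L lborel h"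
proof -
  \<comment> \<open>For \<open>c\<close> and \<open>s\<close> the cosine and sine of an angle,
    \<open>a\<close> is the tangent of half that angle, which makes the product of the three shears
    the rotation.\<close>
  define a where "a = (1 - c) / s"
  define S where "S = (\<lambda>z::real\<times>real. (fst z + a * snd z, snd z))"
  define U where "U = (\<lambda>z::real\<times>real. (fst z, snd z + (- s) * fst z))"
  have S[measurable]: "S \<in> borel_measurable borel" unfolding S_def
    by (intro borel_measurable_continuous_onI continuous_intros)
  have U[measurable]: "U \<in> borel_measurable borel" unfolding U_def
    by (intro borel_measurable_continuous_onI continuous_intros)
  have S_int: "(\<integral>z. f (S z) \<partial>lborel) = integral\<^sup>L lborel f" if "f \<in> borel_measurable borel" for f :: "real \<times> real \<Rightarrow> real"
    using integral_distr[of S lborel borel f] that distr_lborel_shear_fst[of a] S by (simp add: S_def)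
  have U_int: "(\<integral>z. f (U z) \<partial>lborel) = integral\<^sup>L lborel f" if "f \<in> borel_measurable borel" for f :: "real \<times> real \<Rightarrow> real"
    using integral_distr[of U lborel borel f] that distr_lborel_shear_snd[of "-s"] U by (simp add: U_def)
  have as: "a * s = 1 - c" using cs(2) by (simp add: a_def)
  have "s * (a + a * c) = (1 + c) * (a * s)" by algebra
  also have "\<dots> = s * s" using cs(1) unfolding as by algebra
  finally have ac: "a + a * c = s" using cs(2) by simp
  have rot: "S (U (S z)) = (c * fst z + s * snd z, c * snd z - s * fst z)" for z
  proof -
    have "fst z + a * snd z + a * (snd z - s * (fst z + a * snd z))
      = (1 - a * s) * fst z + (a + a * (1 - a * s)) * snd z" by algebra
    moreover have "snd z - s * (fst z + a * snd z) = (1 - a * s) * snd z - s * fst z" by algebra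
    ultimately show ?thesis using as ac by (simp add: S_def U_def)
  qed
  have "(\<integral>z. h (c * fst z + s * snd z, c * snd z - s * fst z) \<partial>lborel) = (\<integral>z. h (S (U (S z))) \<partial>lborel)"
    by (simp only: rot)
  also have "\<dots> = (\<integral>z. h (S (U z)) \<partial>lborel)"
    by (rule S_int[of "\<lambda>z. h (S (U z))"]) measurable
  also have "\<dots> = (\<integral>z. h (S z) \<partial>lborel)"
    by (rule U_int[of "\<lambda>z. h (S z)"]) measurable
  also have "\<dots> = integral\<^sup>L lborel h"
    by (rule S_int) measurable
  finally show ?thesis .
qed

section \<open>The Fourier transform of a disc of radius r\<close>

text \<open>Stated with squares, so that rotation invariance is a polynomial identity, and on
  \<open>real \<times> real\<close>, so that Fubini applies directly. A negative \<open>r\<close>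
  gives the same set as \<open>\<bar>r\<bar>\<close>.\<close>

definition disc :: "real \<Rightarrow> (real \<times> real) set" where
  "disc r = {z. (fst z)\<^sup>2 + (snd z)\<^sup>2 \<le> r\<^sup>2}"

lemma disc_eq_cball:
  assumes "0 \<le> r"
  shows "disc r = cball 0 r"
proof -
  have "z \<in> disc r \<longleftrightarrow> norm z \<le> r" for z
    using real_sqrt_le_iff[of "(fst z)\<^sup>2 + (snd z)\<^sup>2" "r\<^sup>2"] assms by (simp add: disc_def norm_prod_def)
  then show ?thesis by auto
qed

lemma disc_borel[measurable]: "disc r \<in> sets borel"
  unfolding disc_def by (intro borel_closed closed_Collect_le continuous_intros)

lemma integrable_disc:
  fixes f :: "real \<times> real \<Rightarrow> real"
  assumes "continuous_on UNIV f"
  shows "integrable lborel (\<lambda>z. indicator (disc r) z * f z)"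
proof -
  have "disc r = disc \<bar>r\<bar>" by (simp add: disc_def)
  then have "compact (disc r)" by (simp add: disc_eq_cball)
  from borel_integrable_compact[OF this continuous_on_subset[OF assms]] show ?thesis by simp
qed

lemma disc_fourier_horizontal:
  assumes r: "0 < r"
  shows "(\<integral>z. indicator (disc r) z * cos (k * fst z) \<partial>lborel) = 2 * r\<^sup>2 * disc_transform (k * r)"
proof -
  let ?G = "\<lambda>z. indicator (disc r) z * cos (k * fst z)"
  have int: "integrable (lborel \<Otimes>\<^sub>M lborel) ?G"
    unfolding lborel_prod by (intro integrable_disc continuous_intros)
  have "(\<integral>z. ?G z \<partial>lborel) = (\<integral>x. (\<integral>y. ?G (x, y) \<partial>lborel) \<partial>lborel)"
    using lborel_pair.integral_fst'[OF int] by (simp add: lborel_prod)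
  also have "\<dots> = (\<integral>x. indicator {-r..r} x * (2 * sqrt (r\<^sup>2 - x\<^sup>2) * cos (k * x)) \<partial>lborel)"
  proof (rule Bochner_Integration.integral_cong)
    fix x :: real
    show "(\<integral>y. ?G (x, y) \<partial>lborel) = indicator {-r..r} x * (2 * sqrt (r\<^sup>2 - x\<^sup>2) * cos (k * x))"
    proof (cases "x \<in> {-r..r}")
      case True
      then have x: "0 \<le> r\<^sup>2 - x\<^sup>2" by (simp add: abs_le_square_iff[symmetric] abs_le_iff)
      have "(indicator (disc r) (x, y) :: real) = indicator {- sqrt (r\<^sup>2 - x\<^sup>2)..sqrt (r\<^sup>2 - x\<^sup>2)} y" for y
      proof -
        have "(x, y) \<in> disc r \<longleftrightarrow> y\<^sup>2 \<le> r\<^sup>2 - x\<^sup>2" by (auto simp: disc_def)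
        also have "\<dots> \<longleftrightarrow> \<bar>y\<bar> \<le> sqrt (r\<^sup>2 - x\<^sup>2)"
          using x by (metis real_sqrt_abs real_sqrt_le_iff)
        finally show ?thesis by (auto simp: indicator_def abs_le_iff)
      qed
      then have "(\<integral>y. ?G (x, y) \<partial>lborel) = cos (k * x) * measure lborel {- sqrt (r\<^sup>2 - x\<^sup>2)..sqrt (r\<^sup>2 - x\<^sup>2)}"
        by (simp add: mult.commute)
      then show ?thesis using True x by simp
    next
      case False
      then have "\<not> \<bar>x\<bar> \<le> \<bar>r\<bar>" using r by auto
      then have "r\<^sup>2 < x\<^sup>2" unfolding abs_le_square_iff by simp
      then have "\<not> x\<^sup>2 + y\<^sup>2 \<le> r\<^sup>2" for y by (smt (verit) zero_le_power2)
      then have "(x, y) \<notin> disc r" for y by (simp add: disc_def)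
      then show ?thesis using False by simp
    qed
  qed simp
  also have "\<dots> = \<bar>r\<bar> *\<^sub>R (\<integral>v. indicator {-r..r} (0 + r * v) * (2 * sqrt (r\<^sup>2 - (0 + r * v)\<^sup>2) * cos (k * (0 + r * v))) \<partial>lborel)"
    using r by (intro lborel_integral_real_affine) auto
  also have "(\<integral>v. indicator {-r..r} (0 + r * v) * (2 * sqrt (r\<^sup>2 - (0 + r * v)\<^sup>2) * cos (k * (0 + r * v))) \<partial>lborel)
      = (\<integral>v. 2 * r * (indicator {-1..1} v * (sqrt (1 - v\<^sup>2) * cos (k * r * v))) \<partial>lborel)"
  proof (rule Bochner_Integration.integral_cong)
    fix v :: real
    have "r\<^sup>2 - (r * v)\<^sup>2 = r\<^sup>2 * (1 - v\<^sup>2)" by (simp add: power_mult_distrib right_diff_distrib)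
    then have "sqrt (r\<^sup>2 - (r * v)\<^sup>2) = r * sqrt (1 - v\<^sup>2)" using r by (simp add: real_sqrt_mult)
    moreover have "r * v \<in> {-r..r} \<longleftrightarrow> v \<in> {-1..1}"
      using r mult_le_cancel_left_pos[of r v 1] mult_le_cancel_left_pos[of r "-1" v] by auto
    ultimately show "indicator {-r..r} (0 + r * v) * (2 * sqrt (r\<^sup>2 - (0 + r * v)\<^sup>2) * cos (k * (0 + r * v)))
      = 2 * r * (indicator {-1..1} v * (sqrt (1 - v\<^sup>2) * cos (k * r * v)))"
      by (simp add: indicator_def mult.assoc)
  qed simp
  also have "\<dots> = 2 * r * (\<integral>v. indicator {-1..1} v * (sqrt (1 - v\<^sup>2) * cos (k * r * v)) \<partial>lborel)" by simp
  also have "(\<integral>v. indicator {-1..1} v * (sqrt (1 - v\<^sup>2) * cos (k * r * v)) \<partial>lborel) = disc_transform (k * r)"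
  proof -
    have "set_integrable lborel {-1..1} (\<lambda>v. sqrt (1 - v\<^sup>2) * cos (k * r * v))"
      by (intro borel_integrable_atLeastAtMost') (intro continuous_intros)
    from set_borel_integral_eq_integral(2)[OF this] show ?thesis
      by (simp add: set_lebesgue_integral_def disc_transform_def)
  qed
  finally show ?thesis using r by (simp add: power2_eq_square)
qed

text \<open>A rotation carries the frequency vector to the first axis. The rotation lemma asks for a
  nonzero sine, so frequencies already on that axis are handled by the evenness of the
  cosine.\<close>

lemma disc_fourier:
  assumes r: "0 < r"
  shows "(\<integral>z. indicator (disc r) z * cos (2 * pi * (m1 * fst z + m2 * snd z)) \<partial>lborel)
       = 2 * r\<^sup>2 * disc_transform (2 * pi * sqrt (m1\<^sup>2 + m2\<^sup>2) * r)"
proof (cases "m2 = 0")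
  case True
  have "cos (2 * pi * (m1 * x)) = cos (2 * pi * \<bar>m1\<bar> * x)" for x
    by (cases "0 \<le> m1") (simp_all add: mult.assoc)
  then show ?thesis using True disc_fourier_horizontal[OF r, of "2 * pi * \<bar>m1\<bar>"] by simp
next
  case False
  define q where "q = sqrt (m1\<^sup>2 + m2\<^sup>2)"
  have q2: "q\<^sup>2 = m1\<^sup>2 + m2\<^sup>2" by (simp add: q_def)
  have q: "q > 0" using False by (simp add: q_def sum_power2_gt_zero_iff)
  define c s where "c = m1 / q" and "s = m2 / q"
  have cs: "c\<^sup>2 + s\<^sup>2 = 1" unfolding c_def s_def power_divide add_divide_distrib[symmetric] q2[symmetric] using q by simp
  have "s \<noteq> 0" using False q by (simp add: s_def)
  have "(indicator (disc r) z * cos (2 * pi * (m1 * fst z + m2 * snd z)) :: real) =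
    (\<lambda>z. indicator (disc r) z * cos (2 * pi * q * fst z)) (c * fst z + s * snd z, c * snd z - s * fst z)" for z
  proof -
    have "(c * fst z + s * snd z)\<^sup>2 + (c * snd z - s * fst z)\<^sup>2 = (c\<^sup>2 + s\<^sup>2) * ((fst z)\<^sup>2 + (snd z)\<^sup>2)"
      by algebra
    then have "(c * fst z + s * snd z)\<^sup>2 + (c * snd z - s * fst z)\<^sup>2 = (fst z)\<^sup>2 + (snd z)\<^sup>2"
      by (simp add: cs)
    moreover have "m1 * fst z + m2 * snd z = q * (c * fst z + s * snd z)"
      using q by (simp add: c_def s_def field_simps)
    ultimately show ?thesis by (simp add: disc_def indicator_def mult.assoc)
  qed
  then have "(\<integral>z. indicator (disc r) z * cos (2 * pi * (m1 * fst z + m2 * snd z)) \<partial>lborel)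
     = (\<integral>z. (\<lambda>z. indicator (disc r) z * cos (2 * pi * q * fst z)) (c * fst z + s * snd z, c * snd z - s * fst z) \<partial>lborel)"
    by (simp only:)
  also have "\<dots> = (\<integral>z. indicator (disc r) z * cos (2 * pi * q * fst z) \<partial>lborel)"
    by (rule lborel_integral_rotation[OF _ cs \<open>s \<noteq> 0\<close>])
      (intro borel_measurable_times borel_measurable_indicator disc_borel borel_measurable_continuous_onI continuous_intros)
  also have "\<dots> = 2 * r\<^sup>2 * disc_transform (2 * pi * q * r)" by (rule disc_fourier_horizontal[OF r])
  finally show ?thesis by (simp add: q_def)
qed

lemma measure_disc: "0 \<le> r \<Longrightarrow> measure lborel (disc r) = pi * r\<^sup>2"
  by (simp add: disc_eq_cball content_cball unit_ball_vol_2 power2_eq_square)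

section \<open>A positive trigonometric kernel and the smoothed lattice point count\<close>

text \<open>A weak form of Stirling's formula. The recurrence of the central binomial coefficients
  reduces the step to \<open>2 sqrt (n (n+1)) \<le> 2 n + 1\<close>, the inequality of arithmetic
  and geometric means. It bounds the height of the kernel by \<open>2 sqrt P\<close>.\<close>

lemma central_binomial_ge: "4 ^ n \<le> 2 * sqrt (real n) * real (2 * n choose n)" if "1 \<le> n"
  using that
proof (induction n rule: dec_induct)
  case (step n)
  have rec: "real (Suc n) * real (2 * Suc n choose Suc n) = 2 * (2 * real n + 1) * real (2 * n choose n)"
  proof -
    have "Suc n * (2 * Suc n choose Suc n) = 2 * Suc n * (Suc (2 * n) choose n)"
      using Suc_times_binomial_eq[of "Suc (2 * n)" n] by simp
    then have 1: "(2 * Suc n choose Suc n) = 2 * (Suc (2 * n) choose n)"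
      by (simp only: mult.assoc mult.left_commute[of 2] mult_cancel1) simp
    have "Suc n * (Suc (2 * n) choose Suc n) = Suc (2 * n) * (2 * n choose n)"
      using Suc_times_binomial_eq[of "2 * n" n] by simp
    moreover have "Suc (2 * n) choose Suc n = Suc (2 * n) choose n"
      using binomial_symmetric[of "Suc n" "Suc (2 * n)"] by simp
    ultimately have "Suc n * (2 * Suc n choose Suc n) = 2 * (Suc (2 * n) * (2 * n choose n))"
      unfolding 1 by simp
    then have "real (Suc n * (2 * Suc n choose Suc n)) = real (2 * (Suc (2 * n) * (2 * n choose n)))" by metis
    then show ?thesis by (simp add: algebra_simps)
  qed
  have key: "2 * sqrt (real n) * sqrt (real (Suc n)) \<le> 2 * real n + 1"
    using arith_geo_mean_sqrt[of "real n" "real (Suc n)"] by (simp add: real_sqrt_mult)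
  have "4 ^ Suc n * sqrt (real (Suc n)) \<le> 4 * (2 * sqrt (real n) * real (2 * n choose n)) * sqrt (real (Suc n))"
    using step by (intro mult_right_mono) auto
  also have "\<dots> = 4 * real (2 * n choose n) * (2 * sqrt (real n) * sqrt (real (Suc n)))" by simp
  also have "\<dots> \<le> 4 * real (2 * n choose n) * (2 * real n + 1)" by (intro mult_left_mono key) auto
  also have "\<dots> = 2 * (sqrt (real (Suc n)) * sqrt (real (Suc n))) * real (2 * Suc n choose Suc n)"
  proof -
    have sq: "sqrt (real (Suc n)) * sqrt (real (Suc n)) = real (Suc n)" by simp
    show ?thesis unfolding sq mult.assoc rec by (simp add: algebra_simps)
  qed
  also have "\<dots> = (2 * sqrt (real (Suc n)) * real (2 * Suc n choose Suc n)) * sqrt (real (Suc n))" by simp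
  finally show ?case by (rule mult_right_le_imp_le) simp
qed simp

text \<open>The factor \<open>4^P / (2P choose P)\<close> makes the integral over a period equal to
  1. For large \<open>P\<close> the function resembles a Gaussian of width \<open>P^(-1/2)\<close>
  repeated at every integer.\<close>

definition kern :: "nat \<Rightarrow> real \<Rightarrow> real" where
  "kern P x = cos (pi * x) ^ (2 * P) * 4 ^ P / real (2 * P choose P)"

text \<open>The Fourier coefficient of \<open>kern P\<close> at the integer frequency
  \<open>j - P\<close>; the shift lets natural numbers index the frequencies from \<open>- P\<close>
  to \<open>P\<close>.\<close>

definition kern_coeff :: "nat \<Rightarrow> nat \<Rightarrow> real" where
  "kern_coeff P j = real (2 * P choose j) / real (2 * P choose P)"

lemma kern_coeff_nonneg: "0 \<le> kern_coeff P j"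
  by (simp add: kern_coeff_def)

lemma kern_coeff_le_1: "kern_coeff P j \<le> 1"
  using binomial_maximum'[of P j] by (simp add: kern_coeff_def)

lemma kern_coeff_center: "kern_coeff P P = 1"
  by (simp add: kern_coeff_def)

lemma inverse_central_binomial_le: "1 \<le> P \<Longrightarrow> 4 ^ P / real (2 * P choose P) \<le> 2 * sqrt (real P)"
  using central_binomial_ge[of P] by (simp add: divide_le_eq)

lemma sum_kern_coeff_le: "1 \<le> P \<Longrightarrow> (\<Sum>j\<le>2*P. kern_coeff P j) \<le> 2 * sqrt (real P)"
proof -
  assume P: "1 \<le> P"
  have "(\<Sum>j\<le>2*P. real (2 * P choose j)) = 4 ^ P"
    using choose_row_sum[of "2 * P"] by (simp add: power_mult flip: of_nat_sum)
  then show ?thesis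
    using inverse_central_binomial_le[OF P] by (simp add: kern_coeff_def flip: sum_divide_distrib)
qed

lemma kern_nonneg: "0 \<le> kern P x"
  by (simp add: kern_def zero_le_even_power)

lemma kern_le: "1 \<le> P \<Longrightarrow> kern P x \<le> 2 * sqrt (real P)"
proof -
  assume P: "1 \<le> P"
  have "\<bar>cos (pi * x)\<bar> ^ (2 * P) \<le> 1" by (intro power_le_one) auto
  then have "cos (pi * x) ^ (2 * P) \<le> 1" by (simp add: power_even_abs)
  then have "kern P x \<le> 1 * (4 ^ P / real (2 * P choose P))"
    unfolding kern_def times_divide_eq_right[symmetric] by (intro mult_right_mono) auto
  then show ?thesis using inverse_central_binomial_le[OF P] by simp
qed

lemma cos_pi_add_int_squared: "(cos (pi * (x + of_int k)))\<^sup>2 = (cos (pi * x))\<^sup>2"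
proof -
  have "sin (pi * of_int k) = 0" by (simp add: sin_zero_iff_int2 mult.commute)
  moreover from this have "(cos (pi * of_int k))\<^sup>2 = 1" using sin_cos_squared_add[of "pi * of_int k"] by simp
  ultimately show ?thesis by (simp add: distrib_left cos_add power_mult_distrib)
qed

lemma kern_periodic: "kern P (x + of_int k) = kern P x"
  by (simp add: kern_def power_mult cos_pi_add_int_squared)

text \<open>At distance \<open>d\<close> from the integers \<open>sin(pi x)^2\<close> is at least
  \<open>4 d^2\<close>, hence \<open>cos(pi x)^2 \<le> 1 - 4 d^2 \<le> exp(- 4 d^2)\<close>; the
  \<open>P\<close>-th power is then multiplied by the height of the kernel.\<close>

lemma kern_le_away:
  assumes P: "1 \<le> P" and d: "0 < d" "\<And>k::int. d \<le> \<bar>x - of_int k\<bar>"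
  shows "kern P x \<le> 2 * sqrt (real P) * exp (- 4 * real P * d\<^sup>2)"
proof -
  have f: "frac x + of_int \<lfloor>x\<rfloor> = x" by (simp add: frac_def)
  have "d \<le> frac x" using d(2)[of "\<lfloor>x\<rfloor>"] frac_ge_0[of x] by (simp add: frac_def)
  moreover have "frac x \<le> 1 - d" using d(2)[of "\<lfloor>x\<rfloor> + 1"] frac_lt_1[of x] by (simp add: frac_def)
  ultimately have "2 * d \<le> sin (pi * frac x)" by (intro sin_pi_ge d(1))
  then have "(2 * d)\<^sup>2 \<le> (sin (pi * frac x))\<^sup>2" using d(1) by (intro power_mono) auto
  then have "(cos (pi * frac x))\<^sup>2 \<le> 1 - 4 * d\<^sup>2"
    unfolding cos_squared_eq by (simp add: power_mult_distrib)
  also have "\<dots> \<le> exp (- (4 * d\<^sup>2))" using exp_ge_add_one_self[of "- (4 * d\<^sup>2)"] by simp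
  finally have c: "(cos (pi * x))\<^sup>2 \<le> exp (- (4 * d\<^sup>2))"
    using cos_pi_add_int_squared[of "frac x" "\<lfloor>x\<rfloor>"] by (simp only: f)
  have "cos (pi * x) ^ (2 * P) \<le> exp (- (4 * d\<^sup>2)) ^ P"
    unfolding power_mult by (intro power_mono c) auto
  also have "\<dots> = exp (- 4 * real P * d\<^sup>2)" by (simp add: exp_of_nat_mult[symmetric] algebra_simps)
  finally have "cos (pi * x) ^ (2 * P) * (4 ^ P / real (2 * P choose P)) \<le> exp (- 4 * real P * d\<^sup>2) * (2 * sqrt (real P))"
    using inverse_central_binomial_le[OF P] by (intro mult_mono) auto
  then show ?thesis by (simp add: kern_def mult.commute)
qed

text \<open>Expand \<open>(2 cos(pi x))^(2P) = (cis(- pi x) * (cis(2 pi x) + 1))^(2P)\<close> by the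
  binomial theorem.\<close>

lemma kern_fourier_cis:
  "of_real (kern P x) = (\<Sum>j\<le>2*P. of_real (kern_coeff P j) * cis (2 * pi * ((real j - real P) * x)))"
proof -
  let ?N = "2 * P"
  have "complex_of_real (2 * cos (pi * x)) = cis (- (pi * x)) * (cis (2 * (pi * x)) + 1)"
    by (simp add: distrib_left cis_mult) (simp add: complex_eq_iff)
  then have "complex_of_real (2 * cos (pi * x)) ^ ?N = cis (- (pi * x)) ^ ?N * (cis (2 * (pi * x)) + 1) ^ ?N"
    by (simp only: power_mult_distrib)
  also have "(cis (2 * (pi * x)) + 1) ^ ?N = (\<Sum>j\<le>?N. of_nat (?N choose j) * cis (2 * (pi * x)) ^ j)"
    by (simp add: binomial_ring)
  also have "cis (- (pi * x)) ^ ?N * \<dots> = (\<Sum>j\<le>?N. of_nat (?N choose j) * cis (2 * pi * ((real j - real P) * x)))"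
    unfolding sum_distrib_left Complex.DeMoivre
    by (intro sum.cong refl) (simp add: mult.left_commute cis_mult, simp add: algebra_simps)
  finally have main: "complex_of_real (2 * cos (pi * x)) ^ ?N
      = (\<Sum>j\<le>?N. of_nat (?N choose j) * cis (2 * pi * ((real j - real P) * x)))" .
  have "kern P x = (2 * cos (pi * x)) ^ ?N / real (?N choose P)"
    by (simp add: kern_def power_mult power_mult_distrib)
  then have "complex_of_real (kern P x) = complex_of_real (2 * cos (pi * x)) ^ ?N / of_nat (?N choose P)"
    by simp
  also have "\<dots> = (\<Sum>j\<le>?N. of_real (kern_coeff P j) * cis (2 * pi * ((real j - real P) * x)))"
    unfolding main sum_divide_distrib by (intro sum.cong refl) (simp add: kern_coeff_def)
  finally show ?thesis .
qed

lemma kern_fourier: "kern P x = (\<Sum>j\<le>2*P. kern_coeff P j * cos (2 * pi * ((real j - real P) * x)))"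
  using arg_cong[OF kern_fourier_cis[of P x], of Re] by simp

lemma kern_product_fourier:
  "kern P x * kern P y = (\<Sum>j\<le>2*P. \<Sum>k\<le>2*P. kern_coeff P j * kern_coeff P k *
     cos (2 * pi * ((real j - real P) * x + (real k - real P) * y)))"
proof -
  have "complex_of_real (kern P x) * of_real (kern P y) = (\<Sum>j\<le>2*P. \<Sum>k\<le>2*P.
     of_real (kern_coeff P j * kern_coeff P k) * cis (2 * pi * ((real j - real P) * x + (real k - real P) * y)))"
    unfolding kern_fourier_cis sum_product
    by (intro sum.cong refl) (simp add: distrib_left flip: cis_mult)
  from arg_cong[OF this, of Re] show ?thesis by simp
qed

lemma continuous_on_kern[continuous_intros]:
  fixes f :: "'a::t2_space \<Rightarrow> real"
  assumes "continuous_on A f"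
  shows "continuous_on A (\<lambda>x. kern P (f x))"
  unfolding kern_def by (intro continuous_intros assms continuous_on_cos) simp

lemma kern_integral_period: "(kern P has_integral 1) {-1/2..1/2}"
proof -
  have c: "((\<lambda>x. cos (2 * pi * ((real j - real P) * x))) has_integral (if j = P then 1 else 0)) {-1/2..1/2}" for j
  proof (cases "j = P")
    case True
    then show ?thesis using has_integral_const_real[of 1 "-1/2" "1/2"] by simp
  next
    case False
    define m where "m = real j - real P"
    have m: "m \<noteq> 0" using False by (simp add: m_def)
    have s0: "sin (pi * m) = 0"
    proof -
      have "m = of_int (int j - int P)" by (simp add: m_def)
      then show ?thesis by (simp add: sin_zero_iff_int2) (metis mult.commute of_int_diff of_int_of_nat_eq)
    qed
    have "((\<lambda>x. cos (2 * pi * (m * x))) has_integral sin (2 * pi * (m * (1/2))) / (2 * pi * m) - sin (2 * pi * (m * (-1/2))) / (2 * pi * m)) {-1/2..1/2}"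
    proof (rule fundamental_theorem_of_calculus)
      show "((\<lambda>x. sin (2 * pi * (m * x)) / (2 * pi * m)) has_vector_derivative cos (2 * pi * (m * x))) (at x within {-1/2..1/2})" for x
        unfolding has_real_derivative_iff_has_vector_derivative[symmetric]
        using m by (auto intro!: derivative_eq_intros)
    qed simp
    then show ?thesis using False s0 by (simp add: m_def)
  qed
  have "((\<lambda>x. \<Sum>j\<le>2*P. kern_coeff P j * cos (2 * pi * ((real j - real P) * x)))
     has_integral (\<Sum>j\<le>2*P. kern_coeff P j * (if j = P then 1 else 0))) {-1/2..1/2}"
    by (intro has_integral_sum has_integral_mult_right c) auto
  moreover have "(\<Sum>j\<le>2*P. kern_coeff P j * (if j = P then 1 else 0)) = 1"
  proof -
    have "(\<Sum>j\<le>2*P. kern_coeff P j * (if j = P then 1 else 0)) = (\<Sum>j\<le>2*P. if j = P then kern_coeff P j else 0)"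
      by (intro sum.cong) auto
    then show ?thesis by (simp add: kern_coeff_center)
  qed
  ultimately show ?thesis by (simp add: kern_fourier[symmetric])
qed

text \<open>Within one period the complement of \<open>{-d..d}\<close> has length below 1, and there
  the kernel is at most the bound of \<open>kern_le_away\<close>.\<close>

lemma kern_integral_center:
  assumes P: "1 \<le> P" and d: "0 < d" "d < 1/2"
  shows "integral {-d..d} (kern P) \<le> 1"
    and "1 - 2 * sqrt (real P) * exp (- 4 * real P * d\<^sup>2) \<le> integral {-d..d} (kern P)"
proof -
  define \<tau> where "\<tau> = 2 * sqrt (real P) * exp (- 4 * real P * d\<^sup>2)"
  have \<tau>: "0 \<le> \<tau>" by (simp add: \<tau>_def)
  have int: "kern P integrable_on {a..b}" for a b
    by (intro integrable_continuous_interval continuous_intros)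
  have away: "kern P x \<le> \<tau>" if x: "d \<le> \<bar>x\<bar>" "\<bar>x\<bar> \<le> 1/2" for x
    unfolding \<tau>_def
  proof (rule kern_le_away[OF P d(1)])
    fix k :: int
    show "d \<le> \<bar>x - of_int k\<bar>"
    proof (cases "k = 0")
      case False
      then have "1 \<le> \<bar>real_of_int k\<bar>" by (simp flip: of_int_abs)
      then show ?thesis using x d by linarith
    qed (use x in simp)
  qed
  have one: "integral {-1/2..1/2} (kern P) = 1" using kern_integral_period by (rule integral_unique)
  have "integral {-1/2..1/2} (kern P) = integral {-1/2..-d} (kern P) + integral {-d..1/2} (kern P)"
    by (rule Henstock_Kurzweil_Integration.integral_combine[symmetric]) (use d int in auto)
  also have "integral {-d..1/2} (kern P) = integral {-d..d} (kern P) + integral {d..1/2} (kern P)"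
    by (rule Henstock_Kurzweil_Integration.integral_combine[symmetric]) (use d int in auto)
  finally have sp: "1 = integral {-1/2..-d} (kern P) + (integral {-d..d} (kern P) + integral {d..1/2} (kern P))"
    using one by simp
  have nn: "0 \<le> integral {a..b} (kern P)" for a b
    by (intro integral_nonneg int kern_nonneg)
  show "integral {-d..d} (kern P) \<le> 1" using sp nn[of "-1/2" "-d"] nn[of d "1/2"] by linarith
  have "integral {-1/2..-d} (kern P) \<le> integral {-1/2..-d} (\<lambda>_. \<tau>)"
    by (intro integral_le int away) (use d in auto)
  also have "\<dots> \<le> \<tau> / 2" using d \<tau> mult_right_mono[of "1/2 - d" "1/2" \<tau>] by simp
  finally have 1: "integral {-1/2..-d} (kern P) \<le> \<tau> / 2" .
  have "integral {d..1/2} (kern P) \<le> integral {d..1/2} (\<lambda>_. \<tau>)"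
    by (intro integral_le int away) (use d in auto)
  also have "\<dots> \<le> \<tau> / 2" using d \<tau> mult_right_mono[of "1/2 - d" "1/2" \<tau>] by simp
  finally show "1 - 2 * sqrt (real P) * exp (- 4 * real P * d\<^sup>2) \<le> integral {-d..d} (kern P)"
    using sp 1 unfolding \<tau>_def[symmetric] by linarith
qed

lemma set_lebesgue_integral_kern_shift:
  "(\<integral>x. indicator {of_int i - d..of_int i + d} x * kern P x \<partial>lborel) = integral {-d..d} (kern P)"
proof -
  have "(\<integral>x. indicator {of_int i - d..of_int i + d} x * kern P x \<partial>lborel)
    = \<bar>1\<bar> *\<^sub>R (\<integral>x. indicator {of_int i - d..of_int i + d} (of_int i + 1 * x) * kern P (of_int i + 1 * x) \<partial>lborel)"
    by (rule lborel_integral_real_affine) simp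
  also have "\<dots> = (\<integral>x. indicator {-d..d} x * kern P x \<partial>lborel)"
    using kern_periodic[of P _ i] by (auto intro!: Bochner_Integration.integral_cong simp: indicator_def add.commute)
  also have "\<dots> = integral {-d..d} (kern P)"
  proof -
    have "set_integrable lborel {-d..d} (kern P)"
      by (intro borel_integrable_atLeastAtMost') (intro continuous_intros)
    from set_borel_integral_eq_integral(2)[OF this] show ?thesis
      by (simp add: set_lebesgue_integral_def)
  qed
  finally show ?thesis .
qed

section \<open>Comparing the lattice point count with the smoothed count\<close>

definition lattice_disc :: "real \<Rightarrow> (int \<times> int) set" where
  "lattice_disc r = {k. (of_int (fst k))\<^sup>2 + (of_int (snd k))\<^sup>2 \<le> r\<^sup>2}"

text \<open>Every lattice point is replaced by a bump of total mass 1 over its unit cell, and the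
  mass inside the disc is measured.\<close>

definition smooth_count :: "nat \<Rightarrow> real \<Rightarrow> real" where
  "smooth_count P r = (\<integral>z. indicator (disc r) z * (kern P (fst z) * kern P (snd z)) \<partial>lborel)"

text \<open>Squares suit the product kernel: the mass in a box is the square of a one-dimensional
  integral. For \<open>d < 1/2\<close> boxes about different lattice points are disjoint.\<close>

definition lattice_box :: "real \<Rightarrow> int \<times> int \<Rightarrow> (real \<times> real) set" where
  "lattice_box d k = {of_int (fst k) - d..of_int (fst k) + d} \<times> {of_int (snd k) - d..of_int (snd k) + d}"

lemma lattice_disc_subset:
  assumes "0 \<le> r"
  shows "lattice_disc r \<subseteq> {-\<lfloor>r\<rfloor>..\<lfloor>r\<rfloor>} \<times> {-\<lfloor>r\<rfloor>..\<lfloor>r\<rfloor>}"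
proof
  fix k assume k: "k \<in> lattice_disc r"
  have "(of_int (fst k))\<^sup>2 \<le> r\<^sup>2" "(of_int (snd k))\<^sup>2 \<le> r\<^sup>2"
    using k zero_le_power2[of "real_of_int (fst k)"] zero_le_power2[of "real_of_int (snd k)"]
    unfolding lattice_disc_def mem_Collect_eq by linarith+
  then have "\<bar>real_of_int (fst k)\<bar> \<le> r" "\<bar>real_of_int (snd k)\<bar> \<le> r"
    using assms by (simp_all flip: abs_le_square_iff)
  then have "\<bar>fst k\<bar> \<le> \<lfloor>r\<rfloor>" "\<bar>snd k\<bar> \<le> \<lfloor>r\<rfloor>" by (simp_all add: le_floor_iff)
  then show "k \<in> {-\<lfloor>r\<rfloor>..\<lfloor>r\<rfloor>} \<times> {-\<lfloor>r\<rfloor>..\<lfloor>r\<rfloor>}" by (cases k) (auto simp: abs_le_iff)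
qed

lemma finite_lattice_disc: "finite (lattice_disc r)"
proof -
  have "lattice_disc r = lattice_disc \<bar>r\<bar>" by (simp add: lattice_disc_def)
  then show ?thesis using finite_subset[OF lattice_disc_subset[of "\<bar>r\<bar>"]] by simp
qed

lemma card_lattice_disc_le:
  assumes "0 \<le> r"
  shows "real (card (lattice_disc r)) \<le> (2 * r + 1)\<^sup>2"
proof -
  have "card (lattice_disc r) \<le> card ({-\<lfloor>r\<rfloor>..\<lfloor>r\<rfloor>} \<times> {-\<lfloor>r\<rfloor>..\<lfloor>r\<rfloor>})"
    by (intro card_mono lattice_disc_subset assms) auto
  also have "\<dots> = nat (2 * \<lfloor>r\<rfloor> + 1) ^ 2" by (simp add: card_cartesian_product power2_eq_square)
  finally have "real (card (lattice_disc r)) \<le> real (nat (2 * \<lfloor>r\<rfloor> + 1)) ^ 2"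
    by (simp flip: of_nat_power)
  also have "\<dots> \<le> (2 * r + 1)\<^sup>2" using assms by (intro power_mono) auto
  finally show ?thesis .
qed

lemma integrable_lattice_box:
  fixes f :: "real \<times> real \<Rightarrow> real"
  assumes "continuous_on UNIV f"
  shows "integrable lborel (\<lambda>z. indicator (lattice_box d k) z * f z)"
proof -
  have "compact (lattice_box d k)" unfolding lattice_box_def by (intro compact_Times compact_Icc)
  from borel_integrable_compact[OF this continuous_on_subset[OF assms]] show ?thesis by simp
qed

lemma integral_box_kern:
  "(\<integral>z. indicator (lattice_box d k) z * (kern P (fst z) * kern P (snd z)) \<partial>lborel) = (integral {-d..d} (kern P))\<^sup>2"
proof -
  let ?f = "\<lambda>i x. indicator {of_int i - d..of_int i + d} x * kern P x"
  have "integrable (lborel \<Otimes>\<^sub>M lborel) (\<lambda>z. indicator (lattice_box d k) z * (kern P (fst z) * kern P (snd z)))"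
    unfolding lborel_prod by (intro integrable_lattice_box continuous_intros)
  from lborel_pair.integral_fst'[OF this]
  have "(\<integral>z. indicator (lattice_box d k) z * (kern P (fst z) * kern P (snd z)) \<partial>lborel)
     = (\<integral>x. (\<integral>y. indicator (lattice_box d k) (x, y) * (kern P x * kern P y) \<partial>lborel) \<partial>lborel)"
    by (simp add: lborel_prod)
  also have "\<dots> = (\<integral>x. (\<integral>y. ?f (fst k) x * ?f (snd k) y \<partial>lborel) \<partial>lborel)"
    by (intro Bochner_Integration.integral_cong refl) (auto simp: lattice_box_def indicator_def)
  also have "\<dots> = (integral {-d..d} (kern P))\<^sup>2"
    by (simp only: integral_mult_right_zero integral_mult_left_zero set_lebesgue_integral_kern_shift power2_eq_square)
  finally show ?thesis .
qed

lemma lattice_box_disjoint: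
  assumes "d < 1/2" "z \<in> lattice_box d k" "z \<in> lattice_box d l"
  shows "k = l"
proof -
  have "i = j" if "\<bar>x - real_of_int i\<bar> \<le> d" "\<bar>x - real_of_int j\<bar> \<le> d" for x and i j :: int
  proof -
    have "\<bar>real_of_int (i - j)\<bar> < 1" using that assms(1) by simp
    then show ?thesis by linarith
  qed
  from this[of "fst z" "fst k" "fst l"] this[of "snd z" "snd k" "snd l"] show ?thesis
    using assms by (auto simp: lattice_box_def abs_le_iff prod_eq_iff)
qed

lemma sum_indicator_box_le_1:
  assumes "d < 1/2" "finite L"
  shows "(\<Sum>k\<in>L. indicator (lattice_box d k) z) \<le> (1 :: real)"
proof (cases "\<exists>k\<in>L. z \<in> lattice_box d k")
  case True
  then obtain k where k: "k \<in> L" "z \<in> lattice_box d k" by blast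
  have "indicator (lattice_box d l) z = (if l = k then 1 else 0 :: real)" for l
  proof (cases "l = k")
    case False
    then have "z \<notin> lattice_box d l" using lattice_box_disjoint[OF assms(1) k(2), of l] by blast
    then show ?thesis using False by simp
  qed (use k(2) in simp)
  then show ?thesis using assms(2) by simp
next
  case False
  then have "(\<Sum>l\<in>L. indicator (lattice_box d l) z) = (\<Sum>l\<in>L. 0 :: real)"
    by (intro sum.cong) (auto simp: indicator_def)
  then show ?thesis by simp
qed

lemma norm_in_box:
  assumes z: "z \<in> lattice_box d k" and d: "0 \<le> d"
  shows "\<bar>norm z - norm (of_int (fst k) :: real, of_int (snd k) :: real)\<bar> \<le> 2 * d"
proof -
  have "norm (z - (of_int (fst k), of_int (snd k))) \<le> \<bar>fst z - of_int (fst k)\<bar> + \<bar>snd z - of_int (snd k)\<bar>"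
    by (cases z) (simp add: norm_Pair sqrt_sum_squares_le_sum_abs)
  also have "\<dots> \<le> 2 * d" using z by (auto simp: lattice_box_def)
  finally show ?thesis using norm_triangle_ineq3 order.trans by blast
qed

lemma lattice_disc_iff_norm:
  assumes "0 \<le> r"
  shows "k \<in> lattice_disc r \<longleftrightarrow> norm (of_int (fst k) :: real, of_int (snd k) :: real) \<le> r"
  using real_sqrt_le_iff[of "(of_int (fst k))\<^sup>2 + (of_int (snd k))\<^sup>2" "r\<^sup>2"] assms
  by (simp add: lattice_disc_def norm_Pair)

text \<open>The boxes about the lattice points of the disc of radius \<open>r\<close> are disjoint
  and contained in the disc of radius \<open>r + 2 d\<close>, and each of them carries nearly the
  full mass 1 of the nonnegative kernel.\<close>

lemma lattice_disc_le_smooth_count: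
  assumes P: "1 \<le> P" and d: "0 < d" "d < 1/2" and r: "0 \<le> r"
  shows "real (card (lattice_disc r)) * (1 - 4 * sqrt (real P) * exp (- 4 * real P * d\<^sup>2)) \<le> smooth_count P (r + 2 * d)"
proof -
  let ?K = "\<lambda>z. kern P (fst z) * kern P (snd z)"
  let ?b = "integral {-d..d} (kern P)"
  define t where "t = 2 * sqrt (real P) * exp (- 4 * real P * d\<^sup>2)"
  have "1 - t \<le> ?b" "0 \<le> ?b"
    using kern_integral_center(2)[OF P d] kern_nonneg
    by (auto simp: t_def intro!: Henstock_Kurzweil_Integration.integral_nonneg integrable_continuous_interval continuous_intros)
  \<comment> \<open>This gives \<open>?b\<^sup>2 \<ge> 2 * ?b - 1\<close>, hence at least
    \<open>1 - 2 * t\<close>.\<close>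
  moreover have "(?b - 1)\<^sup>2 \<ge> 0" by simp
  ultimately have b: "1 - 2 * t \<le> ?b\<^sup>2" by (simp add: power2_eq_square algebra_simps)
  have "real (card (lattice_disc r)) * ?b\<^sup>2 = (\<integral>z. (\<Sum>k\<in>lattice_disc r. indicator (lattice_box d k) z * ?K z) \<partial>lborel)"
    by (subst Bochner_Integration.integral_sum) (auto intro!: integrable_lattice_box continuous_intros simp: integral_box_kern)
  also have "\<dots> \<le> smooth_count P (r + 2 * d)"
    unfolding smooth_count_def
  proof (rule integral_mono)
    show "integrable lborel (\<lambda>z. \<Sum>k\<in>lattice_disc r. indicator (lattice_box d k) z * ?K z)"
      by (intro Bochner_Integration.integrable_sum integrable_lattice_box continuous_intros)
    show "integrable lborel (\<lambda>z. indicator (disc (r + 2 * d)) z * ?K z)"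
      by (intro integrable_disc continuous_intros)
    fix z :: "real \<times> real"
    have "(\<Sum>k\<in>lattice_disc r. indicator (lattice_box d k) z) \<le> (indicator (disc (r + 2 * d)) z :: real)"
    proof (cases "z \<in> disc (r + 2 * d)")
      case True
      then show ?thesis using sum_indicator_box_le_1[OF d(2) finite_lattice_disc] by simp
    next
      case False
      have "z \<notin> lattice_box d k" if "k \<in> lattice_disc r" for k
      proof
        assume "z \<in> lattice_box d k"
        then have "norm z \<le> r + 2 * d"
          using norm_in_box[of z d k] d that r by (simp add: lattice_disc_iff_norm)
        then show False using False d r by (simp add: disc_eq_cball)
      qed
      then have "(\<Sum>k\<in>lattice_disc r. indicator (lattice_box d k) z) = (0::real)" by (intro sum.neutral) auto
      then show ?thesis by simp
    qed
    then show "(\<Sum>k\<in>lattice_disc r. indicator (lattice_box d k) z * ?K z) \<le> indicator (disc (r + 2 * d)) z * ?K z"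
      unfolding sum_distrib_right[symmetric] by (intro mult_right_mono) (auto simp: kern_nonneg)
  qed
  finally have "real (card (lattice_disc r)) * ?b\<^sup>2 \<le> smooth_count P (r + 2 * d)" .
  moreover have "real (card (lattice_disc r)) * (1 - 2 * t) \<le> real (card (lattice_disc r)) * ?b\<^sup>2"
    by (intro mult_left_mono b) auto
  ultimately show ?thesis by (simp add: t_def mult.assoc)
qed

text \<open>A point of the disc either lies in a box about a lattice point of the enlarged disc, and
  such a box has mass at most 1, or one of its coordinates is at distance at least \<open>d\<close>
  from all integers. In the second case the kernel product is at most the tail bound of one factor
  times the height \<open>2 sqrt P\<close> of the other.\<close>

lemma smooth_count_le_lattice_disc:
  assumes P: "1 \<le> P" and d: "0 < d" "d < 1/2" and r: "0 \<le> r"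
  shows "smooth_count P r \<le> real (card (lattice_disc (r + 2 * d)))
    + 4 * real P * exp (- 4 * real P * d\<^sup>2) * (pi * r\<^sup>2)"
proof -
  let ?K = "\<lambda>z. kern P (fst z) * kern P (snd z)"
  let ?b = "integral {-d..d} (kern P)"
  let ?L = "lattice_disc (r + 2 * d)"
  define \<epsilon> where "\<epsilon> = 4 * real P * exp (- 4 * real P * d\<^sup>2)"
  have \<epsilon>: "0 \<le> \<epsilon>" by (simp add: \<epsilon>_def)
  have "0 \<le> ?b" "?b \<le> 1"
    using kern_integral_center(1)[OF P d] kern_nonneg
    by (auto intro!: Henstock_Kurzweil_Integration.integral_nonneg integrable_continuous_interval continuous_intros)
  then have b: "?b\<^sup>2 \<le> 1" by (simp add: power_le_one)
  have away: "?K z \<le> \<epsilon>" if z: "z \<in> disc r" "\<And>k. k \<in> ?L \<Longrightarrow> z \<notin> lattice_box d k" for z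
  proof -
    have notin: "z \<notin> lattice_box d k" for k
    proof
      assume k: "z \<in> lattice_box d k"
      then have "norm (of_int (fst k) :: real, of_int (snd k) :: real) \<le> r + 2 * d"
        using norm_in_box[of z d k] d z(1) r by (simp add: disc_eq_cball)
      then have "k \<in> ?L" using d r by (simp add: lattice_disc_iff_norm)
      then show False using z(2) k by blast
    qed
    have "\<not> (\<bar>fst z - of_int i\<bar> \<le> d \<and> \<bar>snd z - of_int j\<bar> \<le> d)" for i j
      using notin[of "(i, j)"] by (auto simp: lattice_box_def abs_le_iff mem_Times_iff)
    then have "(\<forall>i::int. d \<le> \<bar>fst z - of_int i\<bar>) \<or> (\<forall>j::int. d \<le> \<bar>snd z - of_int j\<bar>)"
      by (meson linorder_le_cases)
    moreover have e: "\<epsilon> = (2 * sqrt (real P) * exp (- 4 * real P * d\<^sup>2)) * (2 * sqrt (real P))"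
      by (simp add: \<epsilon>_def)
    ultimately show ?thesis
    proof (elim disjE)
      assume "\<forall>i::int. d \<le> \<bar>fst z - of_int i\<bar>"
      then show ?thesis unfolding e
        by (intro mult_mono kern_le_away kern_le P d) (auto simp: kern_nonneg)
    next
      assume "\<forall>j::int. d \<le> \<bar>snd z - of_int j\<bar>"
      then have "kern P (snd z) * kern P (fst z) \<le> \<epsilon>" unfolding e
        by (intro mult_mono kern_le_away kern_le P d) (auto simp: kern_nonneg)
      then show ?thesis by (simp add: mult.commute)
    qed
  qed
  have "smooth_count P r \<le> (\<integral>z. (\<Sum>k\<in>?L. indicator (lattice_box d k) z * ?K z) + indicator (disc r) z * \<epsilon> \<partial>lborel)"
    unfolding smooth_count_def
  proof (rule integral_mono)
    show "integrable lborel (\<lambda>z. (\<Sum>k\<in>?L. indicator (lattice_box d k) z * ?K z) + indicator (disc r) z * \<epsilon>)"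
      by (intro Bochner_Integration.integrable_add Bochner_Integration.integrable_sum integrable_lattice_box integrable_disc continuous_intros)
    show "integrable lborel (\<lambda>z. indicator (disc r) z * ?K z)"
      by (intro integrable_disc continuous_intros)
    fix z :: "real \<times> real"
    have nn: "0 \<le> indicator (lattice_box d k) z * ?K z" for k by (simp add: kern_nonneg)
    show "indicator (disc r) z * ?K z \<le> (\<Sum>k\<in>?L. indicator (lattice_box d k) z * ?K z) + indicator (disc r) z * \<epsilon>"
    proof (cases "z \<in> disc r \<and> (\<exists>k\<in>?L. z \<in> lattice_box d k)")
      case True
      then obtain k where k: "k \<in> ?L" "z \<in> lattice_box d k" by blast
      have "indicator (lattice_box d k) z * ?K z \<le> (\<Sum>k\<in>?L. indicator (lattice_box d k) z * ?K z)"
        by (rule member_le_sum[OF k(1)]) (auto simp: kern_nonneg finite_lattice_disc)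
      then show ?thesis using k True \<epsilon> by simp
    next
      case False
      have "0 \<le> (\<Sum>k\<in>?L. indicator (lattice_box d k) z * ?K z)" by (intro sum_nonneg nn)
      then show ?thesis using False away[of z] by (cases "z \<in> disc r") auto
    qed
  qed
  also have "\<dots> = (\<integral>z. (\<Sum>k\<in>?L. indicator (lattice_box d k) z * ?K z) \<partial>lborel) + (\<integral>z. indicator (disc r) z * \<epsilon> \<partial>lborel)"
    by (intro Bochner_Integration.integral_add Bochner_Integration.integrable_sum integrable_lattice_box integrable_disc continuous_intros)
  also have "(\<integral>z. (\<Sum>k\<in>?L. indicator (lattice_box d k) z * ?K z) \<partial>lborel) = real (card ?L) * ?b\<^sup>2"
    by (subst Bochner_Integration.integral_sum) (auto intro!: integrable_lattice_box continuous_intros simp: integral_box_kern)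
  also have "(\<integral>z. indicator (disc r) z * \<epsilon> \<partial>lborel) = \<epsilon> * (pi * r\<^sup>2)"
    using r by (simp add: measure_disc)
  also have "real (card ?L) * ?b\<^sup>2 \<le> real (card ?L) * 1" by (intro mult_left_mono b) auto
  finally show ?thesis by (simp add: \<epsilon>_def)
qed

text \<open>The frequency \<open>(j - P, k - P)\<close> is indexed by \<open>(j, k)\<close>, so \<open>(P, P)\<close> is the zero frequency.\<close>

definition freq :: "nat \<Rightarrow> nat \<times> nat \<Rightarrow> real" where
  "freq P m = sqrt ((real (fst m) - real P)\<^sup>2 + (real (snd m) - real P)\<^sup>2)"

lemma smooth_count_fourier:
  assumes r: "0 < r"
  shows "smooth_count P r = pi * r\<^sup>2 + (\<Sum>m\<in>{..2*P} \<times> {..2*P} - {(P, P)}.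
     kern_coeff P (fst m) * kern_coeff P (snd m) * (2 * r\<^sup>2 * disc_transform (2 * pi * freq P m * r)))"
proof -
  let ?M = "{..2*P} \<times> {..2*P}"
  let ?c = "\<lambda>m. kern_coeff P (fst m) * kern_coeff P (snd m)"
  let ?g = "\<lambda>m z. indicator (disc r) z * cos (2 * pi * ((real (fst m) - real P) * fst z + (real (snd m) - real P) * snd z))"
  have int: "integrable lborel (?g m)" for m
    by (intro integrable_disc continuous_intros)
  have "smooth_count P r = (\<integral>z. (\<Sum>m\<in>?M. ?c m * ?g m z) \<partial>lborel)"
    unfolding smooth_count_def
    by (intro Bochner_Integration.integral_cong refl)
       (simp add: kern_product_fourier sum.cartesian_product sum_distrib_left split_beta mult_ac)
  also have "\<dots> = (\<Sum>m\<in>?M. ?c m * (\<integral>z. ?g m z \<partial>lborel))"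
    by (subst Bochner_Integration.integral_sum) (auto intro!: integrable_mult_right int)
  also have "\<dots> = ?c (P, P) * (\<integral>z. ?g (P, P) z \<partial>lborel) + (\<Sum>m\<in>?M - {(P, P)}. ?c m * (\<integral>z. ?g m z \<partial>lborel))"
    by (rule sum.remove) auto
  also have "(\<integral>z. ?g (P, P) z \<partial>lborel) = pi * r\<^sup>2"
    using r by (simp add: measure_disc)
  also have "(\<Sum>m\<in>?M - {(P, P)}. ?c m * (\<integral>z. ?g m z \<partial>lborel))
      = (\<Sum>m\<in>?M - {(P, P)}. ?c m * (2 * r\<^sup>2 * disc_transform (2 * pi * freq P m * r)))"
    by (simp only: disc_fourier[OF r] freq_def)
  finally show ?thesis by (simp add: kern_coeff_center)
qed

section \<open>Sums over frequencies weighted by the kernel coefficients\<close>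

text \<open>Weighted means replace the comparison with an integral:
  \<open>N^(1-u) (N+1)^u \<le> (1-u) N + u (N+1)\<close>, and division by \<open>(N+1)^u\<close>
  gives exactly the inequality that telescopes.\<close>

lemma sum_powr_neg_le:
  fixes u :: real
  assumes "0 < u" "u < 1"
  shows "(\<Sum>n=1..N. real n powr (-u)) \<le> real N powr (1 - u) / (1 - u)"
proof (induction N)
  case (Suc N)
  let ?x = "real (Suc N)"
  have "real N powr (1 - u) * ?x powr u \<le> (1 - u) * real N + u * ?x"
    using Youngs_inequality_0[of "1 - u" u "real N" ?x] assms by (cases "N = 0") auto
  also have "\<dots> = ?x - (1 - u)" by (simp add: algebra_simps)
  finally have "(real N powr (1 - u) * ?x powr u) * ?x powr (-u) \<le> (?x - (1 - u)) * ?x powr (-u)"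
    by (intro mult_right_mono) auto
  moreover have "(real N powr (1 - u) * ?x powr u) * ?x powr (-u) = real N powr (1 - u)"
    by (simp add: powr_minus field_simps)
  moreover have "?x * ?x powr (-u) = ?x powr (1 - u)"
    using powr_mult_base[of ?x "-u"] by simp
  ultimately have "real N powr (1 - u) \<le> ?x powr (1 - u) - (1 - u) * ?x powr (-u)"
    by (simp only: left_diff_distrib)
  then have "?x powr (-u) \<le> (?x powr (1 - u) - real N powr (1 - u)) / (1 - u)"
    using assms by (simp add: field_simps)
  then show ?case using Suc by (simp add: diff_divide_distrib)
qed simp

text \<open>The coefficients act as a cutoff at frequency \<open>sqrt P\<close>. Below it they are
  bounded by 1; above it the power is at most \<open>sqrt P powr (-u)\<close> while all coefficients
  together sum to at most \<open>2 sqrt P\<close>. Both parts are of order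
  \<open>sqrt P powr (1 - u)\<close>.\<close>

lemma sum_kern_coeff_powr_le:
  fixes u :: real
  assumes u: "0 < u" "u < 1" and P: "1 \<le> P"
  shows "(\<Sum>j\<le>2*P. kern_coeff P j * max 1 \<bar>real j - real P\<bar> powr (-u))
       \<le> (4 + 2 / (1 - u)) * sqrt (real P) powr (1 - u)"
proof -
  define X where "X = sqrt (real P) powr (1 - u)"
  define h where "h n = (if real n \<le> sqrt (real P) then max 1 (real n) powr (-u) else 0)" for n :: nat
  have sP: "1 \<le> sqrt (real P)" using P by simp
  have X1: "1 \<le> X" unfolding X_def using sP u by (intro ge_one_powr_ge_zero) auto
  have h0: "0 \<le> h n" for n by (simp add: h_def)
  have hsum: "(\<Sum>n\<le>P. h n) \<le> 1 + X / (1 - u)"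
  proof -
    define N where "N = nat \<lfloor>sqrt (real P)\<rfloor>"
    have N: "real N \<le> sqrt (real P)" unfolding N_def by simp
    have NP: "n \<le> N" if "real n \<le> sqrt (real P)" for n
      using that unfolding N_def by (simp add: le_nat_floor)
    have "(\<Sum>n\<le>P. h n) \<le> (\<Sum>n\<in>insert 0 {1..N}. max 1 (real n) powr (-u))"
    proof -
      have "(\<Sum>n\<le>P. h n) = (\<Sum>n\<in>{..P} \<inter> insert 0 {1..N}. h n)"
        using NP by (intro sum.mono_neutral_right) (auto simp: h_def Suc_le_eq)
      also have "\<dots> \<le> (\<Sum>n\<in>{..P} \<inter> insert 0 {1..N}. max 1 (real n) powr (-u))"
        by (intro sum_mono) (simp add: h_def)
      also have "\<dots> \<le> (\<Sum>n\<in>insert 0 {1..N}. max 1 (real n) powr (-u))"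
        by (intro sum_mono2) auto
      finally show ?thesis .
    qed
    also have "\<dots> = 1 + (\<Sum>n=1..N. real n powr (-u))"
      by simp
    also have "\<dots> \<le> 1 + real N powr (1 - u) / (1 - u)"
      by (intro add_left_mono sum_powr_neg_le u)
    also have "real N powr (1 - u) / (1 - u) \<le> X / (1 - u)"
      unfolding X_def using N u by (intro divide_right_mono powr_mono2) auto
    finally show ?thesis by simp
  qed
  have split: "kern_coeff P j * max 1 \<bar>real j - real P\<bar> powr (-u)
      \<le> h (if j \<le> P then P - j else j - P) + kern_coeff P j * sqrt (real P) powr (-u)" for j
  proof -
    define n where "n = (if j \<le> P then P - j else j - P)"
    have n: "\<bar>real j - real P\<bar> = real n" by (simp add: n_def)
    have c: "0 \<le> kern_coeff P j" "kern_coeff P j \<le> 1" by (rule kern_coeff_nonneg kern_coeff_le_1)+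
    show ?thesis unfolding n n_def[symmetric]
    proof (cases "real n \<le> sqrt (real P)")
      case True
      have "kern_coeff P j * max 1 (real n) powr (-u) \<le> 1 * max 1 (real n) powr (-u)"
        by (intro mult_right_mono c) auto
      then show "kern_coeff P j * max 1 (real n) powr (-u) \<le> h n + kern_coeff P j * sqrt (real P) powr (-u)"
        using True c by (simp add: h_def add_increasing2)
    next
      case False
      have "kern_coeff P j * max 1 (real n) powr (-u) \<le> kern_coeff P j * sqrt (real P) powr (-u)"
        using False sP u c by (intro mult_left_mono powr_mono2') auto
      then show "kern_coeff P j * max 1 (real n) powr (-u) \<le> h n + kern_coeff P j * sqrt (real P) powr (-u)"
        using h0[of n] by linarith
    qed
  qed
  have le1: "(\<Sum>j\<le>2*P. h (if j \<le> P then P - j else j - P)) \<le> 2 * (\<Sum>n\<le>P. h n)"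
  proof -
    have "(\<Sum>j\<le>2*P. h (if j \<le> P then P - j else j - P))
       = (\<Sum>j\<le>P. h (P - j)) + (\<Sum>j\<in>{P<..2*P}. h (j - P))"
    proof -
      have "{..2*P} = {..P} \<union> {P<..2*P}" by auto
      then have "(\<Sum>j\<le>2*P. h (if j \<le> P then P - j else j - P))
        = (\<Sum>j\<le>P. h (if j \<le> P then P - j else j - P)) + (\<Sum>j\<in>{P<..2*P}. h (if j \<le> P then P - j else j - P))"
        by (simp only:) (rule sum.union_disjoint, auto)
      moreover have "(\<Sum>j\<le>P. h (if j \<le> P then P - j else j - P)) = (\<Sum>j\<le>P. h (P - j))"
        by (intro sum.cong) auto
      moreover have "(\<Sum>j\<in>{P<..2*P}. h (if j \<le> P then P - j else j - P)) = (\<Sum>j\<in>{P<..2*P}. h (j - P))"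
        by (intro sum.cong) auto
      ultimately show ?thesis by simp
    qed
    also have "(\<Sum>j\<le>P. h (P - j)) = (\<Sum>n\<le>P. h n)"
      by (rule sum.reindex_bij_witness[of _ "\<lambda>n. P - n" "\<lambda>j. P - j"]) auto
    also have "(\<Sum>j\<in>{P<..2*P}. h (j - P)) = (\<Sum>n\<in>{0<..P}. h n)"
      by (rule sum.reindex_bij_witness[of _ "\<lambda>n. n + P" "\<lambda>j. j - P"]) auto
    also have "\<dots> \<le> (\<Sum>n\<le>P. h n)" by (intro sum_mono2) (auto simp: h0)
    finally show ?thesis by simp
  qed
  have le2: "(\<Sum>j\<le>2*P. kern_coeff P j * sqrt (real P) powr (-u)) \<le> 2 * X"
  proof -
    have "(\<Sum>j\<le>2*P. kern_coeff P j) * sqrt (real P) powr (-u) \<le> 2 * sqrt (real P) * sqrt (real P) powr (-u)"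
      by (intro mult_right_mono sum_kern_coeff_le P) auto
    also have "\<dots> = 2 * X" using powr_mult_base[of "sqrt (real P)" "-u"] sP by (simp add: X_def)
    finally show ?thesis by (simp add: sum_distrib_right)
  qed
  have "(\<Sum>j\<le>2*P. kern_coeff P j * max 1 \<bar>real j - real P\<bar> powr (-u))
     \<le> (\<Sum>j\<le>2*P. h (if j \<le> P then P - j else j - P)) + (\<Sum>j\<le>2*P. kern_coeff P j * sqrt (real P) powr (-u))"
    unfolding sum.distrib[symmetric] by (intro sum_mono split)
  also have "\<dots> \<le> 2 * (\<Sum>n\<le>P. h n) + 2 * X" by (intro add_mono le1 le2)
  also have "\<dots> \<le> 2 * (1 + X / (1 - u)) + 2 * X" using hsum by simp
  also have "\<dots> \<le> (4 + 2 / (1 - u)) * X" using X1 by (simp add: algebra_simps)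
  finally show ?thesis by (simp add: X_def)
qed

text \<open>Bounding the squared length below by a product separates the two coordinates in
  frequency sums. Replacing a zero coordinate by 1 keeps this meaningful on the axes, and it holds
  there because the coordinates are integers, not both zero.\<close>

lemma freq_ge:
  assumes "m \<noteq> (P, P)"
  shows "max 1 \<bar>real (fst m) - real P\<bar> * max 1 \<bar>real (snd m) - real P\<bar> \<le> (freq P m)\<^sup>2"
    and "1 \<le> freq P m"
proof -
  define a b where "a = \<bar>int (fst m) - int P\<bar>" and "b = \<bar>int (snd m) - int P\<bar>"
  have ab: "\<bar>real (fst m) - real P\<bar> = of_int a" "\<bar>real (snd m) - real P\<bar> = of_int b"
    by (simp_all add: a_def b_def)
  have f: "(freq P m)\<^sup>2 = of_int (a * a + b * b)"
    unfolding freq_def using ab by (simp flip: ab power2_eq_square)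
  have nn: "0 \<le> a" "0 \<le> b" "a \<noteq> 0 \<or> b \<noteq> 0"
    using assms by (auto simp: a_def b_def prod_eq_iff)
  have "max 1 a * max 1 b \<le> a * a + b * b"
  proof (cases "a = 0 \<or> b = 0")
    case True
    have "x \<le> x * x" if "1 \<le> x" for x :: int using mult_left_mono[of 1 x x] that by simp
    then show ?thesis using True nn by (auto simp: max_def)
  next
    case False
    have "0 \<le> (a - b) * (a - b)" by simp
    then have "2 * (a * b) \<le> a * a + b * b" by (simp add: algebra_simps)
    moreover have "0 \<le> a * b" using nn by simp
    ultimately have "a * b \<le> a * a + b * b" by linarith
    moreover have "max 1 a = a" "max 1 b = b" using False nn by auto
    ultimately show ?thesis by simp
  qed
  then have "real_of_int (max 1 a * max 1 b) \<le> real_of_int (a * a + b * b)" by (simp only: of_int_le_iff)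
  then show 1: "max 1 \<bar>real (fst m) - real P\<bar> * max 1 \<bar>real (snd m) - real P\<bar> \<le> (freq P m)\<^sup>2"
    unfolding f ab by (simp add: of_int_max)
  have "1 * 1 \<le> max 1 \<bar>real (fst m) - real P\<bar> * max 1 \<bar>real (snd m) - real P\<bar>"
    by (intro mult_mono) auto
  then have "1\<^sup>2 \<le> (freq P m)\<^sup>2" using 1 by simp
  then show "1 \<le> freq P m" by (rule power2_le_imp_le) (simp add: freq_def)
qed

text \<open>By \<open>freq_ge\<close> the summand is at most a product of one-dimensional weights,
  so the double sum is at most the square of the previous one. The values \<open>u = 1/2\<close> and
  \<open>u = 3/4\<close> give the exponents -1 and -3/2 that arise from the slices.\<close>

lemma sum_freq_powr_le:
  fixes u :: real
  assumes u: "0 < u" "u < 1" and P: "1 \<le> P"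
  shows "(\<Sum>m\<in>{..2*P} \<times> {..2*P} - {(P, P)}. kern_coeff P (fst m) * kern_coeff P (snd m) * freq P m powr (- 2 * u))
       \<le> (4 + 2 / (1 - u))\<^sup>2 * real P powr (1 - u)"
proof -
  let ?w = "\<lambda>j. kern_coeff P j * max 1 \<bar>real j - real P\<bar> powr (-u)"
  have w0: "0 \<le> ?w j" for j by (simp add: kern_coeff_nonneg)
  have "kern_coeff P (fst m) * kern_coeff P (snd m) * freq P m powr (- 2 * u) \<le> ?w (fst m) * ?w (snd m)"
    if "m \<noteq> (P, P)" for m
  proof -
    let ?x = "max 1 \<bar>real (fst m) - real P\<bar>" and ?y = "max 1 \<bar>real (snd m) - real P\<bar>"
    have f: "1 \<le> freq P m" by (rule freq_ge(2)[OF that])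
    have "freq P m powr (- 2 * u) = (freq P m powr 2) powr (-u)" by (simp add: powr_powr)
    also have "\<dots> = (freq P m)\<^sup>2 powr (-u)" using f by (simp add: powr_numeral)
    also have "\<dots> \<le> (?x * ?y) powr (-u)"
      using freq_ge(1)[OF that] u by (intro powr_mono2') auto
    also have "\<dots> = ?x powr (-u) * ?y powr (-u)" by (simp add: powr_mult)
    finally have "kern_coeff P (fst m) * kern_coeff P (snd m) * freq P m powr (- 2 * u)
       \<le> kern_coeff P (fst m) * kern_coeff P (snd m) * (?x powr (-u) * ?y powr (-u))"
      by (intro mult_left_mono) (simp_all add: kern_coeff_nonneg)
    then show ?thesis by (simp add: mult_ac)
  qed
  then have "(\<Sum>m\<in>{..2*P} \<times> {..2*P} - {(P, P)}. kern_coeff P (fst m) * kern_coeff P (snd m) * freq P m powr (- 2 * u))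
    \<le> (\<Sum>m\<in>{..2*P} \<times> {..2*P} - {(P, P)}. ?w (fst m) * ?w (snd m))"
    by (intro sum_mono) auto
  also have "\<dots> \<le> (\<Sum>m\<in>{..2*P} \<times> {..2*P}. ?w (fst m) * ?w (snd m))"
    by (intro sum_mono2) (auto intro!: mult_nonneg_nonneg simp: kern_coeff_nonneg)
  also have "\<dots> = (\<Sum>j\<le>2*P. ?w j) * (\<Sum>j\<le>2*P. ?w j)"
    by (simp add: sum_product sum.cartesian_product split_beta)
  also have "\<dots> \<le> ((4 + 2 / (1 - u)) * sqrt (real P) powr (1 - u)) * ((4 + 2 / (1 - u)) * sqrt (real P) powr (1 - u))"
    using u by (intro mult_mono sum_kern_coeff_powr_le u P sum_nonneg w0) (auto intro!: mult_nonneg_nonneg add_nonneg_nonneg)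
  also have "\<dots> = (4 + 2 / (1 - u))\<^sup>2 * (sqrt (real P) powr (1 - u) * sqrt (real P) powr (1 - u))"
    by algebra
  also have "sqrt (real P) powr (1 - u) * sqrt (real P) powr (1 - u) = real P powr (1 - u)"
    using powr_mult[of "sqrt (real P)" "sqrt (real P)" "1 - u"] by simp
  finally show ?thesis .
qed

section \<open>The profile of the body\<close>

text \<open>By the mean value theorem used twice, the negated second difference is a value of
  \<open>K\<close> at an intermediate point, hence at least \<open>K t\<close>. Its derivative in
  \<open>t\<close> is a difference of two values of \<open>K\<close>, taken on either side of
  \<open>t + 1\<close>, hence nonnegative. Only an open interval is involved, since the derivative
  of the profile blows up at the pole \<open>R\<close>.\<close>

lemma second_difference_bounds:
  fixes f f' K :: "real \<Rightarrow> real"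
  assumes f: "\<And>s. a < s \<Longrightarrow> s < b \<Longrightarrow> (f has_real_derivative f' s) (at s)"
    and f': "\<And>s. a < s \<Longrightarrow> s < b \<Longrightarrow> (f' has_real_derivative - K s) (at s)"
    and K: "\<And>s t. a < s \<Longrightarrow> s \<le> t \<Longrightarrow> t < b \<Longrightarrow> K s \<le> K t"
  shows "a < t \<Longrightarrow> t + 2 < b \<Longrightarrow> K t \<le> 2 * f (t + 1) - f t - f (t + 2)"
    and "a < t \<Longrightarrow> t + 3 < b \<Longrightarrow>
          2 * f (t + 1) - f t - f (t + 2) \<le> 2 * f (t + 2) - f (t + 1) - f (t + 3)"
proof -
  have f1: "((\<lambda>s. f (s + c)) has_real_derivative f' (s + c)) (at s)" if "a < s + c" "s + c < b" for s c
    using DERIV_shift[of f "f' (s + c)" s c] f[OF that] by (simp add: add.commute)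
  have step: "\<exists>\<eta>. s < \<eta> \<and> \<eta> < s + 1 \<and> f' s - f' (s + 1) = K \<eta>" if "a < s" "s + 1 < b" for s
  proof -
    have "\<exists>z. s < z \<and> z < s + 1 \<and> f' (s + 1) - f' s = (s + 1 - s) * - K z"
      by (rule MVT2) (use that f' in auto)
    then obtain z where "s < z" "z < s + 1" "f' (s + 1) - f' s = - K z" by auto
    then show ?thesis by (intro exI[of _ z]) auto
  qed
  show "K t \<le> 2 * f (t + 1) - f t - f (t + 2)" if t: "a < t" "t + 2 < b"
  proof -
    have "\<exists>z. t < z \<and> z < t + 1 \<and> (f (t + 1 + 0) - f (t + 1 + 1)) - (f (t + 0) - f (t + 1)) = (t + 1 - t) * (f' (z + 0) - f' (z + 1))"
      by (rule MVT2[where f = "\<lambda>s. f (s + 0) - f (s + 1)"]) (use t in \<open>auto intro!: DERIV_diff f1 f1[of _ 0, simplified]\<close>)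
    then obtain z where z: "t < z" "z < t + 1" and e: "f (t + 1) - f (t + 2) - (f t - f (t + 1)) = f' z - f' (z + 1)"
      by (auto simp: add.assoc)
    obtain \<eta> where \<eta>: "z < \<eta>" "\<eta> < z + 1" "f' z - f' (z + 1) = K \<eta>"
      using step[of z] z t by auto
    have "K t \<le> K \<eta>" using \<eta> z t by (intro K) auto
    then show ?thesis using e \<eta> by linarith
  qed
  show "2 * f (t + 1) - f t - f (t + 2) \<le> 2 * f (t + 2) - f (t + 1) - f (t + 3)" if t: "a < t" "t + 3 < b"
  proof -
    have "2 * f (t + 1) - f (t + 0) - f (t + 2) \<le> 2 * f (t + 1 + 1) - f (t + 1 + 0) - f (t + 1 + 2)"
    proof (rule DERIV_nonneg_imp_nondecreasing[where f = "\<lambda>s. 2 * f (s + 1) - f (s + 0) - f (s + 2)"])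
      fix s assume s: "t \<le> s" "s \<le> t + 1"
      have "((\<lambda>s. 2 * f (s + 1) - f (s + 0) - f (s + 2)) has_real_derivative 2 * f' (s + 1) - f' (s + 0) - f' (s + 2)) (at s)"
        using s t by (intro DERIV_diff DERIV_cmult f1) auto
      moreover obtain \<eta> where \<eta>: "s < \<eta>" "\<eta> < s + 1" "f' s - f' (s + 1) = K \<eta>"
        using step[of s] s t by auto
      moreover obtain \<zeta> where \<zeta>: "s + 1 < \<zeta>" "\<zeta> < s + 2" "f' (s + 1) - f' (s + 2) = K \<zeta>"
        using step[of "s + 1"] s t by (auto simp: add.assoc)
      moreover have "K \<eta> \<le> K \<zeta>" using \<eta> \<zeta> s t by (intro K) auto
      ultimately show "\<exists>D. ((\<lambda>s. 2 * f (s + 1) - f (s + 0) - f (s + 2)) has_real_derivative D) (at s) \<and> 0 \<le> D"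
        by (intro exI[of _ "2 * f' (s + 1) - f' (s + 0) - f' (s + 2)"]) auto
    qed simp
    then show ?thesis by (simp add: add.assoc)
  qed
qed

definition profile :: "real \<Rightarrow> real \<Rightarrow> real \<Rightarrow> real" where
  "profile \<alpha> R s = (R powr \<alpha> - s powr \<alpha>) powr (1/\<alpha>)"

lemma profile_nonneg: "0 \<le> profile \<alpha> R s"
  by (simp add: profile_def)

lemma profile_antimono:
  assumes "0 < \<alpha>" "0 \<le> s" "s \<le> t" "t \<le> R"
  shows "profile \<alpha> R t \<le> profile \<alpha> R s"
  unfolding profile_def using assms powr_mono2[of \<alpha> t R] powr_mono2[of \<alpha> s t]
  by (intro powr_mono2) auto

lemma profile_0: "0 < \<alpha> \<Longrightarrow> 0 \<le> R \<Longrightarrow> profile \<alpha> R 0 = R"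
  by (simp add: profile_def powr_powr)

lemma profile_le:
  assumes "0 < \<alpha>" "0 \<le> s" "s \<le> R"
  shows "profile \<alpha> R s \<le> R"
  using profile_antimono[of \<alpha> 0 s R] assms by (simp add: profile_0)

lemma profile_powr:
  assumes "0 < \<alpha>" "0 \<le> s" "s \<le> R"
  shows "profile \<alpha> R s powr \<alpha> = R powr \<alpha> - s powr \<alpha>"
  using assms powr_mono2[of \<alpha> s R] by (simp add: profile_def powr_powr)

lemma powr_diff_ge:
  fixes \<alpha> s R :: real
  assumes "1 \<le> \<alpha>" "0 \<le> s" "s \<le> R - 1"
  shows "R powr (\<alpha> - 1) \<le> R powr \<alpha> - s powr \<alpha>"
proof -
  have "s powr \<alpha> \<le> (R - 1) powr \<alpha>" using assms by (intro powr_mono2) auto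
  also have "\<dots> = (R - 1) * (R - 1) powr (\<alpha> - 1)"
    using assms powr_mult_base[of "R - 1" "\<alpha> - 1"] by simp
  also have "\<dots> \<le> (R - 1) * R powr (\<alpha> - 1)"
    using assms by (intro mult_left_mono powr_mono2) auto
  also have "\<dots> = R powr \<alpha> - R powr (\<alpha> - 1)"
    using assms powr_mult_base[of R "\<alpha> - 1"] by (simp add: algebra_simps)
  finally show ?thesis by simp
qed

text \<open>At distance 1 from the pole the radius is still of order
  \<open>R powr (1 - 1/\<alpha>)\<close>. For \<alpha> > 2 and \<open>R \<ge> 4\<close> this is at
  least 2, so a shift by at most 1 keeps the radius in the range of the disc asymptotics.\<close>

lemma profile_ge:
  assumes "1 \<le> \<alpha>" "0 \<le> s" "s \<le> R - 1"
  shows "R powr (1 - 1/\<alpha>) \<le> profile \<alpha> R s"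
proof -
  have "R powr (1 - 1/\<alpha>) = (R powr (\<alpha> - 1)) powr (1/\<alpha>)"
    using assms by (simp add: powr_powr diff_divide_distrib)
  also have "\<dots> \<le> profile \<alpha> R s"
    unfolding profile_def using powr_diff_ge[OF assms] assms by (intro powr_mono2) auto
  finally show ?thesis .
qed

text \<open>Near the pole the mean value theorem bounds
  \<open>R powr \<alpha> - s powr \<alpha>\<close> by
  \<open>c * \<alpha> * R powr (\<alpha> - 1)\<close>. The slices there have area
  \<open>O(R powr (2 - 2/\<alpha>))\<close>, which is the origin of the second term of the
  theorem.\<close>

lemma profile_squared_le:
  assumes "1 \<le> \<alpha>" "0 < c" "R - c \<le> s" "0 < s" "s \<le> R"
  shows "(profile \<alpha> R s)\<^sup>2 \<le> (c * \<alpha>) powr (2/\<alpha>) * R powr (2 - 2/\<alpha>)"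
proof -
  have "R powr \<alpha> - s powr \<alpha> \<le> c * \<alpha> * R powr (\<alpha> - 1)"
  proof (cases "s < R")
    case True
    have "\<exists>z. s < z \<and> z < R \<and> R powr \<alpha> - s powr \<alpha> = (R - s) * (\<alpha> * z powr (\<alpha> - 1))"
      by (rule MVT2[OF True]) (use assms in \<open>auto intro!: derivative_eq_intros simp: powr_diff\<close>)
    then obtain z where z: "s < z" "z < R" "R powr \<alpha> - s powr \<alpha> = (R - s) * (\<alpha> * z powr (\<alpha> - 1))" by blast
    have "(R - s) * (\<alpha> * z powr (\<alpha> - 1)) \<le> c * (\<alpha> * R powr (\<alpha> - 1))"
      using z assms by (intro mult_mono powr_mono2) auto
    then show ?thesis using z by simp
  next
    case False
    then show ?thesis using assms by simp
  qed
  moreover have "0 \<le> R powr \<alpha> - s powr \<alpha>" using assms powr_mono2[of \<alpha> s R] by simp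
  ultimately have "(R powr \<alpha> - s powr \<alpha>) powr (2/\<alpha>) \<le> (c * \<alpha> * R powr (\<alpha> - 1)) powr (2/\<alpha>)"
    using assms by (intro powr_mono2) auto
  also have "\<dots> = (c * \<alpha>) powr (2/\<alpha>) * R powr ((\<alpha> - 1) * (2/\<alpha>))"
    using assms by (simp add: powr_mult powr_powr)
  also have "(\<alpha> - 1) * (2/\<alpha>) = 2 - 2/\<alpha>" using assms by (simp add: field_simps)
  also have "(R powr \<alpha> - s powr \<alpha>) powr (2/\<alpha>) = (profile \<alpha> R s)\<^sup>2"
    by (simp add: profile_def power2_eq_square flip: powr_add)
  finally show ?thesis .
qed

text \<open>Minus the second derivative of \<open>profile\<close>. For \<alpha> > 2 both factors
  depending on \<open>s\<close> increase: the first exponent is positive, and the last factor raises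
  a decreasing base to a negative power.\<close>

definition profile_curv :: "real \<Rightarrow> real \<Rightarrow> real \<Rightarrow> real" where
  "profile_curv \<alpha> R s = (\<alpha> - 1) * R powr \<alpha> * s powr (\<alpha> - 2) * (R powr \<alpha> - s powr \<alpha>) powr (1/\<alpha> - 2)"

lemma profile_derivatives:
  assumes \<alpha>: "2 < \<alpha>" and s: "0 < s" "s < R"
  shows "(profile \<alpha> R has_real_derivative - (s powr (\<alpha> - 1) * (R powr \<alpha> - s powr \<alpha>) powr (1/\<alpha> - 1))) (at s)"
    and "((\<lambda>s. - (s powr (\<alpha> - 1) * (R powr \<alpha> - s powr \<alpha>) powr (1/\<alpha> - 1))) has_real_derivative - profile_curv \<alpha> R s) (at s)"
proof -
  let ?X = "R powr \<alpha> - s powr \<alpha>"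
  have X: "0 < ?X" using powr_less_mono2[of \<alpha> s R] s \<alpha> by simp
  have dX: "((\<lambda>s. R powr \<alpha> - s powr \<alpha>) has_real_derivative - (\<alpha> * s powr (\<alpha> - 1))) (at s)"
    using s by (auto intro!: derivative_eq_intros)
  have dp: "((\<lambda>s. (R powr \<alpha> - s powr \<alpha>) powr r) has_real_derivative r * ?X powr (r - 1) * - (\<alpha> * s powr (\<alpha> - 1))) (at s)" for r
    by (rule DERIV_chain2[OF has_real_derivative_powr[OF X] dX])
  show "(profile \<alpha> R has_real_derivative - (s powr (\<alpha> - 1) * ?X powr (1/\<alpha> - 1))) (at s)"
    unfolding profile_def by (rule DERIV_cong[OF dp]) (use \<alpha> in simp)
  have ds: "((\<lambda>s. s powr (\<alpha> - 1)) has_real_derivative (\<alpha> - 1) * s powr (\<alpha> - 2)) (at s)"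
    using s has_real_derivative_powr[of s "\<alpha> - 1"] by simp
  define Y where "Y = ?X powr (1/\<alpha> - 2)"
  have Y1: "?X powr (1/\<alpha> - 1) = ?X * Y" unfolding Y_def using X powr_mult_base[of ?X "1/\<alpha> - 2"] by simp
  \<comment> \<open>After this rewriting the two terms share the factor
    \<open>s powr (\<alpha> - 2) * Y\<close>, and \<open>?X + s powr \<alpha>\<close> is
    \<open>R powr \<alpha>\<close>.\<close>
  have s1: "s powr (\<alpha> - 1) * s powr (\<alpha> - 1) = s powr (\<alpha> - 2) * s powr \<alpha>"
    using s by (simp flip: powr_add)
  have "((\<lambda>s. - (s powr (\<alpha> - 1) * (R powr \<alpha> - s powr \<alpha>) powr (1/\<alpha> - 1))) has_real_derivative
     - ((\<alpha> - 1) * s powr (\<alpha> - 2) * ?X powr (1/\<alpha> - 1) + ((1/\<alpha> - 1) * ?X powr (1/\<alpha> - 1 - 1) * - (\<alpha> * s powr (\<alpha> - 1))) * s powr (\<alpha> - 1))) (at s)"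
    by (intro DERIV_minus DERIV_mult ds dp)
  then show "((\<lambda>s. - (s powr (\<alpha> - 1) * (R powr \<alpha> - s powr \<alpha>) powr (1/\<alpha> - 1))) has_real_derivative - profile_curv \<alpha> R s) (at s)"
  proof (rule DERIV_cong)
    have "(1/\<alpha> - 1) * ?X powr (1/\<alpha> - 1 - 1) * - (\<alpha> * s powr (\<alpha> - 1)) * s powr (\<alpha> - 1)
       = (\<alpha> - 1) * Y * (s powr (\<alpha> - 1) * s powr (\<alpha> - 1))"
      using \<alpha> by (simp add: Y_def field_simps)
    then show "- ((\<alpha> - 1) * s powr (\<alpha> - 2) * ?X powr (1/\<alpha> - 1) + ((1/\<alpha> - 1) * ?X powr (1/\<alpha> - 1 - 1) * - (\<alpha> * s powr (\<alpha> - 1))) * s powr (\<alpha> - 1))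
      = - profile_curv \<alpha> R s"
      unfolding profile_curv_def Y_def[symmetric] Y1 s1 by (simp add: algebra_simps)
  qed
qed

lemma profile_curv_mono:
  assumes "2 < \<alpha>" "0 < s" "s \<le> t" "t < R"
  shows "profile_curv \<alpha> R s \<le> profile_curv \<alpha> R t"
proof -
  have "0 < R powr \<alpha> - t powr \<alpha>" "s powr \<alpha> \<le> t powr \<alpha>"
    using assms powr_less_mono2[of \<alpha> t R] powr_mono2[of \<alpha> s t] by auto
  moreover have "1/\<alpha> - 2 \<le> 0" using assms by (simp add: field_simps)
  ultimately have X: "(R powr \<alpha> - s powr \<alpha>) powr (1/\<alpha> - 2) \<le> (R powr \<alpha> - t powr \<alpha>) powr (1/\<alpha> - 2)"
    by (intro powr_mono2') auto
  have "s powr (\<alpha> - 2) \<le> t powr (\<alpha> - 2)" using assms by (intro powr_mono2) auto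
  then show ?thesis
    unfolding profile_curv_def using assms
    by (intro mult_mono X) (auto intro!: mult_nonneg_nonneg)
qed

text \<open>Put the threshold value into the increasing power of \<open>s\<close>, and enlarge
  \<open>R powr \<alpha> - s powr \<alpha>\<close> to \<open>R powr \<alpha>\<close> under its
  negative exponent; what remains is arithmetic of exponents.\<close>

lemma profile_curv_ge:
  assumes \<alpha>: "2 < \<alpha>" and s: "R powr (1 - 1/\<alpha>) \<le> s" "s < R" and R: "0 < R"
  shows "R powr (- 2 + 2/\<alpha>) \<le> profile_curv \<alpha> R s"
proof -
  have s0: "0 < s" using s(1) powr_gt_zero[of R "1 - 1/\<alpha>"] R by linarith
  have X: "0 < R powr \<alpha> - s powr \<alpha>" using powr_less_mono2[of \<alpha> s R] s s0 \<alpha> by simp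
  have "- 2 + 2/\<alpha> = \<alpha> + ((1 - 1/\<alpha>) * (\<alpha> - 2)) + \<alpha> * (1/\<alpha> - 2)"
    using \<alpha> by (simp add: field_simps)
  then have "R powr (- 2 + 2/\<alpha>) = 1 * R powr \<alpha> * (R powr (1 - 1/\<alpha>)) powr (\<alpha> - 2) * (R powr \<alpha>) powr (1/\<alpha> - 2)"
    by (simp only: powr_add powr_powr mult_1)
  also have "\<dots> \<le> profile_curv \<alpha> R s"
  proof -
    have "1/\<alpha> - 2 \<le> 0" using \<alpha> by (simp add: field_simps)
    then have "(R powr \<alpha>) powr (1/\<alpha> - 2) \<le> (R powr \<alpha> - s powr \<alpha>) powr (1/\<alpha> - 2)"
      using X by (intro powr_mono2') auto
    moreover have "(R powr (1 - 1/\<alpha>)) powr (\<alpha> - 2) \<le> s powr (\<alpha> - 2)"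
      using \<alpha> s by (intro powr_mono2) auto
    ultimately show ?thesis
      unfolding profile_curv_def using \<alpha> by (intro mult_mono) auto
  qed
  finally show ?thesis .
qed

section \<open>One frequency summed over the slices\<close>

text \<open>By \<open>disc_fourier\<close> this is the Fourier transform of \<open>disc r\<close> at
  every frequency of length \<open>q\<close>.\<close>

definition disc_hat :: "real \<Rightarrow> real \<Rightarrow> real" where
  "disc_hat q r = 2 * r\<^sup>2 * disc_transform (2 * pi * q * r)"

text \<open>With \<open>x = 2 pi q r\<close>, the main term \<open>r^2 x^(-3/2)\<close> is a
  constant times \<open>sqrt r * q powr (-3/2)\<close>. The error \<open>r^2 x^(-5/2)\<close> is
  weakened to \<open>1/q\<close>: summed over at most \<open>R\<close> slices it yields
  \<open>R/q\<close>, which is also what the exponential sums cost.\<close>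

lemma disc_hat_asymptotics:
  obtains c C where "0 \<le> C"
    "\<And>q r. 1 \<le> q \<Longrightarrow> 1 \<le> r \<Longrightarrow>
       \<bar>disc_hat q r - q powr (-3/2) * Re (c * (sqrt r *\<^sub>R cis (2 * pi * (q * r))))\<bar> \<le> C / q"
proof -
  obtain A B C where C: "0 \<le> C" and as: "\<And>x. 1 \<le> x \<Longrightarrow>
       \<bar>disc_transform x - x powr (-3/2) * (A * cos x + B * sin x)\<bar> \<le> C * x powr (-5/2)"
    by (rule disc_transform_asymptotics) blast
  define k where "k = 2 * (2 * pi) powr (-3/2)"
  show thesis
  \<comment> \<open>The real part of this constant times \<open>cis x\<close> is
    \<open>k * (A * cos x + B * sin x)\<close>.\<close>
  proof (rule that[of "2 * C" "Complex (k * A) (- (k * B))"])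
    fix q r :: real assume q: "1 \<le> q" and r: "1 \<le> r"
    define x where "x = 2 * pi * q * r"
    have pi1: "1 \<le> 2 * pi" using pi_gt3 by simp
    have qr: "1 \<le> q * r" using mult_mono[of 1 q 1 r] q r by simp
    have x: "1 \<le> x" unfolding x_def using mult_mono[OF pi1 qr] by (simp add: mult.assoc)
    have "q * r \<le> x" unfolding x_def using mult_right_mono[OF pi1, of "q * r"] qr by (simp add: mult.assoc)
    then have "x powr (-5/2) \<le> (q * r) powr (-5/2)" using qr by (intro powr_mono2') auto
    also have "\<dots> = q powr (-5/2) * r powr (-5/2)" using q r by (simp add: powr_mult)
    finally have e1: "x powr (-5/2) \<le> q powr (-5/2) * r powr (-5/2)" .
    have "r\<^sup>2 * r powr (-5/2) = r powr (-1/2)"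
      using r by (simp add: powr_add[symmetric] flip: powr_numeral)
    also have "\<dots> \<le> 1" using r powr_mono[of "-1/2" 0 r] by simp
    finally have e2: "r\<^sup>2 * r powr (-5/2) \<le> 1" .
    have e3: "q powr (-5/2) \<le> 1 / q" using q powr_mono[of "-5/2" "-1" q] by (simp add: powr_minus_divide)
    have main: "2 * r\<^sup>2 * (x powr (-3/2) * (A * cos x + B * sin x))
       = q powr (-3/2) * Re (Complex (k * A) (- (k * B)) * (sqrt r *\<^sub>R cis (2 * pi * (q * r))))"
    proof -
      have "x powr (-3/2) = (2 * pi) powr (-3/2) * q powr (-3/2) * r powr (-3/2)"
        unfolding x_def using q r by (simp add: powr_mult)
      moreover have "r\<^sup>2 * r powr (-3/2) = sqrt r"
        using r by (simp add: powr_half_sqrt[symmetric] powr_add[symmetric] flip: powr_numeral)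
      moreover have "2 * r\<^sup>2 * ((2 * pi) powr (-3/2) * q powr (-3/2) * r powr (-3/2)) = k * q powr (-3/2) * (r\<^sup>2 * r powr (-3/2))"
        by (simp add: k_def)
      ultimately have "2 * r\<^sup>2 * x powr (-3/2) = k * q powr (-3/2) * sqrt r"
        by (simp only:)
      moreover have "2 * r\<^sup>2 * (x powr (-3/2) * (A * cos x + B * sin x)) = (2 * r\<^sup>2 * x powr (-3/2)) * (A * cos x + B * sin x)"
        by simp
      ultimately show ?thesis by (simp add: x_def algebra_simps)
    qed
    have "disc_hat q r - q powr (-3/2) * Re (Complex (k * A) (- (k * B)) * (sqrt r *\<^sub>R cis (2 * pi * (q * r))))
      = 2 * r\<^sup>2 * (disc_transform x - x powr (-3/2) * (A * cos x + B * sin x))"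
      unfolding main[symmetric] disc_hat_def x_def[symmetric] by (simp add: right_diff_distrib)
    then have "\<bar>disc_hat q r - q powr (-3/2) * Re (Complex (k * A) (- (k * B)) * (sqrt r *\<^sub>R cis (2 * pi * (q * r))))\<bar>
      = 2 * r\<^sup>2 * \<bar>disc_transform x - x powr (-3/2) * (A * cos x + B * sin x)\<bar>"
      by (simp add: abs_mult)
    also have "\<dots> \<le> 2 * r\<^sup>2 * (C * (q powr (-5/2) * r powr (-5/2)))"
      using order.trans[OF as[OF x] mult_left_mono[OF e1 C]] by (intro mult_left_mono) auto
    also have "\<dots> = 2 * C * (q powr (-5/2) * (r\<^sup>2 * r powr (-5/2)))" by simp
    also have "\<dots> \<le> 2 * C * (1 / q * 1)"
      using C q by (intro mult_left_mono mult_mono e2 e3) auto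
    finally show "\<bar>disc_hat q r - q powr (-3/2) * Re (Complex (k * A) (- (k * B)) * (sqrt r *\<^sub>R cis (2 * pi * (q * r))))\<bar> \<le> 2 * C / q"
      by simp
  qed (use C in simp)
qed

lemma ln_ge_1: "4 \<le> R \<Longrightarrow> 1 \<le> ln (R :: real)"
  using exp_le by (intro ln_ge_iff[THEN iffD2]) auto

text \<open>Since \<open>R + 1 \<le> R^2\<close>, it is enough that \<open>2^J\<close> exceeds
  \<open>R^4\<close>. This number of blocks brings a logarithm into the exponential sum bound; the 7
  is \<open>4 / (2/3) + 1\<close>, from \<open>ln 2 \<ge> 2/3\<close> and
  \<open>ln R \<ge> 1\<close>.\<close>

lemma dyadic_block_number:
  fixes R g :: real
  assumes R: "4 \<le> R" and g: "R powr (-2) \<le> g"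
  obtains J :: nat where "R + 1 < 2 ^ J * g" "real J \<le> 7 * ln R"
proof
  define J where "J = nat \<lfloor>4 * log 2 R\<rfloor> + 1"
  have l: "0 \<le> log 2 R" using R by simp
  have J: "4 * log 2 R < real J" "real J \<le> 4 * log 2 R + 1"
    using l unfolding J_def by linarith+
  have "R ^ 4 = 2 powr (4 * log 2 R)" using R by (simp add: powr_powr[symmetric] mult.commute[of 4] powr_numeral)
  also have "\<dots> < 2 powr real J" using J by (intro powr_less_mono) auto
  finally have RJ: "R ^ 4 < 2 ^ J" by (simp add: powr_realpow)
  have "4 * R \<le> R * R" using R by (intro mult_right_mono) auto
  then have "R + 1 \<le> R\<^sup>2" unfolding power2_eq_square using R by linarith
  also have "R\<^sup>2 = R ^ 4 * R powr (-2)"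
  proof -
    have r4: "R ^ 4 = R\<^sup>2 * R\<^sup>2" by (simp flip: power_add)
    have rm: "R powr (-2) = 1 / R\<^sup>2" using R by (simp add: powr_minus_divide powr_numeral)
    show ?thesis unfolding r4 rm times_divide_eq_right mult_1_right
      using R by (intro nonzero_mult_div_cancel_right[symmetric]) simp
  qed
  also have "\<dots> < 2 ^ J * R powr (-2)" using RJ R by (intro mult_strict_right_mono) auto
  also have "\<dots> \<le> 2 ^ J * g" using g by (intro mult_left_mono) auto
  finally show "R + 1 < 2 ^ J * g" .
  have "log 2 R \<le> ln R / (2/3)" unfolding log_def using R ln2_ge_two_thirds
    by (intro divide_left_mono) auto
  then show "real J \<le> 7 * ln R" using J ln_ge_1[OF R] by simp
qed

text \<open>The unweighted partial sums are covered by \<open>concave_exponential_sum\<close>, with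
  the curvature bound as \<open>g0\<close>; partial summation then restores the weight, at most
  \<open>sqrt (R + 1)\<close>. The two terms are \<open>sqrt R * sqrt (q R)\<close> and
  \<open>sqrt R / sqrt g0\<close>.\<close>

lemma profile_exponential_sum:
  assumes \<alpha>: "2 < \<alpha>" and R: "4 \<le> R" and \<sigma>: "\<bar>\<sigma>\<bar> \<le> 1" and q: "1 \<le> q"
    and a: "R powr (1 - 1/\<alpha>) \<le> real a" and b: "real b \<le> R - 1"
  shows "norm (\<Sum>n\<in>{a..<b}. sqrt (profile \<alpha> R (real n) + \<sigma>) *\<^sub>R cis (2 * pi * (q * (profile \<alpha> R (real n) + \<sigma>))))
     \<le> ln R * (688 * (R * sqrt q) + 112 * R powr (3/2 - 1/\<alpha>))"
proof -
  define g0 where "g0 = R powr (-2 + 2/\<alpha>)"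
  define p where "p n = profile \<alpha> R n + \<sigma>" for n :: nat
  have g0: "0 < g0" "R powr (-2) \<le> g0" using R \<alpha> by (auto simp: g0_def intro!: powr_mono)
  obtain J where J: "R + 1 < 2 ^ J * g0" "real J \<le> 7 * ln R"
    by (rule dyadic_block_number[OF R g0(2)])
  have lnR: "1 \<le> ln R" by (rule ln_ge_1[OF R])
  have pow: "1 \<le> R powr (1 - 1/\<alpha>)" using R \<alpha> by (intro ge_one_powr_ge_zero) auto
  have p1: "1 \<le> p n" "p n \<le> R + 1" if "real n \<le> R - 1" for n
  proof -
    have "2 = (4::real) powr (1/2)" by (simp add: powr_half_sqrt)
    also have "\<dots> \<le> R powr (1/2)" using R by (intro powr_mono2) auto
    also have "\<dots> \<le> R powr (1 - 1/\<alpha>)" using R \<alpha> by (intro powr_mono) (auto simp: field_simps)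
    also have "\<dots> \<le> profile \<alpha> R n" using that \<alpha> by (intro profile_ge) auto
    finally show "1 \<le> p n" using \<sigma> by (simp add: p_def)
    show "p n \<le> R + 1" using profile_le[of \<alpha> n R] \<alpha> that \<sigma> by (simp add: p_def)
  qed
  have pdec: "p (n + 1) \<le> p n" if "real (n + 1) \<le> R" for n
    using profile_antimono[of \<alpha> n "n + 1" R] that \<alpha> by (simp add: p_def)
  note sd = second_difference_bounds[of 0 R "profile \<alpha> R" _ "profile_curv \<alpha> R",
      OF profile_derivatives(1)[OF \<alpha>] profile_derivatives(2)[OF \<alpha>] profile_curv_mono[OF \<alpha>]]
  define B where "B = real J * (24 * sqrt (q * (R + 1)) + 8 / sqrt (q * g0) + 1) + 1"
  have B0: "0 \<le> B" using R q g0 by (auto simp: B_def intro!: add_nonneg_nonneg mult_nonneg_nonneg)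
  have part: "norm (\<Sum>n\<in>{a..<m}. cis (2 * pi * (q * p n))) \<le> B" if "m \<le> b" for m
    unfolding B_def
  proof (rule concave_exponential_sum)
    have mb: "real m \<le> R - 1" using that b by simp
    show "R + 1 < 2 ^ J * g0" by (rule J)
    show "g0 \<le> 2 * p (n + 1) - p n - p (n + 2)" if n: "a \<le> n" "n + 1 < m" for n
    proof -
      have "real (n + 2) \<le> real m" using n by simp
      then have r: "0 < real n" "real n + 2 < R" "R powr (1 - 1/\<alpha>) \<le> real n" using mb a pow n by auto
      then have "g0 \<le> profile_curv \<alpha> R (real n)" unfolding g0_def
        using \<alpha> R by (intro profile_curv_ge) auto
      also have "\<dots> \<le> 2 * profile \<alpha> R (real n + 1) - profile \<alpha> R (real n) - profile \<alpha> R (real n + 2)"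
        by (rule sd(1)) (use r in auto)
      finally show ?thesis by (simp add: p_def add.commute)
    qed
    show "2 * p (n + 1) - p n - p (n + 2) \<le> 2 * p (n + 2) - p (n + 1) - p (n + 3)" if n: "a \<le> n" "n + 2 < m" for n
    proof -
      have "real (n + 3) \<le> real m" using n by simp
      then have r: "0 < real n" "real n + 3 < R" using mb a pow n by auto
      have "2 * profile \<alpha> R (real n + 1) - profile \<alpha> R (real n) - profile \<alpha> R (real n + 2)
         \<le> 2 * profile \<alpha> R (real n + 2) - profile \<alpha> R (real n + 1) - profile \<alpha> R (real n + 3)"
        by (rule sd(2)) (use r in auto)
      then show ?thesis by (simp add: p_def add.commute)
    qed
    show "p (n + 1) \<le> p n" if "a \<le> n" "n < m" for n
      by (rule pdec) (use that mb in linarith)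
    show "0 \<le> p n \<and> p n \<le> R + 1" if "a \<le> n" "n \<le> m" for n
      using p1[of n] that mb by force
  qed (use q g0 R in auto)
  have "norm (\<Sum>n\<in>{a..<b}. sqrt (p n) *\<^sub>R cis (2 * pi * (q * p n))) \<le> sqrt (R + 1) * B"
  proof (rule norm_abel_sum_le)
    show "sqrt (p (n + 1)) \<le> sqrt (p n)" if "a \<le> n" "n + 1 < b" for n
      using pdec[of n] that b by simp
    show "0 \<le> sqrt (p n)" if "a \<le> n" "n < b" for n using p1[of n] that b by simp
    show "sqrt (p a) \<le> sqrt (R + 1)" if "a < b" using p1[of a] that b by simp
  qed (use part B0 R in auto)
  also have "\<dots> \<le> (2 * sqrt R) * (ln R * (344 * (sqrt q * sqrt R) + 56 * R powr (1 - 1/\<alpha>)))"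
  proof (rule mult_mono)
    have "sqrt (R + 1) \<le> sqrt (2\<^sup>2 * R)" using R by (intro real_sqrt_le_mono) simp
    then show s2: "sqrt (R + 1) \<le> 2 * sqrt R" by (simp add: real_sqrt_mult)
    define u where "u = sqrt q * sqrt R"
    have u1: "1 \<le> u" unfolding u_def using mult_mono[of 1 "sqrt q" 1 "sqrt R"] q R by simp
    have 1: "sqrt (q * (R + 1)) \<le> 2 * u"
      using mult_left_mono[OF s2, of "sqrt q"] q by (simp add: u_def real_sqrt_mult)
    have "(-2 + 2/\<alpha>) * (1/2) = -(1 - 1/\<alpha>)" by (simp add: field_simps)
    moreover have "sqrt g0 = R powr ((-2 + 2/\<alpha>) * (1/2))"
      unfolding powr_powr[symmetric] using g0 by (simp add: g0_def powr_half_sqrt)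
    ultimately have "sqrt g0 = R powr (-(1 - 1/\<alpha>))" by (simp only:)
    then have g: "1 / sqrt g0 = R powr (1 - 1/\<alpha>)" by (simp only: powr_minus_divide) simp
    have "8 / sqrt (q * g0) \<le> 8 / sqrt (1 * g0)"
      using q g0 by (intro divide_left_mono real_sqrt_le_mono mult_right_mono) auto
    also have "\<dots> = 8 * (1 / sqrt g0)" by simp
    finally have 2: "8 / sqrt (q * g0) \<le> 8 * R powr (1 - 1/\<alpha>)" by (simp only: g)
    \<comment> \<open>The two summands 1 in \<open>B\<close> are absorbed by
      \<open>u \<ge> 1\<close> and \<open>ln R \<ge> 1\<close>, so the coefficient of
      \<open>u\<close> becomes \<open>7 * (48 + 1) + 1 = 344\<close>.\<close>
    have "B \<le> (7 * ln R) * (24 * (2 * u) + 8 * R powr (1 - 1/\<alpha>) + u) + ln R * u"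
      unfolding B_def
    proof (intro add_mono mult_mono)
      show "1 \<le> ln R * u" using mult_mono[of 1 "ln R" 1 u] lnR u1 by simp
    qed (use 1 2 J lnR q R g0 u1 in auto)
    also have "\<dots> = ln R * (344 * u + 56 * R powr (1 - 1/\<alpha>))" by (simp add: algebra_simps)
    finally show "B \<le> ln R * (344 * (sqrt q * sqrt R) + 56 * R powr (1 - 1/\<alpha>))" by (simp add: u_def)
  qed (use B0 R in auto)
  also have "\<dots> = ln R * (688 * (sqrt R * sqrt R * sqrt q) + 112 * (sqrt R * R powr (1 - 1/\<alpha>)))"
    by (simp add: algebra_simps)
  also have "sqrt R * sqrt R = R" using R by simp
  also have "sqrt R * R powr (1 - 1/\<alpha>) = R powr (3/2 - 1/\<alpha>)"
    using R by (simp add: powr_half_sqrt[symmetric] powr_add[symmetric])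
  finally show ?thesis by (simp add: p_def)
qed

text \<open>Below the cut \<open>a\<close> the terms are bounded by \<open>2 sqrt R\<close> each,
  above it by \<open>profile_exponential_sum\<close>. The factor \<open>q powr (-3/2)\<close> of the
  wave turns \<open>R * sqrt q\<close> into \<open>R / q\<close>, the size of the accumulated
  asymptotic error.\<close>

lemma slice_fourier_sum:
  assumes \<alpha>: "2 < \<alpha>"
  obtains C where "0 \<le> C"
    "\<And>R \<sigma> q b. 4 \<le> R \<Longrightarrow> \<bar>\<sigma>\<bar> \<le> 1 \<Longrightarrow> 1 \<le> q \<Longrightarrow> real b \<le> R - 1 \<Longrightarrow>
       \<bar>\<Sum>t<b. disc_hat q (profile \<alpha> R (real t) + \<sigma>)\<bar>
         \<le> C * ln R * (R * q powr (-1) + R powr (3/2 - 1/\<alpha>) * q powr (-3/2))"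
proof -
  obtain c C where C: "0 \<le> C" and as: "\<And>q r. 1 \<le> q \<Longrightarrow> 1 \<le> r \<Longrightarrow>
       \<bar>disc_hat q r - q powr (-3/2) * Re (c * (sqrt r *\<^sub>R cis (2 * pi * (q * r))))\<bar> \<le> C / q"
    by (rule disc_hat_asymptotics) blast
  show thesis
  proof (rule that[of "688 * norm c + C"])
    fix R \<sigma> q :: real and b :: nat
    assume R: "4 \<le> R" and \<sigma>: "\<bar>\<sigma>\<bar> \<le> 1" and q: "1 \<le> q" and b: "real b \<le> R - 1"
    define p where "p n = profile \<alpha> R (real n) + \<sigma>" for n :: nat
    define u where "u n = sqrt (p n) *\<^sub>R cis (2 * pi * (q * p n))" for n
    define Y where "Y = R powr (3/2 - 1/\<alpha>)"
    define a where "a = nat \<lceil>R powr (1 - 1/\<alpha>)\<rceil>"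
    have lnR: "1 \<le> ln R" by (rule ln_ge_1[OF R])
    have pow: "1 \<le> R powr (1 - 1/\<alpha>)" using R \<alpha> by (intro ge_one_powr_ge_zero) auto
    have a: "R powr (1 - 1/\<alpha>) \<le> real a" "real a \<le> 2 * R powr (1 - 1/\<alpha>)"
      using pow unfolding a_def by linarith+
    have p1: "1 \<le> p n" "p n \<le> R + 1" if "n < b" for n
    proof -
      have n: "real n \<le> R - 1" using that b by simp
      have "2 = (4::real) powr (1/2)" by (simp add: powr_half_sqrt)
      also have "\<dots> \<le> R powr (1/2)" using R by (intro powr_mono2) auto
      also have "\<dots> \<le> R powr (1 - 1/\<alpha>)" using R \<alpha> by (intro powr_mono) (auto simp: field_simps)
      also have "\<dots> \<le> profile \<alpha> R n" using n \<alpha> by (intro profile_ge) auto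
      finally show "1 \<le> p n" using \<sigma> by (simp add: p_def)
      show "p n \<le> R + 1" using profile_le[of \<alpha> n R] \<alpha> n \<sigma> by (simp add: p_def)
    qed
    have nu: "norm (u n) \<le> 2 * sqrt R" if "n < b" for n
    proof -
      have "sqrt (p n) \<le> sqrt (2\<^sup>2 * R)" using p1[OF that] R by (intro real_sqrt_le_mono) simp
      then show ?thesis using p1[OF that] by (simp add: u_def real_sqrt_mult)
    qed
    have head: "norm (\<Sum>n<m. u n) \<le> ln R * (4 * Y)" if "m \<le> a" "m \<le> b" for m
    proof -
      have "norm (\<Sum>n<m. u n) \<le> (\<Sum>n<m. 2 * sqrt R)"
        by (intro sum_norm_le nu) (use that in auto)
      also have "\<dots> = real m * (2 * sqrt R)" by simp
      also have "\<dots> \<le> (2 * R powr (1 - 1/\<alpha>)) * (2 * sqrt R)"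
        using that a R by (intro mult_right_mono) auto
      also have "\<dots> = 4 * (sqrt R * R powr (1 - 1/\<alpha>))" by simp
      also have "sqrt R * R powr (1 - 1/\<alpha>) = Y"
        using R by (simp add: Y_def powr_half_sqrt[symmetric] powr_add[symmetric])
      also have "4 * Y \<le> ln R * (4 * Y)" using lnR mult_right_mono[of 1 "ln R" "4 * Y"] by (simp add: Y_def)
      finally show ?thesis .
    qed
    have S: "norm (\<Sum>n<b. u n) \<le> ln R * (688 * (R * sqrt q) + 116 * Y)"
    proof (cases "a \<le> b")
      case True
      have "(\<Sum>n<b. u n) = (\<Sum>n<a. u n) + (\<Sum>n\<in>{a..<b}. u n)"
        using sum.atLeastLessThan_concat[of 0 a b u] True by (simp add: atLeast0LessThan)
      then have "norm (\<Sum>n<b. u n) \<le> norm (\<Sum>n<a. u n) + norm (\<Sum>n\<in>{a..<b}. u n)"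
        by (simp add: norm_triangle_ineq)
      also have "\<dots> \<le> ln R * (4 * Y) + ln R * (688 * (R * sqrt q) + 112 * Y)"
      proof (rule add_mono)
        show "norm (\<Sum>n<a. u n) \<le> ln R * (4 * Y)" by (rule head) (use True in auto)
        show "norm (\<Sum>n\<in>{a..<b}. u n) \<le> ln R * (688 * (R * sqrt q) + 112 * Y)"
          using profile_exponential_sum[OF \<alpha> R \<sigma> q a(1) b] by (simp add: u_def p_def Y_def)
      qed
      finally show ?thesis by (simp add: algebra_simps)
    next
      case False
      then have "norm (\<Sum>n<b. u n) \<le> ln R * (4 * Y)" by (intro head) auto
      also have "\<dots> \<le> ln R * (688 * (R * sqrt q) + 116 * Y)"
        using lnR R q by (intro mult_left_mono) (auto simp: Y_def)
      finally show ?thesis .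
    qed
    have "(\<Sum>t<b. disc_hat q (p t)) = (\<Sum>t<b. disc_hat q (p t) - q powr (-3/2) * Re (c * u t)) + q powr (-3/2) * Re (c * (\<Sum>t<b. u t))"
      by (simp only: sum_subtractf sum_distrib_left Re_sum)
    then have "\<bar>\<Sum>t<b. disc_hat q (p t)\<bar> \<le> \<bar>\<Sum>t<b. disc_hat q (p t) - q powr (-3/2) * Re (c * u t)\<bar> + \<bar>q powr (-3/2) * Re (c * (\<Sum>t<b. u t))\<bar>"
      by (simp only: abs_triangle_ineq)
    also have "\<bar>\<Sum>t<b. disc_hat q (p t) - q powr (-3/2) * Re (c * u t)\<bar> \<le> (\<Sum>t<b. C / q)"
    proof (intro order.trans[OF sum_abs] sum_mono)
      show "\<bar>disc_hat q (p t) - q powr (-3/2) * Re (c * u t)\<bar> \<le> C / q" if "t \<in> {..<b}" for t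
        unfolding u_def by (rule as[OF q p1(1)]) (use that in simp)
    qed
    also have "\<dots> = C * (real b * q powr (-1))" using q by (simp add: powr_minus_divide)
    also have "\<dots> \<le> C * (ln R * (R * q powr (-1)))"
    proof -
      have "real b * q powr (-1) \<le> R * q powr (-1)" using b by (intro mult_right_mono) auto
      also have "\<dots> \<le> ln R * (R * q powr (-1))"
        using mult_right_mono[OF lnR, of "R * q powr (-1)"] R by simp
      finally show ?thesis using C by (intro mult_left_mono)
    qed
    also have "\<bar>q powr (-3/2) * Re (c * (\<Sum>t<b. u t))\<bar> \<le> q powr (-3/2) * (norm c * (ln R * (688 * (R * sqrt q) + 116 * Y)))"
    proof -
      have "\<bar>Re (c * (\<Sum>t<b. u t))\<bar> \<le> norm c * norm (\<Sum>t<b. u t)"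
        using abs_Re_le_cmod[of "c * (\<Sum>t<b. u t)"] by (simp add: norm_mult)
      also have "\<dots> \<le> norm c * (ln R * (688 * (R * sqrt q) + 116 * Y))" by (intro mult_left_mono S) auto
      finally show ?thesis by (simp add: abs_mult mult_left_mono)
    qed
    also have "\<dots> = norm c * ln R * (688 * (R * (q powr (-3/2) * sqrt q)) + 116 * (Y * q powr (-3/2)))"
      by (simp add: algebra_simps)
    also have "q powr (-3/2) * sqrt q = q powr (-1)"
      using q by (simp add: powr_half_sqrt[symmetric] powr_add[symmetric])
    also have "norm c * ln R * (688 * (R * q powr (-1)) + 116 * (Y * q powr (-3/2)))
       \<le> norm c * ln R * (688 * (R * q powr (-1) + Y * q powr (-3/2)))"
      using lnR by (intro mult_left_mono) (auto simp: Y_def intro!: mult_nonneg_nonneg)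
    also have "C * (ln R * (R * q powr (-1))) \<le> C * (ln R * (R * q powr (-1) + Y * q powr (-3/2)))"
      using C lnR by (intro mult_left_mono) (auto simp: Y_def)
    finally show "\<bar>\<Sum>t<b. disc_hat q (profile \<alpha> R (real t) + \<sigma>)\<bar>
         \<le> (688 * norm c + C) * ln R * (R * q powr (-1) + R powr (3/2 - 1/\<alpha>) * q powr (-3/2))"
      by (simp add: p_def Y_def algebra_simps)
  qed (use C in simp)
qed

section \<open>Volume and lattice points of the body by slices\<close>

text \<open>On \<open>[t, t+1]\<close> a concave function lies above its chord and below the
  extension of the preceding chord. The excess of the integral over the trapezoid is thus between 0
  and half the difference of consecutive decrements, and these differences telescope. The first
  interval has no preceding chord and uses \<open>f s \<le> f 0\<close>.\<close>

lemma trapezoid_sum_concave: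
  fixes f :: "real \<Rightarrow> real"
  assumes conc: "concave_on {0..real b} f" and anti: "\<And>s. 0 \<le> s \<Longrightarrow> s \<le> real b \<Longrightarrow> f s \<le> f 0"
    and cont: "continuous_on {0..real b} f" and b: "1 \<le> b"
  shows "0 \<le> integral {0..real b} f - (\<Sum>t<b. (f (real t) + f (real t + 1)) / 2)"
    and "integral {0..real b} f - (\<Sum>t<b. (f (real t) + f (real t + 1)) / 2) \<le> (f (real b - 1) - f b) / 2"
proof -
  have lin: "((\<lambda>s. A + (s - t) * B) has_integral A + B / 2) {t..t+1}" for A B t :: real
  proof -
    have "((\<lambda>s. A + (s - t) * B) has_integral (A * (t + 1) + (t + 1 - t)\<^sup>2 * B / 2) - (A * t + (t - t)\<^sup>2 * B / 2)) {t..t+1}"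
      by (rule fundamental_theorem_of_calculus)
        (auto simp: has_real_derivative_iff_has_vector_derivative[symmetric] intro!: derivative_eq_intros)
    then show ?thesis by (simp add: algebra_simps)
  qed
  have int: "f integrable_on {x..y}" if "0 \<le> x" "y \<le> real b" for x y
    by (rule integrable_continuous_interval, rule continuous_on_subset[OF cont]) (use that in auto)
  have lower: "(f t + f (t + 1)) / 2 \<le> integral {real t..real t + 1} f" if "t < b" for t :: nat
  proof -
    have "integral {real t..real t + 1} (\<lambda>s. f t + (s - t) * (f (t + 1) - f t)) \<le> integral {real t..real t + 1} f"
    proof (rule integral_le)
      show "f t + (s - t) * (f (t + 1) - f t) \<le> f s" if s: "s \<in> {real t..real t + 1}" for s
      proof -
        have "(1 - (s - t)) * f t + (s - t) * f (t + 1) \<le> f ((1 - (s - t)) *\<^sub>R real t + (s - t) *\<^sub>R (real t + 1))"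
          using concave_onD[OF conc, of "s - t" t "t + 1"] s \<open>t < b\<close> by (auto simp: add.commute)
        then show ?thesis by (simp add: algebra_simps)
      qed
    qed (use int lin that in \<open>auto simp: has_integral_iff\<close>)
    then show ?thesis using lin[of "f t" t "f (t + 1) - f t"] by (simp add: has_integral_iff field_simps)
  qed
  have upper0: "integral {0..1} f \<le> f 0"
  proof -
    have "integral {0..1} f \<le> integral {0..1} (\<lambda>_::real. f 0)"
      by (rule integral_le) (use int b anti in auto)
    then show ?thesis by simp
  qed
  have upper: "integral {real t..real t + 1} f \<le> f t + (f t - f (real t - 1)) / 2" if t: "1 \<le> t" "t < b" for t :: nat
  proof -
    have "integral {real t..real t + 1} f \<le> integral {real t..real t + 1} (\<lambda>s. f t + (s - t) * (f t - f (real t - 1)))"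
    proof (rule integral_le)
      show "f s \<le> f t + (s - t) * (f t - f (real t - 1))" if s: "s \<in> {real t..real t + 1}" for s
      proof -
        \<comment> \<open>With weight \<theta> on \<open>s\<close>, the point \<open>t\<close> is a
          convex combination of \<open>t - 1\<close> and \<open>s\<close>.\<close>
        define \<theta> where "\<theta> = 1 / (1 + s - t)"
        have \<theta>: "0 \<le> \<theta>" "\<theta> \<le> 1" "\<theta> * (1 + s - t) = 1" using s by (auto simp: \<theta>_def)
        have "(1 - \<theta>) * f (real t - 1) + \<theta> * f s \<le> f ((1 - \<theta>) *\<^sub>R (real t - 1) + \<theta> *\<^sub>R s)"
          using concave_onD[OF conc, of \<theta> "real t - 1" s] \<theta> s t by auto
        also have "(1 - \<theta>) *\<^sub>R (real t - 1) + \<theta> *\<^sub>R s = (real t - 1) + \<theta> * (1 + s - t)"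
          by (simp add: algebra_simps)
        also have "\<dots> = t" unfolding \<theta>(3) by simp
        finally have "(1 + s - t) * ((1 - \<theta>) * f (real t - 1) + \<theta> * f s) \<le> (1 + s - t) * f t"
          using s by (intro mult_left_mono) auto
        moreover have "(1 + s - t) * ((1 - \<theta>) * f (real t - 1) + \<theta> * f s)
          = (1 + s - t) * f (real t - 1) + (\<theta> * (1 + s - t)) * (f s - f (real t - 1))"
          by (simp add: algebra_simps)
        ultimately show ?thesis unfolding \<theta>(3) by (simp add: algebra_simps)
      qed
    qed (use int lin t in \<open>auto simp: has_integral_iff\<close>)
    then show ?thesis using lin[of "f t" t "f t - f (real t - 1)"] by (simp add: has_integral_iff)
  qed
  have split: "integral {0..real (Suc m)} f = integral {0..real m} f + integral {real m..real m + 1} f" if "Suc m \<le> b" for m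
    using Henstock_Kurzweil_Integration.integral_combine[of 0 "real m" "real m + 1" f] int[of 0 "real m + 1"] that
    by (simp add: add.commute)
  have "(\<Sum>t<m. (f (real t) + f (real t + 1)) / 2) \<le> integral {0..real m} f \<and>
    integral {0..real m} f - (\<Sum>t<m. (f (real t) + f (real t + 1)) / 2) \<le> (f (real m - 1) - f m) / 2" if "1 \<le> m" "m \<le> b" for m
    using that
  proof (induction m rule: dec_induct)
    case base
    have "integral {0..1} f \<le> f 0" "(f 0 + f 1) / 2 \<le> integral {0..1} f"
      using upper0 lower[of 0] b by auto
    then show ?case by (simp add: field_simps)
  next
    case (step m)
    have m: "Suc m \<le> b" "m < b" "1 \<le> m" using step by auto
    have "(\<Sum>t<m. (f (real t) + f (real t + 1)) / 2) \<le> integral {0..real m} f"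
      "integral {0..real m} f - (\<Sum>t<m. (f (real t) + f (real t + 1)) / 2) \<le> (f (real m - 1) - f m) / 2"
      using step by auto
    moreover have "(\<Sum>t<Suc m. (f (real t) + f (real t + 1)) / 2) = (\<Sum>t<m. (f (real t) + f (real t + 1)) / 2) + (f (real m) + f (real m + 1)) / 2"
      by simp
    moreover have "real (Suc m) - 1 = real m" "f (real (Suc m)) = f (real m + 1)" by (simp_all add: add.commute)
    ultimately show ?case
      unfolding split[OF m(1)] using lower[OF m(2)] upper[OF m(3,2)]
      by (simp add: field_simps)
  qed
  from this[of b] b show "0 \<le> integral {0..real b} f - (\<Sum>t<b. (f (real t) + f (real t + 1)) / 2)"
    "integral {0..real b} f - (\<Sum>t<b. (f (real t) + f (real t + 1)) / 2) \<le> (f (real b - 1) - f b) / 2"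
    by auto
qed

lemma convex_on_powr_nonneg:
  fixes p :: real
  assumes p: "1 \<le> p"
  shows "convex_on {0..} (\<lambda>x::real. x powr p)"
proof (rule convex_onI)
  fix t x y :: real assume t: "0 < t" "t < 1" and xy: "x \<in> {0..}" "y \<in> {0..}"
  \<comment> \<open>If one endpoint is 0, convexity reduces to \<open>c powr p \<le> c\<close> for
    \<open>0 < c < 1\<close>.\<close>
  have scale: "(c * z) powr p \<le> c * z powr p" if "0 < c" "c < 1" "0 \<le> z" for c z :: real
  proof -
    have "(c * z) powr p = c powr p * z powr p" using that by (simp add: powr_mult)
    also have "\<dots> \<le> c * z powr p"
      using that p powr_mono'[of 1 p c] by (intro mult_right_mono) auto
    finally show ?thesis .
  qed
  consider "x = 0" | "y = 0" | "0 < x" "0 < y" using xy by force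
  then show "((1 - t) *\<^sub>R x + t *\<^sub>R y) powr p \<le> (1 - t) * x powr p + t * y powr p"
  proof cases
    case 3
    then show ?thesis using convex_onD[OF powr_convex[OF p], of t x y] t by auto
  qed (use scale[of t y] scale[of "1 - t" x] t xy in auto)
qed simp

text \<open>Raising to the power \<open>\<alpha>/2 \<ge> 1\<close> linearises the problem: the
  \<open>\<alpha>/2\<close>-th power of the function is
  \<open>R powr \<alpha> - s powr \<alpha>\<close>. Convexity of \<open>x powr (\<alpha>/2)\<close>
  and then of \<open>x powr \<alpha>\<close> bounds the power of the chord by that of the
  function.\<close>

lemma concave_on_profile_squared:
  assumes \<alpha>: "2 \<le> \<alpha>" and R: "0 \<le> R"
  shows "concave_on {0..R} (\<lambda>s. (R powr \<alpha> - s powr \<alpha>) powr (2/\<alpha>))"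
  unfolding concave_on_def
proof (rule convex_onI)
  fix t x y :: real assume t: "0 < t" "t < 1" and xy: "x \<in> {0..R}" "y \<in> {0..R}"
  let ?f = "\<lambda>s. (R powr \<alpha> - s powr \<alpha>) powr (2/\<alpha>)"
  let ?z = "(1 - t) *\<^sub>R x + t *\<^sub>R y"
  have cancel: "?f s powr (\<alpha>/2) = R powr \<alpha> - s powr \<alpha>" if "s \<in> {0..R}" for s
    using that \<alpha> powr_mono2[of \<alpha> s R] by (simp add: powr_powr)
  have "((1 - t) *\<^sub>R ?f x + t *\<^sub>R ?f y) powr (\<alpha>/2) \<le> (1 - t) * ?f x powr (\<alpha>/2) + t * ?f y powr (\<alpha>/2)"
    using \<alpha> t by (intro convex_onD[OF convex_on_powr_nonneg]) auto
  also have "\<dots> = R powr \<alpha> - ((1 - t) * x powr \<alpha> + t * y powr \<alpha>)"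
    unfolding cancel[OF xy(1)] cancel[OF xy(2)] by (simp add: algebra_simps)
  also have "\<dots> \<le> R powr \<alpha> - ?z powr \<alpha>"
    using convex_onD[OF convex_on_powr_nonneg[of \<alpha>], of t x y] \<alpha> t xy by simp
  finally have "(((1 - t) *\<^sub>R ?f x + t *\<^sub>R ?f y) powr (\<alpha>/2)) powr (2/\<alpha>) \<le> ?f ?z"
    using \<alpha> by (intro powr_mono2) auto
  moreover have "0 \<le> (1 - t) *\<^sub>R ?f x + t *\<^sub>R ?f y" using t by simp
  then have "(((1 - t) *\<^sub>R ?f x + t *\<^sub>R ?f y) powr (\<alpha>/2)) powr (2/\<alpha>) = (1 - t) *\<^sub>R ?f x + t *\<^sub>R ?f y"
    unfolding powr_powr using \<alpha> by simp
  ultimately show "- ?f ?z \<le> (1 - t) * - ?f x + t * - ?f y" by simp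
qed simp

lemma profile_squared: "(profile \<alpha> R s)\<^sup>2 = (R powr \<alpha> - s powr \<alpha>) powr (2/\<alpha>)"
  by (simp add: profile_def power2_eq_square flip: powr_add)

lemma continuous_on_profile_squared:
  assumes "0 < \<alpha>"
  shows "continuous_on {-R..R} (\<lambda>s. (profile \<alpha> R \<bar>s\<bar>)\<^sup>2)"
  unfolding profile_squared
proof (rule continuous_on_powr')
  have "0 \<le> R powr \<alpha> - \<bar>s\<bar> powr \<alpha>" if "s \<in> {-R..R}" for s
    using that assms powr_mono2[of \<alpha> "\<bar>s\<bar>" R] by auto
  then show "\<forall>s\<in>{-R..R}. 0 \<le> R powr \<alpha> - \<bar>s\<bar> powr \<alpha> \<and> (R powr \<alpha> - \<bar>s\<bar> powr \<alpha> = 0 \<longrightarrow> 0 < 2/\<alpha>)"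
    using assms by auto
  have "continuous_on {-R..R} (\<lambda>s. \<bar>s\<bar> powr \<alpha>)"
    by (intro continuous_on_powr' continuous_intros) (use assms in auto)
  then show "continuous_on {-R..R} (\<lambda>s. R powr \<alpha> - \<bar>s\<bar> powr \<alpha>)"
    by (intro continuous_on_diff continuous_on_const)
qed (intro continuous_intros)

section \<open>Volume and lattice count of the body as sums over slices\<close>

lemma super_ball_slice:
  assumes \<alpha>: "0 < \<alpha>" and R: "0 < R"
  shows "(z, t) \<in> super_ball \<alpha> R \<longleftrightarrow> \<bar>t\<bar> \<le> R \<and> norm z \<le> profile \<alpha> R \<bar>t\<bar>"
proof -
  have iff: "x powr \<alpha> \<le> y powr \<alpha> \<longleftrightarrow> x \<le> y" if "0 \<le> x" "0 \<le> y" for x y :: real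
    using that \<alpha> powr_mono2[of \<alpha> x y] powr_less_mono2[of \<alpha> y x] by (cases "x \<le> y") auto
  show ?thesis
  proof (cases "\<bar>t\<bar> \<le> R")
    case True
    then have "norm z \<le> profile \<alpha> R \<bar>t\<bar> \<longleftrightarrow> norm z powr \<alpha> \<le> R powr \<alpha> - \<bar>t\<bar> powr \<alpha>"
      using iff[of "norm z" "profile \<alpha> R \<bar>t\<bar>"] profile_powr[of \<alpha> "\<bar>t\<bar>" R] \<alpha> by (simp add: profile_nonneg)
    then show ?thesis using True by (auto simp: super_ball_def)
  next
    case False
    then have "\<not> \<bar>t\<bar> powr \<alpha> \<le> R powr \<alpha>" using iff[of "\<bar>t\<bar>" R] R by simp
    then show ?thesis using False powr_ge_zero[of "norm z" \<alpha>] unfolding super_ball_def by (simp; linarith)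
  qed
qed

lemma measure_super_ball:
  assumes \<alpha>: "0 < \<alpha>" and R: "0 < R"
  shows "measure lebesgue (super_ball \<alpha> R) = 2 * integral {0..R} (\<lambda>s. pi * (profile \<alpha> R s)\<^sup>2)"
proof -
  let ?g = "\<lambda>s. pi * (profile \<alpha> R \<bar>s\<bar>)\<^sup>2"
  let ?S = "super_ball \<alpha> R"
  have S[measurable]: "?S \<in> sets borel"
  proof -
    have "(\<lambda>p :: (real^2) \<times> real. norm (fst p) powr \<alpha> + \<bar>snd p\<bar> powr \<alpha>) \<in> borel_measurable borel"
      by (intro borel_measurable_continuous_onI continuous_intros continuous_on_powr') (use \<alpha> in auto)
    then have "{p \<in> space borel. norm (fst p :: real^2) powr \<alpha> + \<bar>snd p\<bar> powr \<alpha> \<le> R powr \<alpha>} \<in> sets borel"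
      by measurable
    moreover have "?S = {p \<in> space borel. norm (fst p) powr \<alpha> + \<bar>snd p\<bar> powr \<alpha> \<le> R powr \<alpha>}"
      by (auto simp: super_ball_def)
    ultimately show ?thesis by (simp only:)
  qed
  have cont: "continuous_on {-R..R} ?g"
    by (intro continuous_intros continuous_on_profile_squared \<alpha>)
  have int: "set_integrable lborel {-R..R} ?g"
    by (rule borel_integrable_atLeastAtMost'[OF cont])
  have "emeasure lborel ?S = emeasure (lborel \<Otimes>\<^sub>M lborel) ?S" by (simp add: lborel_prod)
  also have "\<dots> = (\<integral>\<^sup>+t. emeasure lborel ((\<lambda>z. (z, t)) -` ?S) \<partial>lborel)"
    by (rule lborel_pair.emeasure_pair_measure_alt2) (unfold lborel_prod, simp)
  also have "\<dots> = (\<integral>\<^sup>+t. ennreal (indicator {-R..R} t * ?g t) \<partial>lborel)"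
  proof (rule nn_integral_cong)
    fix t :: real
    show "emeasure lborel ((\<lambda>z. (z, t)) -` ?S) = ennreal (indicator {-R..R} t * ?g t)"
    proof (cases "\<bar>t\<bar> \<le> R")
      case True
      then have "(\<lambda>z. (z, t)) -` ?S = cball 0 (profile \<alpha> R \<bar>t\<bar>)"
        using super_ball_slice[OF \<alpha> R] by auto
      then show ?thesis using True
        by (simp add: emeasure_cball profile_nonneg unit_ball_vol_2 abs_le_iff indicator_def)
    next
      case False
      then have "(\<lambda>z. (z, t)) -` ?S = {}" using super_ball_slice[OF \<alpha> R] by auto
      then show ?thesis using False by (auto simp: indicator_def abs_le_iff)
    qed
  qed
  also have "\<dots> = ennreal (\<integral>t. indicator {-R..R} t * ?g t \<partial>lborel)"
    using int by (intro nn_integral_eq_integral) (auto simp: set_integrable_def)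
  also have "(\<integral>t. indicator {-R..R} t * ?g t \<partial>lborel) = integral {-R..R} ?g"
    using set_borel_integral_eq_integral(2)[OF int] by (simp only: set_lebesgue_integral_def real_scaleR_def)
  finally have "measure lborel ?S = integral {-R..R} ?g"
    using integral_nonneg[OF integrable_continuous_interval[OF cont]] by (simp add: measure_def)
  moreover have "measure lebesgue ?S = measure lborel ?S" by simp
  moreover have "integral {-R..R} ?g = integral {-R..0} ?g + integral {0..R} ?g"
    using Henstock_Kurzweil_Integration.integral_combine[of "-R" 0 R ?g] integrable_continuous_interval[OF cont] R by simp
  moreover have "integral {-R..0} ?g = integral {0..R} ?g"
    using Henstock_Kurzweil_Integration.integral_reflect_real[of R 0 ?g] by simp
  moreover have "integral {0..R} ?g = integral {0..R} (\<lambda>s. pi * (profile \<alpha> R s)\<^sup>2)"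
    by (intro Henstock_Kurzweil_Integration.integral_cong) simp
  ultimately show ?thesis by simp
qed

lemma card_int_lattice3_super_ball:
  assumes \<alpha>: "0 < \<alpha>" and R: "0 < R"
  shows "card (int_lattice3 \<inter> super_ball \<alpha> R)
       = (\<Sum>t\<in>{-\<lfloor>R\<rfloor>..\<lfloor>R\<rfloor>}. card (lattice_disc (profile \<alpha> R \<bar>of_int t\<bar>)))"
proof -
  let ?L = "\<lambda>t::int. lattice_disc (profile \<alpha> R \<bar>of_int t\<bar>)"
  define F :: "int \<times> (int \<times> int) \<Rightarrow> (real^2) \<times> real" where
    "F = (\<lambda>(t, k). (vector [of_int (fst k), of_int (snd k)], of_int t))"
  have nv: "norm (vector [a, b] :: real^2) = norm (a, b)" for a b :: real
    by (simp add: norm_vec_def L2_set_def sum_2 norm_Pair)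
  have mem: "F (t, k) \<in> super_ball \<alpha> R \<longleftrightarrow> t \<in> {-\<lfloor>R\<rfloor>..\<lfloor>R\<rfloor>} \<and> k \<in> ?L t" for t k
  proof -
    have "\<bar>real_of_int t\<bar> \<le> R \<longleftrightarrow> t \<in> {-\<lfloor>R\<rfloor>..\<lfloor>R\<rfloor>}"
      by (simp add: abs_le_iff le_floor_iff minus_le_iff flip: of_int_minus) linarith
    then show ?thesis
      unfolding F_def by (simp add: super_ball_slice[OF \<alpha> R] nv lattice_disc_iff_norm profile_nonneg)
  qed
  have "int_lattice3 \<inter> super_ball \<alpha> R = F ` (SIGMA t:{-\<lfloor>R\<rfloor>..\<lfloor>R\<rfloor>}. ?L t)"
  proof
    show "F ` (SIGMA t:{-\<lfloor>R\<rfloor>..\<lfloor>R\<rfloor>}. ?L t) \<subseteq> int_lattice3 \<inter> super_ball \<alpha> R"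
    proof
      fix p assume "p \<in> F ` (SIGMA t:{-\<lfloor>R\<rfloor>..\<lfloor>R\<rfloor>}. ?L t)"
      then obtain t k where p: "p = F (t, k)" "t \<in> {-\<lfloor>R\<rfloor>..\<lfloor>R\<rfloor>}" "k \<in> ?L t" by auto
      have "p \<in> int_lattice3" unfolding p(1) F_def by (simp add: int_lattice3_def forall_2)
      moreover have "p \<in> super_ball \<alpha> R" unfolding p(1) using p mem by blast
      ultimately show "p \<in> int_lattice3 \<inter> super_ball \<alpha> R" by blast
    qed
    show "int_lattice3 \<inter> super_ball \<alpha> R \<subseteq> F ` (SIGMA t:{-\<lfloor>R\<rfloor>..\<lfloor>R\<rfloor>}. ?L t)"
    proof
      fix p assume p: "p \<in> int_lattice3 \<inter> super_ball \<alpha> R"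
      obtain z s where zs: "p = (z, s)" by (cases p)
      have "z $ 1 \<in> \<int>" "z $ 2 \<in> \<int>" "s \<in> \<int>" using p zs by (auto simp: int_lattice3_def)
      then obtain i j t where "z $ 1 = of_int i" "z $ 2 = of_int j" "s = of_int t" by (auto elim!: Ints_cases)
      then have pF: "p = F (t, (i, j))" by (simp add: F_def zs vec_eq_iff forall_2)
      then have "t \<in> {-\<lfloor>R\<rfloor>..\<lfloor>R\<rfloor>} \<and> (i, j) \<in> ?L t" using p mem[of t "(i, j)"] by simp
      then show "p \<in> F ` (SIGMA t:{-\<lfloor>R\<rfloor>..\<lfloor>R\<rfloor>}. ?L t)" unfolding pF by blast
    qed
  qed
  moreover have "inj F"
    by (rule injI) (auto simp: F_def vec_eq_iff forall_2)
  ultimately have "card (int_lattice3 \<inter> super_ball \<alpha> R) = card (SIGMA t:{-\<lfloor>R\<rfloor>..\<lfloor>R\<rfloor>}. ?L t)"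
    by (simp add: card_image inj_on_subset)
  then show ?thesis by (simp add: card_SigmaI finite_lattice_disc)
qed

lemma sum_abs_symmetric:
  fixes g :: "real \<Rightarrow> 'a::comm_ring_1"
  assumes "1 \<le> N"
  shows "(\<Sum>t\<in>{-int N<..<int N}. g \<bar>of_int t\<bar>) = 2 * (\<Sum>t<N. g (real t)) - g 0"
proof -
  have "{-int N<..<int N} = {-int N<..<0} \<union> {0..<int N}" using assms by auto
  then have "(\<Sum>t\<in>{-int N<..<int N}. g \<bar>of_int t\<bar>)
     = (\<Sum>t\<in>{-int N<..<0}. g \<bar>of_int t\<bar>) + (\<Sum>t\<in>{0..<int N}. g \<bar>of_int t\<bar>)"
    by (simp only:) (rule sum.union_disjoint, auto)
  also have "(\<Sum>t\<in>{0..<int N}. g \<bar>of_int t\<bar>) = (\<Sum>t<N. g (real t))"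
    by (rule sum.reindex_bij_witness[of _ int nat]) auto
  also have "(\<Sum>t\<in>{-int N<..<0}. g \<bar>of_int t\<bar>) = (\<Sum>t\<in>{1..<N}. g (real t))"
    by (rule sum.reindex_bij_witness[of _ "\<lambda>t. - int t" "\<lambda>t. nat (- t)"]) auto
  also have "(\<Sum>t\<in>{1..<N}. g (real t)) = (\<Sum>t<N. g (real t)) - g 0"
    using assms sum.atLeast_Suc_lessThan[of 0 N "\<lambda>t. g (real t)"] by (simp add: atLeast0LessThan)
  finally show ?thesis by simp
qed

section \<open>The error term\<close>

definition oscillation :: "nat \<Rightarrow> real \<Rightarrow> real" where
  "oscillation P r = (\<Sum>m\<in>{..2*P} \<times> {..2*P} - {(P, P)}.
     kern_coeff P (fst m) * kern_coeff P (snd m) * disc_hat (freq P m) r)"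

lemma smooth_count_eq: "0 < r \<Longrightarrow> smooth_count P r = pi * r\<^sup>2 + oscillation P r"
  by (simp add: smooth_count_fourier oscillation_def disc_hat_def)

text \<open>The sandwich for one slice: moving the radius by \<open>2 d\<close> costs the terms with
  \<open>4 * d * r\<close>, and the tail of the kernel costs those with \<open>e\<close>, where the
  crude count \<open>(2 r + 1)^2\<close> is enough. The oscillating part is left unestimated, since
  its cancellation appears only after summation over the slices.\<close>

lemma lattice_disc_error:
  assumes P: "1 \<le> P" and d: "0 < d" "d < 1/2" and r: "1 < r"
  defines "e \<equiv> exp (- 4 * real P * d\<^sup>2)"
  shows "real (card (lattice_disc r)) - pi * r\<^sup>2
           \<le> pi * (4 * d * r + 4 * d\<^sup>2) + 4 * sqrt (real P) * e * (2 * r + 1)\<^sup>2 + oscillation P (r + 2 * d)"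
    and "oscillation P (r - 2 * d) - pi * (4 * d * r) - 4 * real P * e * (pi * r\<^sup>2)
           \<le> real (card (lattice_disc r)) - pi * r\<^sup>2"
proof -
  have "real (card (lattice_disc r)) * (1 - 4 * sqrt (real P) * e) \<le> pi * (r + 2 * d)\<^sup>2 + oscillation P (r + 2 * d)"
    using lattice_disc_le_smooth_count[OF P d, of r] smooth_count_eq[of "r + 2 * d" P] r d by (simp add: e_def)
  moreover have "4 * sqrt (real P) * e * real (card (lattice_disc r)) \<le> 4 * sqrt (real P) * e * (2 * r + 1)\<^sup>2"
    using card_lattice_disc_le[of r] r by (intro mult_left_mono) (auto simp: e_def)
  moreover have "pi * (r + 2 * d)\<^sup>2 = pi * r\<^sup>2 + pi * (4 * d * r + 4 * d\<^sup>2)"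
    by (simp add: power2_eq_square algebra_simps)
  moreover have "real (card (lattice_disc r)) * (1 - 4 * sqrt (real P) * e)
     = real (card (lattice_disc r)) - 4 * sqrt (real P) * e * real (card (lattice_disc r))"
    by (simp add: algebra_simps)
  ultimately show "real (card (lattice_disc r)) - pi * r\<^sup>2
           \<le> pi * (4 * d * r + 4 * d\<^sup>2) + 4 * sqrt (real P) * e * (2 * r + 1)\<^sup>2 + oscillation P (r + 2 * d)"
    by linarith
  have "pi * (r - 2 * d)\<^sup>2 + oscillation P (r - 2 * d)
     \<le> real (card (lattice_disc r)) + 4 * real P * e * (pi * (r - 2 * d)\<^sup>2)"
    using smooth_count_le_lattice_disc[OF P d, of "r - 2 * d"] smooth_count_eq[of "r - 2 * d" P] r d by (simp add: e_def)
  moreover have "4 * real P * e * (pi * (r - 2 * d)\<^sup>2) \<le> 4 * real P * e * (pi * r\<^sup>2)"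
    using r d by (intro mult_left_mono power_mono) (auto simp: e_def)
  moreover have "pi * r\<^sup>2 - pi * (4 * d * r) \<le> pi * (r - 2 * d)\<^sup>2"
  proof -
    have "pi * (r - 2 * d)\<^sup>2 = pi * r\<^sup>2 - pi * (4 * d * r) + pi * (4 * d\<^sup>2)"
      by (simp add: power2_eq_square algebra_simps)
    then show ?thesis by simp
  qed
  ultimately show "oscillation P (r - 2 * d) - pi * (4 * d * r) - 4 * real P * e * (pi * r\<^sup>2)
           \<le> real (card (lattice_disc r)) - pi * r\<^sup>2"
    by linarith
qed

text \<open>Exchange the sums and use the slice bound for each frequency. With
  \<open>P \<le> R\<close> the frequency sums are \<open>O(R^(1/2))\<close> and
  \<open>O(R^(1/4))\<close>, leading to \<open>R^(3/2)\<close> and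
  \<open>R^(7/4-1/\<alpha>)\<close>.\<close>

lemma sum_oscillation_le:
  assumes \<alpha>: "2 < \<alpha>"
  obtains C where "0 \<le> C"
    "\<And>R \<sigma> P N. 4 \<le> R \<Longrightarrow> \<bar>\<sigma>\<bar> \<le> 1 \<Longrightarrow> 1 \<le> P \<Longrightarrow> real P \<le> R \<Longrightarrow> 1 \<le> N \<Longrightarrow> real N \<le> R - 1 \<Longrightarrow>
       \<bar>\<Sum>t\<in>{-int N<..<int N}. oscillation P (profile \<alpha> R \<bar>of_int t\<bar> + \<sigma>)\<bar>
         \<le> C * ((R powr (3/2) + R powr (2 - 2/\<alpha>)) * ln R)"
proof -
  obtain C where C: "0 \<le> C" and sl: "\<And>R \<sigma> q b. 4 \<le> R \<Longrightarrow> \<bar>\<sigma>\<bar> \<le> 1 \<Longrightarrow> 1 \<le> q \<Longrightarrow> real b \<le> R - 1 \<Longrightarrow>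
       \<bar>\<Sum>t<b. disc_hat q (profile \<alpha> R (real t) + \<sigma>)\<bar>
         \<le> C * ln R * (R * q powr (-1) + R powr (3/2 - 1/\<alpha>) * q powr (-3/2))"
    by (rule slice_fourier_sum[OF \<alpha>]) blast
  show thesis
  proof (rule that[of "3 * C * 208"])
    fix R \<sigma> :: real and P N :: nat
    assume R: "4 \<le> R" and \<sigma>: "\<bar>\<sigma>\<bar> \<le> 1" and P: "1 \<le> P" "real P \<le> R" and N: "1 \<le> N" "real N \<le> R - 1"
    let ?M = "{..2*P} \<times> {..2*P} - {(P, P)}"
    let ?c = "\<lambda>m. kern_coeff P (fst m) * kern_coeff P (snd m)"
    let ?Y = "R powr (3/2 - 1/\<alpha>)"
    define h where "h q s = disc_hat q (profile \<alpha> R s + \<sigma>)" for q s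
    have lnR: "1 \<le> ln R" by (rule ln_ge_1[OF R])
    have lin: "(\<Sum>m\<in>M. a m * (K * (R * x m + Y * y m))) = K * (R * (\<Sum>m\<in>M. a m * x m) + Y * (\<Sum>m\<in>M. a m * y m))"
      for M and a x y :: "nat \<times> nat \<Rightarrow> real" and K Y
      by (induction M rule: infinite_finite_induct) (simp_all add: distrib_left mult_ac)
    \<comment> \<open>The slice bound is used for \<open>N\<close> slices, twice, and for the single
      slice \<open>t = 0\<close>, once; hence the factor 3.\<close>
    have one: "\<bar>2 * (\<Sum>t<N. h q (real t)) - h q 0\<bar> \<le> 3 * (C * ln R * (R * q powr (-1) + ?Y * q powr (-3/2)))"
      if q: "1 \<le> q" for q
      using sl[OF R \<sigma> q N(2)] sl[OF R \<sigma> q, of 1] N R unfolding h_def by simp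
    have sw: "(\<Sum>t\<in>{-int N<..<int N}. oscillation P (profile \<alpha> R \<bar>of_int t\<bar> + \<sigma>))
       = (\<Sum>m\<in>?M. ?c m * (\<Sum>t\<in>{-int N<..<int N}. h (freq P m) \<bar>of_int t\<bar>))"
      unfolding oscillation_def h_def sum_distrib_left by (rule sum.swap)
    have "\<bar>\<Sum>t\<in>{-int N<..<int N}. oscillation P (profile \<alpha> R \<bar>of_int t\<bar> + \<sigma>)\<bar>
       = \<bar>\<Sum>m\<in>?M. ?c m * (2 * (\<Sum>t<N. h (freq P m) (real t)) - h (freq P m) 0)\<bar>"
      unfolding sw by (simp only: sum_abs_symmetric[OF N(1)])
    also have "\<dots> \<le> (\<Sum>m\<in>?M. ?c m * (3 * C * ln R * (R * freq P m powr (-1) + ?Y * freq P m powr (-3/2))))"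
    proof (intro order.trans[OF sum_abs] sum_mono)
      fix m assume "m \<in> ?M"
      then have "1 \<le> freq P m" by (intro freq_ge(2)) auto
      from one[OF this] show "\<bar>?c m * (2 * (\<Sum>t<N. h (freq P m) (real t)) - h (freq P m) 0)\<bar>
         \<le> ?c m * (3 * C * ln R * (R * freq P m powr (-1) + ?Y * freq P m powr (-3/2)))"
        by (simp add: mult.assoc abs_mult kern_coeff_nonneg mult_left_mono)
    qed
    also have "\<dots> = 3 * C * ln R * (R * (\<Sum>m\<in>?M. ?c m * freq P m powr (-1)) + ?Y * (\<Sum>m\<in>?M. ?c m * freq P m powr (-3/2)))"
      by (rule lin)
    \<comment> \<open>The constants are \<open>(4 + 2 / (1 - u))^2\<close> at \<open>u = 1/2\<close>
      and at \<open>u = 3/4\<close>.\<close>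
    also have "\<dots> \<le> 3 * C * ln R * (R * (64 * R powr (1/2)) + ?Y * (144 * R powr (1/4)))"
    proof -
      have "(\<Sum>m\<in>?M. ?c m * freq P m powr (-1)) \<le> 64 * real P powr (1/2)"
        using sum_freq_powr_le[of "1/2" P] P by simp
      also have "\<dots> \<le> 64 * R powr (1/2)" using P by (intro mult_left_mono powr_mono2) auto
      finally have 1: "(\<Sum>m\<in>?M. ?c m * freq P m powr (-1)) \<le> 64 * R powr (1/2)" .
      have "(\<Sum>m\<in>?M. ?c m * freq P m powr (-3/2)) \<le> 144 * real P powr (1/4)"
        using sum_freq_powr_le[of "3/4" P] P by simp
      also have "\<dots> \<le> 144 * R powr (1/4)" using P by (intro mult_left_mono powr_mono2) auto
      finally have 2: "(\<Sum>m\<in>?M. ?c m * freq P m powr (-3/2)) \<le> 144 * R powr (1/4)" .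
      show ?thesis using C lnR R by (intro mult_left_mono add_mono 1 2) auto
    qed
    also have "R * (64 * R powr (1/2)) = 64 * R powr (3/2)"
      using powr_mult_base[of R "1/2"] R by simp
    also have "?Y * (144 * R powr (1/4)) = 144 * R powr (7/4 - 1/\<alpha>)"
      by (simp add: powr_add[symmetric])
    also have "3 * C * ln R * (64 * R powr (3/2) + 144 * R powr (7/4 - 1/\<alpha>))
      \<le> 3 * C * ln R * (208 * (R powr (3/2) + R powr (2 - 2/\<alpha>)))"
    proof -
      \<comment> \<open>The left side is the geometric mean of the two terms on the right, hence at
        most the larger one; which one that is depends on whether \<alpha> is at most 4.\<close>
      have "R powr (7/4 - 1/\<alpha>) \<le> R powr (3/2) + R powr (2 - 2/\<alpha>)"
      proof (cases "1/\<alpha> \<ge> 1/4")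
        case True
        then have "R powr (7/4 - 1/\<alpha>) \<le> R powr (3/2)" using R by (intro powr_mono) auto
        then show ?thesis by (simp add: add_increasing2)
      next
        case False
        then have "R powr (7/4 - 1/\<alpha>) \<le> R powr (2 - 2/\<alpha>)" using R by (intro powr_mono) auto
        then show ?thesis by (simp add: add_increasing)
      qed
      moreover have "0 \<le> R powr (2 - 2/\<alpha>)" by simp
      ultimately have "64 * R powr (3/2) + 144 * R powr (7/4 - 1/\<alpha>) \<le> 208 * (R powr (3/2) + R powr (2 - 2/\<alpha>))"
        by argo
      then show ?thesis using C lnR by (intro mult_left_mono) auto
    qed
    finally show "\<bar>\<Sum>t\<in>{-int N<..<int N}. oscillation P (profile \<alpha> R \<bar>of_int t\<bar> + \<sigma>)\<bar>
         \<le> 3 * C * 208 * ((R powr (3/2) + R powr (2 - 2/\<alpha>)) * ln R)"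
      by (simp add: mult_ac)
  qed (use C in simp)
qed

text \<open>The trapezoidal rule is applied up to \<open>N\<close> only. Its error and the integral
  over the cap beyond \<open>N\<close>, of height at most 2, are both controlled by slice areas
  within distance 3 of the pole.\<close>

lemma sum_slice_areas:
  assumes \<alpha>: "2 < \<alpha>" and R: "4 \<le> R" and N: "R - 2 \<le> real N" "real N \<le> R - 1"
  shows "\<bar>(\<Sum>t\<in>{-int N<..<int N}. pi * (profile \<alpha> R \<bar>of_int t\<bar>)\<^sup>2) - measure lebesgue (super_ball \<alpha> R)\<bar>
       \<le> 5 * pi * (3 * \<alpha>) powr (2/\<alpha>) * R powr (2 - 2/\<alpha>)"
proof -
  define f where "f s = pi * (profile \<alpha> R s)\<^sup>2" for s
  have N1: "1 \<le> N" using N(1) R by linarith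
  have sub: "{0..real N} \<subseteq> {0..R}" using N by auto
  have anti: "f t \<le> f s" if "0 \<le> s" "s \<le> t" "t \<le> R" for s t
    unfolding f_def using that \<alpha> by (intro mult_left_mono power_mono profile_antimono profile_nonneg) auto
  have f0: "0 \<le> f s" for s by (simp add: f_def)
  have "concave_on {0..R} (\<lambda>s. pi * (R powr \<alpha> - s powr \<alpha>) powr (2/\<alpha>))"
    using \<alpha> R by (intro concave_on_cmul concave_on_profile_squared) auto
  then have conc: "concave_on {0..real N} f"
    unfolding f_def profile_squared concave_on_def using sub by (rule convex_on_subset) simp
  have "continuous_on {0..R} (\<lambda>s. pi * (profile \<alpha> R \<bar>s\<bar>)\<^sup>2)"
    by (intro continuous_intros continuous_on_subset[OF continuous_on_profile_squared]) (use \<alpha> in auto)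
  then have contR: "continuous_on {0..R} f"
    by (rule continuous_on_eq) (auto simp: f_def)
  have cont: "continuous_on {0..real N} f" by (rule continuous_on_subset[OF contR sub])
  have trap: "0 \<le> integral {0..real N} f - (\<Sum>t<N. (f (real t) + f (real t + 1)) / 2)"
    "integral {0..real N} f - (\<Sum>t<N. (f (real t) + f (real t + 1)) / 2) \<le> (f (real N - 1) - f N) / 2"
    by (rule trapezoid_sum_concave[OF conc _ cont N1]; use anti N in force)+
  have tr: "2 * (\<Sum>t<N. (f (real t) + f (real t + 1)) / 2) = 2 * (\<Sum>t<N. f (real t)) - f 0 + f N"
  proof -
    have "2 * (\<Sum>t<m. (f (real t) + f (real t + 1)) / 2) = 2 * (\<Sum>t<m. f (real t)) - f 0 + f (real m)" for m :: nat
      by (induction m) (auto simp: field_simps)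
    then show ?thesis .
  qed
  have int: "f integrable_on {0..R}" by (rule integrable_continuous_interval[OF contR])
  have spl: "integral {0..R} f = integral {0..real N} f + integral {real N..R} f"
    using Henstock_Kurzweil_Integration.integral_combine[of 0 "real N" R f] int N by simp
  have intN: "f integrable_on {real N..R}"
    by (rule integrable_continuous_interval, rule continuous_on_subset[OF contR]) auto
  have t0: "0 \<le> integral {real N..R} f" by (intro Henstock_Kurzweil_Integration.integral_nonneg intN f0)
  have t1: "integral {real N..R} f \<le> 2 * f N"
  proof -
    have "integral {real N..R} f \<le> integral {real N..R} (\<lambda>_::real. f N)"
      by (rule integral_le) (use intN anti in auto)
    also have "\<dots> = (R - real N) * f N" using N by simp
    also have "\<dots> \<le> 2 * f N" using N f0 by (intro mult_right_mono) auto
    finally show ?thesis .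
  qed
  have last: "f N \<le> f (real N - 1)" using anti[of "real N - 1" N] N N1 by simp
  have fb: "f (real N - 1) \<le> pi * ((3 * \<alpha>) powr (2/\<alpha>) * R powr (2 - 2/\<alpha>))"
    unfolding f_def using \<alpha> N R by (intro mult_left_mono profile_squared_le) auto
  define T A B V I where "T = (\<Sum>t<N. (f (real t) + f (real t + 1)) / 2)" and "A = (\<Sum>t<N. f (real t))"
    and "B = (\<Sum>t\<in>{-int N<..<int N}. f \<bar>of_int t\<bar>)"
    and "V = pi * ((3 * \<alpha>) powr (2/\<alpha>) * R powr (2 - 2/\<alpha>))" and "I = integral {0..R} f"
  have BA: "B = 2 * A - f 0"
    unfolding A_def B_def by (rule sum_abs_symmetric[OF N1])
  have m: "measure lebesgue (super_ball \<alpha> R) = 2 * I"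
    using measure_super_ball[of \<alpha> R] \<alpha> R by (simp only: f_def[abs_def] I_def)
  define U W y z where "U = integral {0..real N} f" and "W = integral {real N..R} f"
    and "y = f (real N)" and "z = f (real N - 1)"
  \<comment> \<open>These facts give \<open>B - 2 I = 2 (T - U) - y - 2 W\<close>, of absolute value
    at most \<open>(z - y) + y + 4 y = z + 4 y \<le> 5 V\<close>.\<close>
  have "z \<le> V" "0 \<le> U - T" "U - T \<le> (z - y) / 2" "2 * T = 2 * A - f 0 + y" "I = U + W"
    "0 \<le> W" "W \<le> 2 * y" "y \<le> z" "0 \<le> y"
    using fb trap tr spl t0 t1 last f0[of N] by (simp_all only: V_def T_def A_def I_def U_def W_def y_def z_def)
  then have "\<bar>B - 2 * I\<bar> \<le> 5 * V" using BA by argo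
  then have "\<bar>B - measure lebesgue (super_ball \<alpha> R)\<bar> \<le> 5 * V" by (simp only: m)
  then have "\<bar>B - measure lebesgue (super_ball \<alpha> R)\<bar> \<le> 5 * pi * (3 * \<alpha>) powr (2/\<alpha>) * R powr (2 - 2/\<alpha>)"
    by (simp only: mult.assoc V_def)
  then show ?thesis by (simp only: B_def f_def)
qed

text \<open>Summing the one-slice sandwich, the oscillating parts are bounded by
  \<open>sum_oscillation_le\<close> with the shifts \<open>2 d\<close> and \<open>- 2 d\<close>, and
  the rest is at most \<open>20 d R + 1\<close> for each of at most \<open>2 R\<close>
  slices.\<close>

lemma sum_lattice_disc_error:
  assumes \<alpha>: "2 < \<alpha>"
  obtains K where
    "\<And>R N. 16 \<le> R \<Longrightarrow> 8 * ln R < R - 1 \<Longrightarrow> int N = \<lfloor>R\<rfloor> - 1 \<Longrightarrow>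
      \<bar>\<Sum>t\<in>{-int N<..<int N}. real (card (lattice_disc (profile \<alpha> R \<bar>of_int t\<bar>))) - pi * (profile \<alpha> R \<bar>of_int t\<bar>)\<^sup>2\<bar>
        \<le> K * ((R powr (3/2) + R powr (2 - 2/\<alpha>)) * ln R)"
proof -
  obtain C where C: "0 \<le> C" and osc: "\<And>R \<sigma> P N. 4 \<le> R \<Longrightarrow> \<bar>\<sigma>\<bar> \<le> 1 \<Longrightarrow> 1 \<le> P \<Longrightarrow> real P \<le> R \<Longrightarrow> 1 \<le> N \<Longrightarrow> real N \<le> R - 1 \<Longrightarrow>
       \<bar>\<Sum>t\<in>{-int N<..<int N}. oscillation P (profile \<alpha> R \<bar>of_int t\<bar> + \<sigma>)\<bar>
         \<le> C * ((R powr (3/2) + R powr (2 - 2/\<alpha>)) * ln R)"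
    by (rule sum_oscillation_le[OF \<alpha>]) blast
  show thesis
  proof (rule that[of "C + 82"])
    fix R :: real and N :: nat
    assume R: "16 \<le> R" and lnR8: "8 * ln R < R - 1" and N: "int N = \<lfloor>R\<rfloor> - 1"
    define G where "G = (R powr (3/2) + R powr (2 - 2/\<alpha>)) * ln R"
    \<comment> \<open>\<open>P\<close> is the integer part of \<open>R\<close>, and \<open>d\<close>
      is chosen to make \<open>exp (- 4 P d^2)\<close> equal to \<open>R^(-8)\<close>, which
      outweighs every polynomial factor. The hypothesis \<open>8 * ln R < R - 1\<close> ensures
      \<open>d < 1/2\<close>.\<close>
    define P where "P = Suc N"
    define d where "d = sqrt (2 * ln R / real P)"
    define e where "e = exp (- 4 * real P * d\<^sup>2)"
    have lnR: "1 \<le> ln R" using ln_ge_1[of R] R by simp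
    have PR: "real P = of_int \<lfloor>R\<rfloor>" unfolding P_def using N by simp
    have P: "real P \<le> R" "R - 1 < real P" "1 \<le> P" using PR R by (linarith, linarith, simp add: P_def)
    have P0: "0 < real P" using P by simp
    have NR: "real N \<le> R - 1" "R - 2 \<le> real N" "1 \<le> N" using P R by (simp_all add: P_def)
    have d2: "d\<^sup>2 = 2 * ln R / real P" unfolding d_def using lnR P by simp
    have d0: "0 < d" unfolding d_def real_sqrt_gt_0_iff using lnR P0 by (intro divide_pos_pos) auto
    have "8 * ln R < real P" using lnR8 P by linarith
    then have "d\<^sup>2 < (1/2)\<^sup>2" unfolding d2 using P0 by (simp add: divide_less_eq power2_eq_square)
    then have dh: "d < 1/2" by (rule power2_less_imp_less) simp
    \<comment> \<open>The smoothing width costs only \<open>sqrt (ln R)\<close>; it is weakened to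
      \<open>ln R\<close> to match the claimed bound.\<close>
    have dR: "d * (R * R) \<le> 2 * (ln R * R powr (3/2))"
    proof -
      have "d\<^sup>2 \<le> 2 * ln R / (R / 2)" unfolding d2
        using P lnR R by (intro divide_left_mono) auto
      also have "\<dots> \<le> 4 * (ln R * ln R) / R"
        using lnR R mult_left_mono[of 1 "ln R" "ln R"] by (simp add: divide_right_mono)
      also have "\<dots> = (2 * ln R / sqrt R)\<^sup>2" using R by (simp add: power_divide power_mult_distrib power2_eq_square)
      finally have "d \<le> 2 * ln R / sqrt R" by (rule power2_le_imp_le) (use lnR R in auto)
      then have "d * (R * R) \<le> 2 * ln R / sqrt R * (R * R)" using R by (intro mult_right_mono) auto
      moreover have "R * R = R powr (3/2) * sqrt R"
        using R by (simp add: powr_half_sqrt[symmetric] powr_add[symmetric] power2_eq_square[symmetric] flip: powr_numeral)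
      moreover have "2 * ln R / sqrt R * (R powr (3/2) * sqrt R) = 2 * (ln R * R powr (3/2))" using R by simp
      ultimately show ?thesis by (simp only:)
    qed
    have "R ^ 8 = exp (8 * ln R)" using R by (simp add: exp_of_nat_mult[of 8 "ln R", simplified])
    then have e: "e = 1 / R ^ 8" unfolding e_def d2 using P by (simp add: exp_minus field_simps)
    define \<omega> where "\<omega> = 4 * real P * e * (2 * R + 1)\<^sup>2"
    have \<omega>: "\<omega> \<le> 1"
    proof -
      have "4 * real P * (2 * R + 1)\<^sup>2 \<le> 4 * R * (3 * R)\<^sup>2"
        using P R by (intro mult_mono power_mono) auto
      also have "\<dots> = 36 * R ^ 3" by (simp add: power2_eq_square power3_eq_cube)
      also have "\<dots> \<le> R ^ 5 * R ^ 3"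
      proof (intro mult_right_mono)
        have "(36::real) \<le> 16 ^ 5" by simp
        also have "\<dots> \<le> R ^ 5" using R by (intro power_mono) auto
        finally show "36 \<le> R ^ 5" .
      qed (use R in auto)
      also have "\<dots> = R ^ 8" by (simp flip: power_add)
      finally have "4 * real P * (2 * R + 1)\<^sup>2 / R ^ 8 \<le> 1" using R by simp
      then show ?thesis by (simp add: \<omega>_def e)
    qed
    have e0: "0 \<le> e" by (simp add: e_def)
    let ?r = "\<lambda>t::int. profile \<alpha> R \<bar>of_int t\<bar>"
    let ?I = "{-int N<..<int N}"
    let ?E = "\<lambda>t. real (card (lattice_disc (?r t))) - pi * (?r t)\<^sup>2"
    have bound: "oscillation P (?r t - 2 * d) - (20 * d * R + 1) \<le> ?E t"
      "?E t \<le> oscillation P (?r t + 2 * d) + (20 * d * R + 1)" if t: "t \<in> ?I" for t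
    proof -
      have t1: "\<bar>of_int t :: real\<bar> \<le> R - 1"
      proof -
        have "\<bar>t\<bar> \<le> int N" using t by auto
        then have "\<bar>of_int t :: real\<bar> \<le> real N" by linarith
        then show ?thesis using NR by linarith
      qed
      have "1 < R powr (1 - 1/\<alpha>)" using R \<alpha> by (intro gr_one_powr) auto
      also have "\<dots> \<le> ?r t" using \<alpha> t1 by (intro profile_ge) auto
      finally have r1: "1 < ?r t" .
      have rR: "?r t \<le> R" using \<alpha> t1 by (intro profile_le) auto
      have "d * ?r t \<le> d * R" using rR d0 by simp
      moreover have "4 * d\<^sup>2 \<le> d * R"
      proof -
        have "(4 * d) * d \<le> R * d" using dh R d0 by (intro mult_right_mono) auto
        then show ?thesis by (simp add: power2_eq_square mult_ac)
      qed
      ultimately have "4 * d * ?r t + 4 * d\<^sup>2 \<le> 5 * (d * R)" by simp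
      moreover have "0 \<le> 4 * d * ?r t" "0 \<le> 4 * d\<^sup>2" using d0 r1 by auto
      moreover have "pi * x \<le> 4 * y" if "0 \<le> x" "x \<le> y" for x y
        by (rule mult_mono) (use that pi_less_4 in auto)
      ultimately have A: "pi * (4 * d * ?r t + 4 * d\<^sup>2) \<le> 4 * (5 * (d * R))" "pi * (4 * d * ?r t) \<le> 4 * (5 * (d * R))"
        by (smt (verit))+
      have sq: "sqrt (real P) \<le> real P"
        using P(3) real_sqrt_le_mono[of "real P" "(real P)\<^sup>2"] by (simp add: self_le_power)
      have B1: "4 * sqrt (real P) * e * (2 * ?r t + 1)\<^sup>2 \<le> \<omega>"
        unfolding \<omega>_def using sq e0 rR r1 by (intro mult_mono power_mono) auto
      have "pi * (?r t)\<^sup>2 \<le> (2 * R + 1)\<^sup>2"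
      proof -
        have "pi * (?r t)\<^sup>2 \<le> 4 * R\<^sup>2" using pi_less_4 rR r1 by (intro mult_mono power_mono) auto
        also have "\<dots> = (2 * R)\<^sup>2" by (simp add: power_mult_distrib)
        also have "\<dots> \<le> (2 * R + 1)\<^sup>2" using R by (intro power_mono) auto
        finally show ?thesis .
      qed
      then have B2: "4 * real P * e * (pi * (?r t)\<^sup>2) \<le> \<omega>"
        unfolding \<omega>_def using e0 by (intro mult_left_mono) auto
      note err = lattice_disc_error[OF P(3) d0 dh r1, folded e_def]
      show "?E t \<le> oscillation P (?r t + 2 * d) + (20 * d * R + 1)"
        using err(1) A(1) B1 \<omega> by linarith
      show "oscillation P (?r t - 2 * d) - (20 * d * R + 1) \<le> ?E t"
        using err(2) A(2) B2 \<omega> by linarith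
    qed
    have cI: "real (card ?I) \<le> 2 * R" using NR by simp
    \<comment> \<open>The product is at most \<open>40 d R^2 + 2 R\<close>, and \<open>dR\<close>
      turns this into \<open>80 + 2 = 82\<close> multiples of
      \<open>ln R * R powr (3/2)\<close>.\<close>
    have small: "real (card ?I) * (20 * d * R + 1) \<le> 82 * G"
    proof -
      have "real (card ?I) * (20 * d * R + 1) \<le> (2 * R) * (20 * d * R + 1)"
        using cI d0 R by (intro mult_right_mono) auto
      also have "\<dots> = 40 * (d * (R * R)) + 2 * R" by (simp add: algebra_simps)
      also have "\<dots> \<le> 40 * (2 * (ln R * R powr (3/2))) + 2 * (ln R * R powr (3/2))"
      proof (intro add_mono mult_left_mono dR)
        have "R = R powr 1" using R by simp
        also have "\<dots> \<le> R powr (3/2)" using R by (intro powr_mono) auto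
        also have "\<dots> \<le> ln R * R powr (3/2)" using lnR mult_right_mono[of 1 "ln R" "R powr (3/2)"] by simp
        finally show "R \<le> ln R * R powr (3/2)" .
      qed auto
      also have "\<dots> \<le> 82 * G" using lnR by (simp add: G_def algebra_simps)
      finally show ?thesis .
    qed
    have addc: "(\<Sum>t\<in>A. f t + k) = sum f A + real (card A) * k"
      and subc: "(\<Sum>t\<in>A. f t - k) = sum f A - real (card A) * k" for f :: "int \<Rightarrow> real" and k A
      by (simp_all only: sum.distrib sum_subtractf sum_constant)
    have sg: "\<bar>2 * d\<bar> \<le> 1" "\<bar>- 2 * d\<bar> \<le> 1" using d0 dh by auto
    have R4: "4 \<le> R" using R by simp
    have up: "\<bar>\<Sum>t\<in>?I. oscillation P (?r t + 2 * d)\<bar> \<le> C * G"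
      unfolding G_def by (rule osc[OF R4 sg(1) P(3,1) NR(3,1)])
    have lo: "\<bar>\<Sum>t\<in>?I. oscillation P (?r t - 2 * d)\<bar> \<le> C * G"
      using osc[OF R4 sg(2) P(3,1) NR(3,1)] by (simp add: G_def)
    have "sum ?E ?I \<le> (\<Sum>t\<in>?I. oscillation P (?r t + 2 * d) + (20 * d * R + 1))"
      by (intro sum_mono bound(2))
    also have "\<dots> = (\<Sum>t\<in>?I. oscillation P (?r t + 2 * d)) + real (card ?I) * (20 * d * R + 1)"
      by (rule addc)
    also have "\<dots> \<le> C * G + 82 * G"
      by (intro add_mono small order.trans[OF abs_ge_self up])
    finally have 1: "sum ?E ?I \<le> (C + 82) * G" by (simp only: distrib_right)
    have "(\<Sum>t\<in>?I. oscillation P (?r t - 2 * d) - (20 * d * R + 1)) \<le> sum ?E ?I"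
      by (intro sum_mono bound(1))
    moreover have "(\<Sum>t\<in>?I. oscillation P (?r t - 2 * d) - (20 * d * R + 1))
       = (\<Sum>t\<in>?I. oscillation P (?r t - 2 * d)) - real (card ?I) * (20 * d * R + 1)"
      by (rule subc)
    ultimately have lo': "(\<Sum>t\<in>?I. oscillation P (?r t - 2 * d)) - real (card ?I) * (20 * d * R + 1) \<le> sum ?E ?I"
      by (simp only:)
    have "- z \<le> (C + 82) * G" if "x - y \<le> z" "\<bar>x\<bar> \<le> C * G" "y \<le> 82 * G" for x y z
      using that unfolding distrib_right by linarith
    from this[OF lo' lo small] have 2: "- sum ?E ?I \<le> (C + 82) * G" .
    show "\<bar>sum ?E ?I\<bar> \<le> (C + 82) * ((R powr (3/2) + R powr (2 - 2/\<alpha>)) * ln R)"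
      using 1 2 unfolding G_def by (rule abs_leI)
  qed
qed

text \<open>The four slices with \<open>\<bar>t\<bar>\<close> equal to \<open>N\<close> or
  \<open>N + 1\<close> are kept out of the exponential sums, since the outermost radius may be
  arbitrarily small. A trivial count suffices for them because their radius squared is already
  \<open>O(R powr (2 - 2/\<alpha>))\<close>.\<close>

lemma lattice_point_error_bound:
  assumes \<alpha>: "2 < \<alpha>"
  obtains C where
    "\<And>R. 16 \<le> R \<Longrightarrow> 8 * ln R < R - 1 \<Longrightarrow>
      \<bar>real (card (int_lattice3 \<inter> super_ball \<alpha> R)) - measure lebesgue (super_ball \<alpha> R)\<bar>
        \<le> C * ((R powr (3/2) + R powr (2 - 2/\<alpha>)) * ln R)"
proof -
  obtain K where K: "\<And>R N. 16 \<le> R \<Longrightarrow> 8 * ln R < R - 1 \<Longrightarrow> int N = \<lfloor>R\<rfloor> - 1 \<Longrightarrow>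
      \<bar>\<Sum>t\<in>{-int N<..<int N}. real (card (lattice_disc (profile \<alpha> R \<bar>of_int t\<bar>))) - pi * (profile \<alpha> R \<bar>of_int t\<bar>)\<^sup>2\<bar>
        \<le> K * ((R powr (3/2) + R powr (2 - 2/\<alpha>)) * ln R)"
    by (rule sum_lattice_disc_error[OF \<alpha>]) blast
  define c1 where "c1 = (2 * \<alpha>) powr (2/\<alpha>)"
  define c2 where "c2 = 5 * pi * (3 * \<alpha>) powr (2/\<alpha>)"
  show thesis
  proof (rule that[of "K + 4 * (8 * c1 + 2) + c2"])
    fix R :: real
    assume R: "16 \<le> R" and lnR8: "8 * ln R < R - 1"
    define G where "G = (R powr (3/2) + R powr (2 - 2/\<alpha>)) * ln R"
    define N where "N = nat (\<lfloor>R\<rfloor> - 1)"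
    have "16 \<le> \<lfloor>R\<rfloor>" using R by (simp add: le_floor_iff)
    then have N: "int N = \<lfloor>R\<rfloor> - 1" "1 \<le> N" unfolding N_def by linarith+
    have NR: "R - 2 \<le> real N" "real N \<le> R - 1" using N(1) by linarith+
    have lnR: "1 \<le> ln R" using ln_ge_1[of R] R by simp
    have GR: "R powr (2 - 2/\<alpha>) \<le> G" and G1: "1 \<le> G"
    proof -
      have "1 \<le> R powr (3/2)" using R by (intro ge_one_powr_ge_zero) auto
      moreover have "R powr (3/2) + R powr (2 - 2/\<alpha>) \<le> G"
        unfolding G_def using mult_left_mono[OF lnR, of "R powr (3/2) + R powr (2 - 2/\<alpha>)"] by simp
      moreover have "0 \<le> R powr (2 - 2/\<alpha>)" by simp
      ultimately show "R powr (2 - 2/\<alpha>) \<le> G" "1 \<le> G" by linarith+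
    qed
    let ?c = "\<lambda>t::int. real (card (lattice_disc (profile \<alpha> R \<bar>of_int t\<bar>)))"
    let ?a = "\<lambda>t::int. pi * (profile \<alpha> R \<bar>of_int t\<bar>)\<^sup>2"
    let ?I = "{-int N<..<int N}"
    let ?J = "{- int N - 1, - int N, int N, int N + 1}"
    have fl: "\<lfloor>R\<rfloor> = int N + 1" using N by simp
    have "{-\<lfloor>R\<rfloor>..\<lfloor>R\<rfloor>} = ?I \<union> ?J" unfolding fl using N(2) by auto
    then have "real (card (int_lattice3 \<inter> super_ball \<alpha> R)) = sum ?c (?I \<union> ?J)"
      using card_int_lattice3_super_ball[of \<alpha> R] \<alpha> R by simp
    also have "\<dots> = sum ?c ?I + sum ?c ?J"
      by (rule sum.union_disjoint) auto
    finally have card: "real (card (int_lattice3 \<inter> super_ball \<alpha> R)) = sum ?c ?I + sum ?c ?J" .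
    have edge: "?c t \<le> (8 * c1 + 2) * G" if t: "t \<in> ?J" for t
    proof -
      let ?r = "profile \<alpha> R \<bar>of_int t\<bar>"
      have t': "\<bar>t\<bar> = int N \<or> \<bar>t\<bar> = int N + 1" using t by auto
      then have "\<bar>of_int t :: real\<bar> = real N \<or> \<bar>of_int t :: real\<bar> = real N + 1" by linarith
      then have "?r\<^sup>2 \<le> c1 * R powr (2 - 2/\<alpha>)"
        unfolding c1_def using \<alpha> NR N R by (intro profile_squared_le) auto
      also have "\<dots> \<le> c1 * G" using GR by (intro mult_left_mono) (auto simp: c1_def)
      finally have r: "?r\<^sup>2 \<le> c1 * G" .
      have "?c t \<le> (2 * ?r + 1)\<^sup>2" by (rule card_lattice_disc_le[OF profile_nonneg])
      also have "\<dots> \<le> 8 * ?r\<^sup>2 + 2"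
      proof -
        have "0 \<le> (2 * ?r - 1)\<^sup>2" by simp
        then show ?thesis by (simp add: power2_eq_square algebra_simps)
      qed
      also have "\<dots> \<le> 8 * (c1 * G) + 2 * G" using r G1 by linarith
      finally show ?thesis by (simp add: algebra_simps)
    qed
    have "sum ?c ?J \<le> of_nat (card ?J) * ((8 * c1 + 2) * G)"
      by (rule sum_bounded_above) (rule edge)
    also have "card ?J = 4" using N by simp
    also have "of_nat 4 * ((8 * c1 + 2) * G) = 4 * (8 * c1 + 2) * G" by simp
    finally have J: "sum ?c ?J \<le> 4 * (8 * c1 + 2) * G" .
    have J0: "0 \<le> sum ?c ?J" by (intro sum_nonneg) simp
    have I: "\<bar>sum ?c ?I - sum ?a ?I\<bar> \<le> K * G"
      using K[OF R lnR8 N(1)] by (simp only: G_def sum_subtractf)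
    have "\<bar>sum ?a ?I - measure lebesgue (super_ball \<alpha> R)\<bar> \<le> c2 * R powr (2 - 2/\<alpha>)"
      unfolding c2_def by (rule sum_slice_areas[OF \<alpha> _ NR]) (use R in simp)
    also have "\<dots> \<le> c2 * G" using GR by (intro mult_left_mono) (auto simp: c2_def)
    finally have V: "\<bar>sum ?a ?I - measure lebesgue (super_ball \<alpha> R)\<bar> \<le> c2 * G" .
    define A B D where "A = sum ?c ?I" and "B = sum ?a ?I" and "D = sum ?c ?J"
    have "\<bar>A + D - measure lebesgue (super_ball \<alpha> R)\<bar> \<le> K * G + 4 * (8 * c1 + 2) * G + c2 * G"
      using J[folded D_def] J0[folded D_def] I[folded A_def B_def] V[folded B_def] by linarith
    then show "\<bar>real (card (int_lattice3 \<inter> super_ball \<alpha> R)) - measure lebesgue (super_ball \<alpha> R)\<bar>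
        \<le> (K + 4 * (8 * c1 + 2) + c2) * ((R powr (3/2) + R powr (2 - 2/\<alpha>)) * ln R)"
      unfolding card A_def D_def G_def[symmetric] by (simp only: distrib_right)
  qed
qed

theorem theorem6p1:
  fixes \<alpha> :: real
  assumes "\<alpha> > 2"
  shows "(\<lambda>R::real. \<bar>real (card (int_lattice3 \<inter> super_ball \<alpha> R)) - measure lebesgue (super_ball \<alpha> R)\<bar>)
           \<in> O[at_top](\<lambda>R. (R powr (3/2) + R powr (2 - 2/\<alpha>)) * ln R)"
proof -
  obtain C where C: "\<And>R. 16 \<le> R \<Longrightarrow> 8 * ln R < R - 1 \<Longrightarrow>
      \<bar>real (card (int_lattice3 \<inter> super_ball \<alpha> R)) - measure lebesgue (super_ball \<alpha> R)\<bar>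
        \<le> C * ((R powr (3/2) + R powr (2 - 2/\<alpha>)) * ln R)"
    by (rule lattice_point_error_bound[OF assms]) blast
  have "eventually (\<lambda>R::real. 8 * ln R < R - 1) at_top" by real_asymp
  moreover have "eventually (\<lambda>R::real. 16 \<le> R) at_top" by (rule eventually_ge_at_top)
  ultimately have "eventually (\<lambda>R. norm \<bar>real (card (int_lattice3 \<inter> super_ball \<alpha> R)) - measure lebesgue (super_ball \<alpha> R)\<bar>
      \<le> C * norm ((R powr (3/2) + R powr (2 - 2/\<alpha>)) * ln R)) at_top"
  proof eventually_elim
    case (elim R)
    then have "0 \<le> ln R" by simp
    then have "norm ((R powr (3/2) + R powr (2 - 2/\<alpha>)) * ln R) = (R powr (3/2) + R powr (2 - 2/\<alpha>)) * ln R"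
      by (simp add: abs_mult)
    then show ?case using C[of R] elim by (simp only: real_norm_def abs_idempotent)
  qed
  then show ?thesis by (rule bigoI)
qed

end
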